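(* Let $A$ and $B$ be finite sets. Let $H$ be a nonzero finite-dimensional Hilbert space, and let $\mathcal X$ be the quantum set defined by $\mathrm{At}(\mathcal X) = \{H\}$. Consider the one-to-one correspondence between families of projections $(p_{ab} \in L(H) \,|\, a \in A,\, b \in B)$ such that $\sum_{b \in B} p_{ab} = 1_H$ for all $a \in A$ and functions $F: \mathcal X \times `A \to `B$, given by $F(H \otimes \mathbb C_a, \mathbb C_b)= L(H \otimes \mathbb C_a, \mathbb C_b)\cdot (p_{ab} \otimes 1)$ for $a \in A$ and $b \in B$. This correspondence restricts to a one-to-one correspondence between families of projections $(p_{ab} \in L(H) \,|\, a \in A, \, b \in B)$ that are magic unitaries and functions $F: \mathcal X \times `A \to `B$ such that (1) $[\![(\forall x \in \mathcal X)\,(\forall b_* \in `B^* )\,(\exists a \in `A)\, E_{`B}(F(x,a),b_* )]\!] = \top$; (2) $[\![(\forall (x = x_* ) \in \mathcal X \times \mathcal X^* )\, (\forall (a_1 = a_{1*}) \in `A \times `A^* )\,(\forall (a_2 = a_{2*}) \in `A \times `A^* )\,(E_{`A} (a_{1},a_{2*}) \leftrightarrow (E_{`B})_* (F_*(x_*,a_{1*}), F(x,a_{2})))]\!] = \top$.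
   Context: Magic unitaries. For finite sets $A$, $B$, a family of projections $(p_{ab}\in L(H)\,|\,a\in A,b\in B)$ is a magic unitary if $\sum_{b\in B}p_{ab}=1_H$ for all $a\in A$ and $\sum_{a\in A}p_{ab}=1_H$ for all $b\in B$. Operators. Hilbert spaces are complex. $L(H,K)$ is the space of bounded operators $H\to K$, $L(H)=L(H,H)$, $H^*=L(H,\mathbb C)$. For $a\in L(H,K)$: $a^\dagger\in L(K,H)$ is the Hermitian adjoint, $a^*\in L(K^*,H^* )$ the transpose, $a_*=(a^\dagger)^*\in L(H^*,K^* )$. Products of subspaces of operators denote linear spans of products. The identifications $X^{**}=X$, $(X\otimes Y)^*=X^*\otimes Y^*$, $\mathbb C^*=\mathbb C$, $X\otimes\mathbb C=X$ are used. Quantum sets. A quantum set $\mathcal X$ is an object uniquely determined by a set $\mathrm{At}(\mathcal X)$ of nonzero finite-dimensional Hilbert spaces, its atoms. $\mathcal X\times\mathcal Y$ has atoms $X\otimes Y$; $\mathcal X^*$ has atoms $X^*$; $\mathbf 1$ (the empty product) has the single atom $\mathbb C$. For an ordinary set $A$, $`A$ has exactly one one-dimensional atom $\mathbb C_a$ for each $a\in A$ (distinct for distinct $a$); $`A^*$ means $(`A)^*$. Binary relations. A binary relation $R$ from $\mathcal X$ to $\mathcal Y$ is a choice of subspaces $R(X,Y)\le L(X,Y)$ for all atoms $X,Y$. Order, joins, meets and complement $\neg$ are componentwise (inclusion, span, intersection, orthogonal complement for $\langle a|b\rangle=\mathrm{Tr}(a^\dagger b)$); $\top$ and $\bot$ (or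 $\top_{\mathcal X}$, $\bot_{\mathcal X}$ for $\mathcal Y=\mathbf 1$) are the largest and smallest. $(S\circ R)(X,Z)=\sum_Y S(Y,Z)\cdot R(X,Y)$; $(R\times S)(X\otimes X',Y\otimes Y')=R(X,Y)\otimes S(X',Y')$; $R^\dagger(Y,X)=\{r^\dagger: r\in R(X,Y)\}$; $R_*(X^*,Y^* )=\{r_*: r\in R(X,Y)\}$; $I_{\mathcal X}(X,X)=\mathbb C1_X$, with other components $0$. A function $F:\mathcal X\to\mathcal Y$ is a binary relation with $F^\dagger\circ F\ge I_{\mathcal X}$ and $F\circ F^\dagger\le I_{\mathcal Y}$. A relation of arity $(\mathcal X_1,\dots,\mathcal X_n)$ is a binary relation $R$ from $\mathcal X_1\times\cdots\times\mathcal X_n$ to $\mathbf 1$; write $R(X_1\otimes\cdots\otimes X_n)$ for $R(X_1\otimes\cdots\otimes X_n,\mathbb C)$; its conjugate $R_*$ has arity $(\mathcal X_1^*,\dots,\mathcal X_n^* )$. The equality relation $E_{\mathcal X}$ of arity $(\mathcal X,\mathcal X^* )$ has $E_{\mathcal X}(X\otimes X^* )=\mathbb C\epsilon_X$, with $\epsilon_X:X\otimes X^*\to\mathbb C$ evaluation, and $E_{\mathcal X}(X_1\otimes X_2^* )=0$ for $X_1\ne X_2$; thus $(E_{`B})_*$ has arity $(`B^*,`B)$. For a binary relation $B$ from $\mathcal X$ to $\mathcal Y$, $\widehat B=E_{\mathcal Y}\circ(B\times I_{\mathcal Y^*})$, of arity $(\mathcal X,\mathcal Y^* )$. Formulas.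 Each quantum set is a sort with infinitely many variables. Nonduplicating terms of sort $\mathcal Y$: variables of sort $\mathcal Y$, and $F(s_1,\dots,s_m)$ with $F:\mathcal X_1\times\cdots\times\mathcal X_m\to\mathcal Y$ a function and $s_i$ nonduplicating terms of sorts $\mathcal X_i$, no two sharing a variable. Nonduplicating atomic formulas: $R(t_1,\dots,t_n)$ with $R$ a relation of arity $(\mathcal Y_1,\dots,\mathcal Y_n)$ and $t_i$ nonduplicating terms of sorts $\mathcal Y_i$, no two sharing a variable. Formulas are built from these with connectives and quantifiers. Interpretation. For distinct variables $x_i$ of sorts $\mathcal X_i$ including the free variables of $\phi$, $[\![\phi]\!]=[\![(x_1,\dots,x_n)\in\mathcal X_1\times\cdots\times\mathcal X_n\,|\,\phi]\!]$ is a relation of arity $(\mathcal X_1,\dots,\mathcal X_n)$ (for a sentence, $\top$ or $\bot$), defined recursively. For a permutation $\pi$ of $\{1,\dots,n\}$, $m\le n$ and $R$ of arity $(\mathcal X_{\pi(1)},\dots,\mathcal X_{\pi(m)})$, $[\![R(x_{\pi(1)},\dots,x_{\pi(m)})]\!](X_1\otimes\cdots\otimes X_n)=(R\times\top_{\mathcal X_{\pi(m+1)}}\times\cdots\times\top_{\mathcal X_{\pi(n)}})(X_{\pi(1)}\otimes\cdots\otimes X_{\pi(n)})\cdot u_\pi$, where $u_\pi$ is the unitary permuting tensor factors. $[\![\neg\phi]\!]=\neg[\![\phi]\!]$; $[\![\phi\wedge\psi]\!]=[\![\phi]\!]\wedge[\![\psi]\!]$; $[\![(x_1,\dots,x_n)\,|\,(\forall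 x\in\mathcal X)\,\phi]\!]=\sup\{R \text{ of arity }(\mathcal X_1,\dots,\mathcal X_n): \top_{\mathcal X}\times R\le[\![(x,x_1,\dots,x_n)\,|\,\phi]\!]\}$. Abbreviations: $\phi\vee\psi$ is $\neg(\neg\phi\wedge\neg\psi)$; $\exists$ is $\neg\forall\neg$; $\phi\to\psi$ is $\neg\phi\vee(\phi\wedge\psi)$; $\phi\leftrightarrow\psi$ is $(\phi\to\psi)\wedge(\psi\to\phi)$; $(\forall(x=x_* )\in\mathcal X\times\mathcal X^* )\,\phi$ is $(\forall x_*\in\mathcal X^* )(\forall x\in\mathcal X)(E_{\mathcal X}(x,x_* )\to\phi)$, with $x,x_*$ distinct variables; $(\exists(x=x_* )\in\mathcal X\times\mathcal X^* )\,\phi$ is $\neg(\forall(x=x_* )\in\mathcal X\times\mathcal X^* )\,\neg\phi$. If not all $t_i$ are variables, $R(t_1,\dots,t_n)$ abbreviates $(\exists(y_n=y_{n*})\in\mathcal Y_n\times\mathcal Y_n^* )\cdots(\exists(y_1=y_{1*})\in\mathcal Y_1\times\mathcal Y_1^* )(R(y_1,\dots,y_n)\wedge t_1\curvearrowright y_{1*}\wedge\cdots\wedge t_n\curvearrowright y_{n*})$ with all $y_i,y_{i*}$ new variables, where $t\curvearrowright y_*$ is $E_{\mathcal Y}(t,y_* )$ if $t$ is a variable and $\widehat F(s_1,\dots,s_m,y_* )$ if $t=F(s_1,\dots,s_m)$. *)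

theory Defs
  imports Complex_Main "HOL-Library.FuncSet" "HOL-Library.Function_Algebras"
begin

section \<open>Finite-dimensional Hilbert spaces and families of projections\<close>

class complex_vector_space = ab_group_add +
  fixes scaleC :: "complex \<Rightarrow> 'a \<Rightarrow> 'a"
  assumes scaleC_add_right: "scaleC c (x + y) = scaleC c x + scaleC c y"
    and scaleC_add_left: "scaleC (c + d) x = scaleC c x + scaleC d x"
    and scaleC_scaleC: "scaleC c (scaleC d x) = scaleC (c * d) x"
    and scaleC_one: "scaleC 1 x = x"

global_interpretation cvec: vector_space "scaleC :: complex \<Rightarrow> 'a \<Rightarrow> 'a::complex_vector_space"
  by unfold_locales (simp_all add: scaleC_add_right scaleC_add_left scaleC_scaleC scaleC_one)

class fd_hilbert = complex_vector_space +
  fixes cinner :: "'a \<Rightarrow> 'a \<Rightarrow> complex"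
  assumes cinner_add_right: "cinner x (y + z) = cinner x y + cinner x z"
    and cinner_scaleC_right: "cinner x (scaleC c y) = c * cinner x y"
    and cinner_commute: "cinner x y = cnj (cinner y x)"
    and cinner_pos: "x \<noteq> 0 \<Longrightarrow> 0 < Re (cinner x x)"
    and finite_dimensional: "\<exists>S. finite S \<and> (\<forall>x. \<exists>c. x = (\<Sum>s\<in>S. scaleC (c s) s))"

definition orthonormal_basis :: "nat \<Rightarrow> (nat \<Rightarrow> 'h::fd_hilbert) \<Rightarrow> bool" where
  "orthonormal_basis n e \<longleftrightarrow>
     (\<forall>i<n. \<forall>j<n. cinner (e i) (e j) = (if i = j then 1 else 0)) \<and>
     cvec.span (e ` {..<n}) = UNIV"

definition projection :: "('h::fd_hilbert \<Rightarrow> 'h) \<Rightarrow> bool" where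
  "projection p \<longleftrightarrow>
     Vector_Spaces.linear scaleC scaleC p \<and> p \<circ> p = p \<and>
     (\<forall>x y. cinner (p x) y = cinner x (p y))"

text \<open>A family indexed by \<open>A\<close> and \<open>B\<close> is a function on pairs that is \<open>undefined\<close>
  outside \<open>A \<times> B\<close>, so that distinct families are distinct functions.\<close>

definition row_families :: "'a set \<Rightarrow> 'b set \<Rightarrow> ('a \<times> 'b \<Rightarrow> 'h::fd_hilbert \<Rightarrow> 'h) set" where
  "row_families A B =
     {p \<in> (A \<times> B) \<rightarrow>\<^sub>E {q. projection q}. \<forall>a\<in>A. (\<lambda>v. \<Sum>b\<in>B. p (a, b) v) = id}"

definition magic_unitaries :: "'a set \<Rightarrow> 'b set \<Rightarrow> ('a \<times> 'b \<Rightarrow> 'h::fd_hilbert \<Rightarrow> 'h) set" where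
  "magic_unitaries A B =
     {p \<in> (A \<times> B) \<rightarrow>\<^sub>E {q. projection q}.
        (\<forall>a\<in>A. (\<lambda>v. \<Sum>b\<in>B. p (a, b) v) = id) \<and>
        (\<forall>b\<in>B. (\<lambda>v. \<Sum>a\<in>A. p (a, b) v) = id)}"


section \<open>Quantum sets\<close>

text \<open>An atom is a Hilbert space with a chosen orthonormal basis indexed by \<open>{..<d}\<close>:
  \<open>Hilb l d False\<close> is a copy of \<open>\<complex>\<^sup>d\<close> named \<open>l\<close>, and \<open>Hilb l d True\<close> is its dual, with
  the dual basis.  Different values are different spaces, and the double dual is the
  space itself.\<close>

datatype 'l hilb = Hilb (hlabel: 'l) (hdim: nat) (hdual: bool)

definition dual :: "'l hilb \<Rightarrow> 'l hilb" where
  "dual H = Hilb (hlabel H) (hdim H) (\<not> hdual H)"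

type_synonym 'l qset = "'l hilb set"

definition quantum_set :: "'l qset \<Rightarrow> bool" where
  "quantum_set X \<longleftrightarrow> (\<forall>H\<in>X. 0 < hdim H)"

definition qdual :: "'l qset \<Rightarrow> 'l qset" where
  "qdual X = dual ` X"

definition classical :: "'l set \<Rightarrow> 'l qset" where
  "classical A = (\<lambda>a. Hilb a 1 False) ` A"

text \<open>A product of quantum sets is the list of its factors, and a tensor product of atoms
  is the list of its tensor factors; \<open>listset Xs\<close> is the set of atoms of the product \<open>Xs\<close>.
  The empty product is \<open>[]\<close>, with the single atom \<open>[]\<close> (the space \<open>\<complex>\<close>).  The product basis
  of \<open>X\<^sub>1 \<otimes> \<dots> \<otimes> X\<^sub>n\<close> is indexed by lists of length \<open>n\<close>, so that tensor products are strictly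
  associative and \<open>X \<otimes> \<complex> = X\<close>.\<close>

definition basis :: "'l hilb list \<Rightarrow> nat list set" where
  "basis xs = listset (map (\<lambda>H. {..<hdim H}) xs)"


section \<open>Operators\<close>

text \<open>An operator \<open>X \<rightarrow> Y\<close> is its matrix, row index (basis of \<open>Y\<close>) first,
  extended by \<open>0\<close> outside the basis indices.\<close>

type_synonym oper = "nat list \<Rightarrow> nat list \<Rightarrow> complex"

definition scale_oper :: "complex \<Rightarrow> oper \<Rightarrow> oper" where
  "scale_oper c a = (\<lambda>j i. c * a j i)"

global_interpretation oper: vector_space scale_oper
  by unfold_locales (auto simp: scale_oper_def fun_eq_iff algebra_simps)

definition L :: "'l hilb list \<Rightarrow> 'l hilb list \<Rightarrow> oper set" where
  "L xs ys = {a. \<forall>j i. a j i \<noteq> 0 \<longrightarrow> j \<in> basis ys \<and> i \<in> basis xs}"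

definition id_oper :: "'l hilb list \<Rightarrow> oper" where
  "id_oper xs = (\<lambda>j i. if j = i \<and> i \<in> basis xs then 1 else 0)"

text \<open>\<open>mult ys b a\<close> is the product \<open>b a\<close> of \<open>a : X \<rightarrow> Y\<close> and \<open>b : Y \<rightarrow> Z\<close>, where \<open>Y\<close> is \<open>ys\<close>.\<close>

definition mult :: "'l hilb list \<Rightarrow> oper \<Rightarrow> oper \<Rightarrow> oper" where
  "mult ys b a = (\<lambda>k i. \<Sum>j\<in>basis ys. b k j * a j i)"

definition adj :: "oper \<Rightarrow> oper" where
  "adj a = (\<lambda>i j. cnj (a j i))"

definition transp :: "oper \<Rightarrow> oper" where
  "transp a = (\<lambda>i j. a j i)"

definition conj_oper :: "oper \<Rightarrow> oper" where
  "conj_oper a = transp (adj a)"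

definition Tr :: "'l hilb list \<Rightarrow> oper \<Rightarrow> complex" where
  "Tr xs a = (\<Sum>i\<in>basis xs. a i i)"

text \<open>Tensor product \<open>a \<otimes> b\<close>, where \<open>a\<close> is an operator from an \<open>n\<close>-fold to an \<open>m\<close>-fold
  tensor product.\<close>

definition tensor :: "nat \<Rightarrow> nat \<Rightarrow> oper \<Rightarrow> oper \<Rightarrow> oper" where
  "tensor m n a b = (\<lambda>j i. a (take m j) (take n i) * b (drop m j) (drop n i))"

definition eval_oper :: "'l hilb \<Rightarrow> oper" where
  "eval_oper H = (\<lambda>j i. if j = [] \<and> (\<exists>k<hdim H. i = [k, k]) then 1 else 0)"

text \<open>A permutation of \<open>{..<n}\<close> is given as the list of its values.\<close>

definition permute :: "nat list \<Rightarrow> 'a list \<Rightarrow> 'a list" where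
  "permute p xs = map (\<lambda>k. xs ! k) p"

definition perm_oper :: "nat list \<Rightarrow> 'l hilb list \<Rightarrow> oper" where
  "perm_oper p xs = (\<lambda>j i. if i \<in> basis xs \<and> j = permute p i then 1 else 0)"


section \<open>Binary relations between products of quantum sets\<close>

datatype 'l brel =
  Brel (src: "'l qset list") (tgt: "'l qset list")
    (spaces: "'l hilb list \<Rightarrow> 'l hilb list \<Rightarrow> oper set")

text \<open>The components at non-atoms are set to the zero space.\<close>

definition brel_of ::
  "'l qset list \<Rightarrow> 'l qset list \<Rightarrow> ('l hilb list \<Rightarrow> 'l hilb list \<Rightarrow> oper set) \<Rightarrow> 'l brel" where
  "brel_of Xs Ys S =
     Brel Xs Ys (\<lambda>xs ys. if xs \<in> listset Xs \<and> ys \<in> listset Ys then S xs ys else {0})"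

definition is_brel :: "'l brel \<Rightarrow> bool" where
  "is_brel R \<longleftrightarrow>
     (\<forall>X \<in> set (src R) \<union> set (tgt R). quantum_set X) \<and>
     (\<forall>xs ys. if xs \<in> listset (src R) \<and> ys \<in> listset (tgt R)
       then oper.subspace (spaces R xs ys) \<and> spaces R xs ys \<subseteq> L xs ys
       else spaces R xs ys = {0})"

definition brel_le :: "'l brel \<Rightarrow> 'l brel \<Rightarrow> bool" where
  "brel_le R S \<longleftrightarrow> src R = src S \<and> tgt R = tgt S \<and>
     (\<forall>xs ys. spaces R xs ys \<subseteq> spaces S xs ys)"

definition top_brel :: "'l qset list \<Rightarrow> 'l qset list \<Rightarrow> 'l brel" where
  "top_brel Xs Ys = brel_of Xs Ys L"

definition compl_brel :: "'l brel \<Rightarrow> 'l brel" where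
  "compl_brel R = brel_of (src R) (tgt R)
     (\<lambda>xs ys. {b \<in> L xs ys. \<forall>a \<in> spaces R xs ys. Tr xs (mult ys (adj a) b) = 0})"

definition meet_brel :: "'l brel \<Rightarrow> 'l brel \<Rightarrow> 'l brel" where
  "meet_brel R S = brel_of (src R) (tgt R) (\<lambda>xs ys. spaces R xs ys \<inter> spaces S xs ys)"

definition Sup_brel :: "'l qset list \<Rightarrow> 'l qset list \<Rightarrow> 'l brel set \<Rightarrow> 'l brel" where
  "Sup_brel Xs Ys RR = brel_of Xs Ys (\<lambda>xs ys. oper.span (\<Union>R\<in>RR. spaces R xs ys))"

definition comp_brel :: "'l brel \<Rightarrow> 'l brel \<Rightarrow> 'l brel" where
  "comp_brel S R = brel_of (src R) (tgt S)
     (\<lambda>xs zs. oper.span {mult ys s r | ys s r.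
        ys \<in> listset (tgt R) \<and> s \<in> spaces S ys zs \<and> r \<in> spaces R xs ys})"

definition prod_brel :: "'l brel \<Rightarrow> 'l brel \<Rightarrow> 'l brel" where
  "prod_brel R S = (let n = length (src R); m = length (tgt R) in
     brel_of (src R @ src S) (tgt R @ tgt S)
       (\<lambda>xs ys. oper.span {tensor m n r s | r s.
          r \<in> spaces R (take n xs) (take m ys) \<and> s \<in> spaces S (drop n xs) (drop m ys)}))"

definition adj_brel :: "'l brel \<Rightarrow> 'l brel" where
  "adj_brel R = brel_of (tgt R) (src R) (\<lambda>ys xs. adj ` spaces R xs ys)"

definition conj_brel :: "'l brel \<Rightarrow> 'l brel" where
  "conj_brel R = brel_of (map qdual (src R)) (map qdual (tgt R))
     (\<lambda>xs ys. conj_oper ` spaces R (map dual xs) (map dual ys))"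

definition id_brel :: "'l qset list \<Rightarrow> 'l brel" where
  "id_brel Xs = brel_of Xs Xs (\<lambda>xs ys. if xs = ys then oper.span {id_oper xs} else {0})"

definition is_function :: "'l brel \<Rightarrow> bool" where
  "is_function F \<longleftrightarrow> is_brel F \<and>
     brel_le (id_brel (src F)) (comp_brel (adj_brel F) F) \<and>
     brel_le (comp_brel F (adj_brel F)) (id_brel (tgt F))"

definition eq_brel :: "'l qset \<Rightarrow> 'l brel" where
  "eq_brel X = brel_of [X, qdual X] []
     (\<lambda>xs ys. if xs ! 1 = dual (xs ! 0) then oper.span {eval_oper (xs ! 0)} else {0})"

text \<open>The relation \<open>\<hat>B\<close>, for \<open>B\<close> with a single target factor \<open>Y\<close>.\<close>

definition hat_brel :: "'l brel \<Rightarrow> 'l brel" where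
  "hat_brel B = (let Y = hd (tgt B) in
     comp_brel (eq_brel Y) (prod_brel B (id_brel [qdual Y])))"


section \<open>Formulas\<close>

text \<open>A variable is a number together with its sort.\<close>

type_synonym 'l var = "nat \<times> 'l qset"

datatype 'l fm =
    Atm "'l brel" "'l var list"
  | Neg "'l fm"
  | And "'l fm" "'l fm"
  | All "'l var" "'l fm"

definition Or :: "'l fm \<Rightarrow> 'l fm \<Rightarrow> 'l fm" where
  "Or \<phi> \<psi> = Neg (And (Neg \<phi>) (Neg \<psi>))"

definition Ex :: "'l var \<Rightarrow> 'l fm \<Rightarrow> 'l fm" where
  "Ex x \<phi> = Neg (All x (Neg \<phi>))"

definition Imp :: "'l fm \<Rightarrow> 'l fm \<Rightarrow> 'l fm" where
  "Imp \<phi> \<psi> = Or (Neg \<phi>) (And \<phi> \<psi>)"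

definition Iff :: "'l fm \<Rightarrow> 'l fm \<Rightarrow> 'l fm" where
  "Iff \<phi> \<psi> = And (Imp \<phi> \<psi>) (Imp \<psi> \<phi>)"

text \<open>\<open>AllEq x x' \<phi>\<close> is \<open>(\<forall>(x = x') \<in> \<X> \<times> \<X>\<^sup>*) \<phi>\<close>, and likewise for \<open>ExEq\<close>.\<close>

definition AllEq :: "'l var \<Rightarrow> 'l var \<Rightarrow> 'l fm \<Rightarrow> 'l fm" where
  "AllEq x x' \<phi> = All x' (All x (Imp (Atm (eq_brel (snd x)) [x, x']) \<phi>))"

definition ExEq :: "'l var \<Rightarrow> 'l var \<Rightarrow> 'l fm \<Rightarrow> 'l fm" where
  "ExEq x x' \<phi> = Neg (AllEq x x' (Neg \<phi>))"

datatype 'l trm = is_Var: Var (the_var: "'l var") | App "'l brel" "'l trm list"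

primrec apps :: "'l trm \<Rightarrow> nat" where
  "apps (Var x) = 0"
| "apps (App F ts) = Suc (sum_list (map apps ts))"

text \<open>\<open>Rel k R ts\<close> is the formula \<open>R(t\<^sub>1, \<dots>, t\<^sub>n)\<close>.  The new variables needed to eliminate
  function symbols are numbered from \<open>k\<close> on; \<open>k\<close> has to exceed the numbers of all variables
  of the surrounding formula.\<close>

function Rel :: "nat \<Rightarrow> 'l brel \<Rightarrow> 'l trm list \<Rightarrow> 'l fm" where
  "Rel k R ts =
    (if \<forall>t\<in>set ts. is_Var t then Atm R (map the_var ts)
     else let n = length ts;
              y = (\<lambda>i. (k + 2 * i, src R ! i));
              y' = (\<lambda>i. (k + 2 * i + 1, qdual (src R ! i)))
          in fold (\<lambda>i \<phi>. ExEq (y i) (y' i) \<phi>) [0..<n]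
               (foldl And (Atm R (map y [0..<n]))
                 (map (\<lambda>i. case ts ! i of
                      Var x \<Rightarrow> Atm (eq_brel (src R ! i)) [x, y' i]
                    | App F ss \<Rightarrow> Rel (k + 2 * n) (hat_brel F) (ss @ [Var (y' i)])) [0..<n])))"
  by pat_completeness auto
termination
proof (relation "measure (\<lambda>(k, R, ts). sum_list (map apps ts))", goal_cases)
  case 1
  then show ?case by simp
next
  case (2 k R ts n y y' i F ss)
  then have "App F ss \<in> set ts"
    by (metis (no_types, lifting) atLeastLessThan_iff nth_mem set_upt)
  then have "apps (App F ss) \<in> set (map apps ts)"
    unfolding set_map by (rule imageI)
  then have "apps (App F ss) \<le> sum_list (map apps ts)"
    by (rule member_le_sum_list) simp
  then show ?case by simp
qed

declare Rel.simps [simp del]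


section \<open>Interpretation\<close>

fun position :: "'a list \<Rightarrow> 'a \<Rightarrow> nat" where
  "position [] u = 0"
| "position (v # vs) u = (if u = v then 0 else Suc (position vs u))"

text \<open>The permutation \<open>\<pi>\<close> for which \<open>us\<close> consists of the variables at places \<open>\<pi>(1), \<dots>, \<pi>(m)\<close>
  of \<open>vs\<close>; the remaining places follow in increasing order.\<close>

definition arg_perm :: "'a list \<Rightarrow> 'a list \<Rightarrow> nat list" where
  "arg_perm vs us = map (position vs) us @
     filter (\<lambda>k. k \<notin> set (map (position vs) us)) [0..<length vs]"

definition atm_brel :: "'l var list \<Rightarrow> 'l brel \<Rightarrow> 'l var list \<Rightarrow> 'l brel" where
  "atm_brel vs R us =
     (let p = arg_perm vs us; Xs = map snd vs;
          T = foldl prod_brel R (map (\<lambda>X. top_brel [X] []) (drop (length us) (permute p Xs)))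
      in brel_of Xs [] (\<lambda>xs ys.
           (\<lambda>r. mult (permute p xs) r (perm_oper p xs)) ` spaces T (permute p xs) ys))"

text \<open>\<open>interp vs \<phi>\<close> is the interpretation of \<open>\<phi>\<close> in the context of the distinct variables \<open>vs\<close>,
  which have to include the free variables of \<open>\<phi>\<close>.\<close>

primrec interp :: "'l var list \<Rightarrow> 'l fm \<Rightarrow> 'l brel" where
  "interp vs (Atm R us) = atm_brel vs R us"
| "interp vs (Neg \<phi>) = compl_brel (interp vs \<phi>)"
| "interp vs (And \<phi> \<psi>) = meet_brel (interp vs \<phi>) (interp vs \<psi>)"
| "interp vs (All x \<phi>) = Sup_brel (map snd vs) []
     {R. is_brel R \<and> src R = map snd vs \<and> tgt R = [] \<and>
         brel_le (prod_brel (top_brel [snd x] []) R) (interp (x # vs) \<phi>)}"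

definition holds :: "'l fm \<Rightarrow> bool" where
  "holds \<phi> \<longleftrightarrow> interp [] \<phi> = top_brel [] []"


section \<open>The function defined by a family of projections\<close>

text \<open>The matrix of an operator on \<open>'h\<close> with respect to the orthonormal basis \<open>e\<close>, as an operator
  on the atom \<open>H\<close>, which is a copy of \<open>'h\<close> in these coordinates.\<close>

definition matrix_of :: "'l hilb \<Rightarrow> (nat \<Rightarrow> 'h::fd_hilbert) \<Rightarrow> ('h \<Rightarrow> 'h) \<Rightarrow> oper" where
  "matrix_of H e q =
     (\<lambda>j i. if j \<in> basis [H] \<and> i \<in> basis [H] then cinner (e (hd j)) (q (e (hd i))) else 0)"

definition family_function ::
  "'l hilb \<Rightarrow> (nat \<Rightarrow> 'h::fd_hilbert) \<Rightarrow> 'l set \<Rightarrow> 'l set \<Rightarrow> ('l \<times> 'l \<Rightarrow> 'h \<Rightarrow> 'h) \<Rightarrow> 'l brel" where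
  "family_function H e A B p = brel_of [{H}, classical A] [classical B]
     (\<lambda>xs ys. let a = hlabel (xs ! 1); b = hlabel (ys ! 0) in
        {mult xs f (tensor 1 1 (matrix_of H e (p (a, b))) (id_oper [xs ! 1])) | f. f \<in> L xs ys})"

end

theory Submission
  imports Defs
begin

text \<open>
  Write \<open>V\<^sub>a\<^sub>b = F(H \<otimes> \<complex>\<^sub>a, \<complex>\<^sub>b)\<close>, a space of functionals on \<open>H\<close>.  By the Riesz representation
  theorem \<open>V\<^sub>a\<^sub>b\<close> consists of the functionals \<open>\<langle>u, -\<rangle>\<close> with \<open>u\<close> in a subspace \<open>U\<^sub>a\<^sub>b\<close> of \<open>H\<close>, and for the
  relation given by a family of projections \<open>U\<^sub>a\<^sub>b\<close> is the range of \<open>p\<^sub>a\<^sub>b\<close>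
  (\<open>spaces_family_function\<close>).  The inequality \<open>F \<circ> F\<^sup>\<dagger> \<le> I\<close> says that \<open>U\<^sub>a\<^sub>b\<close> and \<open>U\<^sub>a\<^sub>b'\<close> are orthogonal
  for \<open>b \<noteq> b'\<close>, and \<open>F\<^sup>\<dagger> \<circ> F \<ge> I\<close> says that the \<open>U\<^sub>a\<^sub>b\<close> with \<open>a\<close> fixed span \<open>H\<close>: the identity is a sum
  of products \<open>r\<^sup>\<dagger> s\<close> of functionals in the same component, and the image of \<open>r\<^sup>\<dagger> s\<close> lies in the
  corresponding \<open>U\<^sub>a\<^sub>b\<close>.  So functions correspond to families of orthogonal decompositions of \<open>H\<close>,
  that is, to families of projections whose rows sum to \<open>1\<close> (\<open>bij_betw_family_function\<close>).

  A quantifier over a classical sort is an intersection over its elements, up to orthogonal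
  complements, and the fresh variables in \<open>R(t\<^sub>1, \<dots>, t\<^sub>n)\<close> are classical and are bound to
  the values of the terms by equality relations.  Hence the first sentence says that for every \<open>b\<close>
  the join over \<open>a\<close> of the \<open>V\<^sub>a\<^sub>b\<close> is everything: no nonzero vector is annihilated by \<open>p\<^sub>a\<^sub>b\<close> for every \<open>a\<close>
  (\<open>holds_surjectivity_iff\<close>).

  The outer quantifier \<open>\<forall>(x = x\<^sub>*)\<close> of the second sentence holds exactly if the evaluation functional
  on \<open>H \<otimes> H\<^sup>*\<close> lies in the component of its body (\<open>sasaki_arrow_valid_iff\<close>).  Functionals on \<open>H \<otimes> H\<^sup>*\<close>
  correspond to operators on \<open>H\<close>, the evaluation functional to the identity.  At \<open>a\<^sub>1 = i\<close> and \<open>a\<^sub>2 = i'\<close>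
  the component of the equation between the values of \<open>F\<^sub>*\<close> and \<open>F\<close> is the span over \<open>b\<close> of the operators
  of the form \<open>p S p'\<close>, where \<open>p\<close> and \<open>p'\<close> are the projections at \<open>(i, b)\<close> and \<open>(i', b)\<close>.  For
  \<open>i = i'\<close> the identity lies in this span because the projections in row \<open>i\<close> sum to \<open>1\<close>.  For
  \<open>i \<noteq> i'\<close> it has to be orthogonal to the span, and since the inner product with it is the trace, this
  means \<open>p' p = 0\<close> (\<open>holds_injectivity_iff\<close>).  Together the sentences say that for fixed \<open>b\<close> the
  ranges of the \<open>p\<^sub>a\<^sub>b\<close> are pairwise orthogonal and span \<open>H\<close>, that is, that the columns sum to \<open>1\<close> too
  (\<open>magic_unitary_iff\<close>).

  The connectives are evaluated with the identity \<open>S\<^sup>\<bottom>\<^sup>\<bottom>\<^sup>\<bottom> = S\<^sup>\<bottom>\<close> for orthogonal complements.  It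
  suffices because each component that has to be known is itself a complement.
\<close>


section \<open>Indices and operators\<close>

lemma scale_oper_apply: "scale_oper c a j i = c * a j i"
  by (simp add: scale_oper_def)

text \<open>Stated for semilinear maps so as to cover the adjoint and the conjugate.\<close>

lemma subspace_semilinear_image:
  assumes "oper.subspace V" and "\<And>a b. f (a + b) = f a + f b"
    and "\<And>c a. f (scale_oper c a) = scale_oper (g c) (f a)" and "surj g"
  shows "oper.subspace (f ` V)"
proof (rule oper.subspaceI)
  have "f 0 = 0"
    using assms(2)[of 0 0] by simp
  then show "0 \<in> f ` V"
    using oper.subspace_0[OF assms(1)] by (metis imageI)
next
  show "x + y \<in> f ` V" if "x \<in> f ` V" "y \<in> f ` V" for x y
    using that assms(1,2) oper.subspace_add by (auto simp flip: assms(2))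
next
  fix c x assume "x \<in> f ` V"
  moreover obtain d where "c = g d"
    using \<open>surj g\<close> by (metis surjD)
  ultimately show "scale_oper c x \<in> f ` V"
    using assms(1) oper.subspace_scale by (auto simp flip: assms(3))
qed

lemma surj_cnj: "surj cnj"
  by (metis complex_cnj_cnj surjI)

lemma listset_iff: "xs \<in> listset Xs \<longleftrightarrow> list_all2 (\<in>) xs Xs"
  by (induction Xs arbitrary: xs) (auto simp: set_Cons_def list_all2_Cons2)

declare listset.simps(2) [simp del]

lemma in_listset_Cons [simp]:
  "xs \<in> listset (X # Xs) \<longleftrightarrow> (\<exists>x ys. xs = x # ys \<and> x \<in> X \<and> ys \<in> listset Xs)"
  by (auto simp: listset_iff list_all2_Cons2)

lemma basis_iff: "i \<in> basis xs \<longleftrightarrow> list_all2 (\<lambda>k H. k < hdim H) i xs"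
  by (simp add: basis_def listset_iff list_all2_map2)

lemma basis_Nil [simp]: "basis [] = {[]}"
  by (auto simp: basis_iff)

lemma basis_Cons: "basis (H # xs) = (\<lambda>(k, i). k # i) ` ({..<hdim H} \<times> basis xs)"
  by (auto simp: basis_iff list_all2_Cons2 image_iff)

lemma Cons_in_basis [simp]: "k # i \<in> basis (H # xs) \<longleftrightarrow> k < hdim H \<and> i \<in> basis xs"
  by (simp add: basis_iff)

lemma Nil_notin_basis_Cons [simp]: "[] \<notin> basis (H # xs)"
  by (simp add: basis_iff)

lemma append_in_basis:
  "length i = length xs \<Longrightarrow> i @ k \<in> basis (xs @ ys) \<longleftrightarrow> i \<in> basis xs \<and> k \<in> basis ys"
  by (simp add: basis_iff list_all2_append)

lemma length_basis: "i \<in> basis xs \<Longrightarrow> length i = length xs"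
  by (simp add: basis_iff list_all2_lengthD)

lemma basis_appendE:
  assumes "i \<in> basis (xs @ ys)"
  obtains i1 i2 where "i = i1 @ i2" "i1 \<in> basis xs" "i2 \<in> basis ys"
  using assms by (auto simp: basis_iff list_all2_append2)

lemma append_in_basisI: "i \<in> basis xs \<Longrightarrow> k \<in> basis ys \<Longrightarrow> i @ k \<in> basis (xs @ ys)"
  by (simp add: append_in_basis length_basis)

lemma finite_basis [simp]: "finite (basis xs)"
  by (induction xs) (auto simp: basis_Cons)

lemma sum_basis_Cons:
  "(\<Sum>i\<in>basis (H # xs). f i) = (\<Sum>k<hdim H. \<Sum>i\<in>basis xs. f (k # i))"
  unfolding basis_Cons
  by (subst sum.reindex) (auto simp: inj_on_def sum.cartesian_product case_prod_unfold)

lemma zero_in_L [simp]: "0 \<in> L xs ys"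
  by (simp add: L_def)

lemma subspace_L: "oper.subspace (L xs ys)"
  by (rule oper.subspaceI) (auto simp: L_def scale_oper_def, (metis add_0)+)

lemma L_zero: "a \<in> L xs ys \<Longrightarrow> j \<notin> basis ys \<or> i \<notin> basis xs \<Longrightarrow> a j i = 0"
  by (auto simp: L_def)

lemma subspace_zero: "oper.subspace {0}"
  by (simp add: oper.subspace_def scale_oper_def fun_eq_iff)

lemma L_eqI:
  assumes "a \<in> L xs ys" "b \<in> L xs ys"
    and "\<And>j i. j \<in> basis ys \<Longrightarrow> i \<in> basis xs \<Longrightarrow> a j i = b j i"
  shows "a = b"
  using assms by (intro ext) (metis L_zero)

lemma mult_in_L: "b \<in> L ys zs \<Longrightarrow> a \<in> L xs ys' \<Longrightarrow> mult ys b a \<in> L xs zs"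
  unfolding L_def mult_def by (auto elim!: sum.not_neutral_contains_not_neutral) 

lemma adj_in_L: "a \<in> L xs ys \<Longrightarrow> adj a \<in> L ys xs"
  by (auto simp: L_def adj_def)

lemma id_oper_in_L: "id_oper xs \<in> L xs xs"
  by (auto simp: L_def id_oper_def)

lemma eval_oper_in_L: "hdim H' = hdim H \<Longrightarrow> eval_oper H \<in> L [H, H'] []"
  by (auto simp: L_def eval_oper_def)

lemma hdim_dual [simp]: "hdim (dual H) = hdim H"
  by (simp add: dual_def)

lemma basis_map_dual [simp]: "basis (map dual xs) = basis xs"
  by (auto simp: basis_iff list_all2_map2)

lemma conj_oper_apply: "conj_oper a = (\<lambda>j i. cnj (a j i))"
  by (simp add: conj_oper_def transp_def adj_def)

lemma conj_oper_in_L: "a \<in> L (map dual xs) (map dual ys) \<Longrightarrow> conj_oper a \<in> L xs ys"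
  by (auto simp: L_def conj_oper_apply)

lemma tensor_in_L:
  assumes "r \<in> L (take n xs) (take m ys)" "s \<in> L (drop n xs) (drop m ys)"
  shows "tensor m n r s \<in> L xs ys"
proof -
  have "i \<in> basis zs" if "take k i \<in> basis (take k zs)" "drop k i \<in> basis (drop k zs)"
    for k i and zs :: "'a hilb list"
    using append_in_basisI[OF that] by simp
  with assms show ?thesis
    unfolding L_def tensor_def mem_Collect_eq mult_eq_0_iff by blast
qed

lemma dual_dual [simp]: "dual (dual H) = H"
  by (cases H) (simp add: dual_def)

lemma qdual_qdual [simp]: "qdual (qdual X) = X"
  by (simp add: qdual_def image_image)

lemma dual_in_qdual [simp]: "dual H \<in> qdual X \<longleftrightarrow> H \<in> X"
  by (metis dual_dual imageE image_eqI qdual_def)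

lemma in_qdual_iff: "H \<in> qdual X \<longleftrightarrow> dual H \<in> X"
  by (metis dual_dual dual_in_qdual)


section \<open>Relations whose components are spaces of operators\<close>

text \<open>This is \<open>is_brel\<close> without the condition that the sorts are quantum sets.  Every operation
  preserves it, so that interpretations of formulas have it in every context.\<close>

definition graded :: "'l brel \<Rightarrow> bool" where
  "graded R \<longleftrightarrow> (\<forall>xs ys.
     oper.subspace (spaces R xs ys) \<and> spaces R xs ys \<subseteq> L xs ys \<and>
     (xs \<notin> listset (src R) \<or> ys \<notin> listset (tgt R) \<longrightarrow> spaces R xs ys = {0}))"

lemma is_brel_iff:
  fixes R :: "'l brel"
  shows "is_brel R \<longleftrightarrow> (\<forall>X \<in> set (src R) \<union> set (tgt R). quantum_set X) \<and> graded R"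
proof -
  have "oper.subspace V \<and> V \<subseteq> L xs ys" if "V = {0}" for V and xs ys :: "'l hilb list"
    using that by (simp add: subspace_zero)
  then have "(if P then oper.subspace V \<and> V \<subseteq> L xs ys else V = {0}) \<longleftrightarrow>
      oper.subspace V \<and> V \<subseteq> L xs ys \<and> (\<not> P \<longrightarrow> V = {0})" for P V and xs ys :: "'l hilb list"
    by auto
  then show ?thesis
    unfolding is_brel_def graded_def by (simp only: de_Morgan_conj)
qed

lemma gradedD:
  assumes "graded R"
  shows graded_subspace: "oper.subspace (spaces R xs ys)"
    and graded_in_L: "r \<in> spaces R xs ys \<Longrightarrow> r \<in> L xs ys"
    and graded_outside:
      "xs \<notin> listset (src R) \<or> ys \<notin> listset (tgt R) \<Longrightarrow> spaces R xs ys = {0}"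
  using assms by (auto simp: graded_def)

lemma brel_of_simps [simp]:
  "src (brel_of Xs Ys S) = Xs" "tgt (brel_of Xs Ys S) = Ys"
  "xs \<in> listset Xs \<Longrightarrow> ys \<in> listset Ys \<Longrightarrow> spaces (brel_of Xs Ys S) xs ys = S xs ys"
  by (simp_all add: brel_of_def)

lemma brel_eqI:
  assumes "graded R" "graded S" "src R = src S" "tgt R = tgt S"
    and "\<And>xs ys. xs \<in> listset (src S) \<Longrightarrow> ys \<in> listset (tgt S) \<Longrightarrow> spaces R xs ys = spaces S xs ys"
  shows "R = S"
proof (rule brel.expand, intro conjI ext)
  show "spaces R xs ys = spaces S xs ys" for xs ys
    using assms graded_outside by metis
qed (use assms in auto)

lemma graded_brel_of:
  assumes "\<And>xs ys. xs \<in> listset Xs \<Longrightarrow> ys \<in> listset Ys \<Longrightarrow> oper.subspace (S xs ys) \<and> S xs ys \<subseteq> L xs ys"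
  shows "graded (brel_of Xs Ys S)"
  using assms by (auto simp: graded_def brel_of_def subspace_zero)

lemma graded_brel_of_span:
  assumes "\<And>xs ys. xs \<in> listset Xs \<Longrightarrow> ys \<in> listset Ys \<Longrightarrow> S xs ys \<subseteq> L xs ys"
  shows "graded (brel_of Xs Ys (\<lambda>xs ys. oper.span (S xs ys)))"
  using assms by (intro graded_brel_of conjI oper.subspace_span oper.span_minimal subspace_L)

lemma graded_top: "graded (top_brel Xs Ys)"
  unfolding top_brel_def by (intro graded_brel_of conjI subspace_L order_refl)

lemma graded_compl: "graded (compl_brel R)"
  unfolding compl_brel_def
proof (rule graded_brel_of, rule conjI)
  fix xs ys :: "'a hilb list"
  show "oper.subspace {b \<in> L xs ys. \<forall>a\<in>spaces R xs ys. Tr xs (mult ys (adj a) b) = 0}"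
    using subspace_L[of xs ys]
    by (auto simp: oper.subspace_def Tr_def mult_def scale_oper_def distrib_left sum.distrib
        mult.left_commute simp flip: sum_distrib_left)
qed auto

lemma graded_meet: "graded R \<Longrightarrow> graded S \<Longrightarrow> graded (meet_brel R S)"
  unfolding meet_brel_def
  by (intro graded_brel_of conjI oper.subspace_inter graded_subspace) (auto dest: graded_in_L)

lemma graded_Sup: "(\<And>R. R \<in> RR \<Longrightarrow> graded R) \<Longrightarrow> graded (Sup_brel Xs Ys RR)"
  unfolding Sup_brel_def by (rule graded_brel_of_span) (auto dest: graded_in_L)

lemma graded_comp: "graded R \<Longrightarrow> graded S \<Longrightarrow> graded (comp_brel S R)"
  unfolding comp_brel_def by (rule graded_brel_of_span) (auto dest!: graded_in_L intro!: mult_in_L)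

lemma graded_prod: "graded R \<Longrightarrow> graded S \<Longrightarrow> graded (prod_brel R S)"
  unfolding prod_brel_def Let_def
  by (rule graded_brel_of_span) (auto intro!: tensor_in_L dest: graded_in_L)

lemma graded_adj: "graded R \<Longrightarrow> graded (adj_brel R)"
  unfolding adj_brel_def
proof (rule graded_brel_of, rule conjI)
  fix ys xs assume "graded R"
  then have sub: "oper.subspace (spaces R xs ys)"
    by (rule graded_subspace)
  show "oper.subspace (adj ` spaces R xs ys)"
    by (rule subspace_semilinear_image[OF sub _ _ surj_cnj])
      (auto simp: adj_def scale_oper_def fun_eq_iff)
  show "adj ` spaces R xs ys \<subseteq> L ys xs"
    using \<open>graded R\<close> by (auto dest: graded_in_L intro: adj_in_L)
qed

lemma graded_conj: "graded R \<Longrightarrow> graded (conj_brel R)"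
  unfolding conj_brel_def
proof (rule graded_brel_of, rule conjI)
  fix xs ys :: "'a hilb list" assume "graded R"
  then have sub: "oper.subspace (spaces R (map dual xs) (map dual ys))" (is "oper.subspace ?V")
    by (rule graded_subspace)
  show "oper.subspace (conj_oper ` ?V)"
    by (rule subspace_semilinear_image[OF sub _ _ surj_cnj])
      (auto simp: conj_oper_apply scale_oper_def fun_eq_iff)
  show "conj_oper ` ?V \<subseteq> L xs ys"
    using \<open>graded R\<close> by (auto dest: graded_in_L intro: conj_oper_in_L)
qed

lemma graded_id: "graded (id_brel Xs)"
  unfolding id_brel_def
proof (rule graded_brel_of)
  fix xs ys :: "'a hilb list"
  show "oper.subspace (if xs = ys then oper.span {id_oper xs} else {0}) \<and>
      (if xs = ys then oper.span {id_oper xs} else {0}) \<subseteq> L xs ys"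
    using oper.span_minimal[OF _ subspace_L, of "{id_oper xs}" xs xs]
    by (auto simp: oper.subspace_span subspace_zero id_oper_in_L)
qed

lemma graded_eq: "graded (eq_brel X)"
  unfolding eq_brel_def
proof (rule graded_brel_of)
  fix xs ys assume "xs \<in> listset [X, qdual X]" "ys \<in> listset ([] :: 'a qset list)"
  then show "oper.subspace (if xs ! 1 = dual (xs ! 0) then oper.span {eval_oper (xs ! 0)} else {0}) \<and>
      (if xs ! 1 = dual (xs ! 0) then oper.span {eval_oper (xs ! 0)} else {0}) \<subseteq> L xs ys"
    using oper.span_minimal[OF _ subspace_L, of "{eval_oper (xs ! 0)}" xs ys]
    by (auto simp: oper.subspace_span subspace_zero eval_oper_in_L)
qed

lemma graded_hat: "graded F \<Longrightarrow> graded (hat_brel F)"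
  unfolding hat_brel_def Let_def by (intro graded_comp graded_prod graded_id graded_eq)

lemma graded_atm:
  assumes "graded R"
  shows "graded (atm_brel vs R us)"
  unfolding atm_brel_def Let_def
proof (rule graded_brel_of, rule conjI)
  fix xs ys :: "'a hilb list"
  let ?p = "arg_perm vs us"
  let ?T = "foldl prod_brel R
    (map (\<lambda>X. top_brel [X] []) (drop (length us) (permute ?p (map snd vs))))"
  have "graded (foldl prod_brel R (map (\<lambda>X. top_brel [X] []) Xs))" for Xs
    using assms by (induction Xs arbitrary: R) (simp_all add: graded_prod graded_top)
  then have T: "graded ?T" .
  let ?f = "\<lambda>r. mult (permute ?p xs) r (perm_oper ?p xs)"
  show "oper.subspace (?f ` spaces ?T (permute ?p xs) ys)"
    by (rule subspace_semilinear_image[OF graded_subspace[OF T], where g = id])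
      (simp_all add: mult_def scale_oper_def fun_eq_iff distrib_right sum.distrib sum_distrib_left
        mult.assoc)
  have "perm_oper ?p xs k i \<noteq> 0 \<Longrightarrow> i \<in> basis xs" for k i
    by (simp add: perm_oper_def split: if_splits)
  then show "?f ` spaces ?T (permute ?p xs) ys \<subseteq> L xs ys"
    using graded_in_L[OF T, of _ "permute ?p xs" ys]
    by (fastforce simp: L_def mult_def elim!: sum.not_neutral_contains_not_neutral)
qed


section \<open>Components of an interpretation\<close>

definition graded_fm :: "'l fm \<Rightarrow> bool" where
  "graded_fm \<phi> \<longleftrightarrow> (\<forall>vs. graded (interp vs \<phi>))"

lemma src_interp [simp]: "src (interp vs \<phi>) = map snd vs"
  and tgt_interp [simp]: "tgt (interp vs \<phi>) = []"
  by (induction \<phi> arbitrary: vs)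
    (simp_all add: atm_brel_def compl_brel_def meet_brel_def Sup_brel_def Let_def)

lemma graded_fm_intros [simp, intro]:
  "graded R \<Longrightarrow> graded_fm (Atm R us)"
  "graded_fm (Neg \<phi>)"
  "graded_fm \<phi> \<Longrightarrow> graded_fm \<psi> \<Longrightarrow> graded_fm (And \<phi> \<psi>)"
  "graded_fm (All x \<phi>)"
  by (auto simp: graded_fm_def graded_atm graded_compl graded_meet is_brel_iff intro!: graded_Sup)

text \<open>The tensor product of the \<open>k\<close>-th coordinate functional with the functional \<open>t\<close>.\<close>

definition cons_oper :: "nat \<Rightarrow> oper \<Rightarrow> oper" where
  "cons_oper k t = (\<lambda>j i. case i of [] \<Rightarrow> 0 | k' # i' \<Rightarrow> if k' = k then t j i' else 0)"

lemma cons_oper_linear: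
  "cons_oper k (s + t) = cons_oper k s + cons_oper k t"
  "cons_oper k (scale_oper c t) = scale_oper c (cons_oper k t)"
  "cons_oper k 0 = 0"
  by (auto simp: cons_oper_def scale_oper_def fun_eq_iff split: list.split)

lemma cons_oper_in_L: "k < hdim h \<Longrightarrow> t \<in> L xs ys \<Longrightarrow> cons_oper k t \<in> L (h # xs) ys"
  by (auto simp: L_def cons_oper_def split: list.splits if_splits)

lemma sum_apply: "(\<Sum>a\<in>A. f a) x = (\<Sum>a\<in>A. f a x)"
  by (induction A rule: infinite_finite_induct) auto

lemma functional_tensor_eq:
  assumes "r \<in> L [h] []"
  shows "tensor 0 (Suc 0) r s = (\<Sum>k<hdim h. scale_oper (r [] [k]) (cons_oper k s))"
proof (intro ext)
  fix j i :: "nat list"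
  show "tensor 0 (Suc 0) r s j i = (\<Sum>k<hdim h. scale_oper (r [] [k]) (cons_oper k s)) j i"
  proof (cases i)
    case Nil
    then show ?thesis
      using L_zero[OF assms, of "[]" "[]"]
      by (simp add: sum_apply tensor_def scale_oper_def cons_oper_def basis_def)
  next
    case (Cons k i')
    then show ?thesis
      using L_zero[OF assms, of "[]" "[k]"]
      by (auto simp: sum_apply tensor_def scale_oper_def cons_oper_def if_distrib cong: if_cong)
  qed
qed

text \<open>The condition on \<open>t\<close> is linear, so it passes from the relations whose join defines the
  quantifier to the join.  Conversely, the line through a functional with this property is the only
  nonzero component of one of these relations.\<close>

lemma interp_All:
  assumes \<phi>: "graded_fm \<phi>" and sorts: "\<forall>v\<in>set (x # vs). quantum_set (snd v)"
    and xs: "xs \<in> listset (map snd vs)"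
  shows "t \<in> spaces (interp vs (All x \<phi>)) xs [] \<longleftrightarrow>
    t \<in> L xs [] \<and> (\<forall>h\<in>snd x. \<forall>k<hdim h. cons_oper k t \<in> spaces (interp (x # vs) \<phi>) (h # xs) [])"
    (is "?l \<longleftrightarrow> ?r")
proof -
  let ?I = "interp (x # vs) \<phi>"
  let ?G = "{t \<in> L xs []. \<forall>h\<in>snd x. \<forall>k<hdim h. cons_oper k t \<in> spaces ?I (h # xs) []}"
  let ?RR = "{R. is_brel R \<and> src R = map snd vs \<and> tgt R = [] \<and>
    brel_le (prod_brel (top_brel [snd x] []) R) ?I}"
  have I: "graded ?I"
    using \<phi> by (simp add: graded_fm_def)
  note sub = graded_subspace[OF I]
  have l: "?l \<longleftrightarrow> t \<in> oper.span (\<Union>R\<in>?RR. spaces R xs [])"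
    using xs by (simp add: Sup_brel_def)
  have G: "oper.subspace ?G"
    using subspace_L[of xs "[]"] sub
    by (auto simp: oper.subspace_def cons_oper_linear)
  have "spaces R xs [] \<subseteq> ?G" if R: "R \<in> ?RR" for R
  proof
    fix s assume s: "s \<in> spaces R xs []"
    have "cons_oper k s \<in> spaces ?I (h # xs) []" if h: "h \<in> snd x" "k < hdim h" for h k
    proof -
      let ?d = "\<lambda>j i. if j = [] \<and> i = [k] then 1 else 0 :: complex"
      have d: "?d \<in> L [h] []"
        using h by (auto simp: L_def)
      have "tensor 0 (Suc 0) ?d s = cons_oper k s"
        by (auto simp: tensor_def cons_oper_def fun_eq_iff split: list.split)
      then have "cons_oper k s \<in> {tensor 0 (Suc 0) r s |r s. r \<in> L [h] [] \<and> s \<in> spaces R xs []}"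
        using d s by (intro CollectI exI[of _ ?d] exI[of _ s]) simp
      then have "cons_oper k s \<in> spaces (prod_brel (top_brel [snd x] []) R) (h # xs) []"
        using h R xs by (auto simp: prod_brel_def top_brel_def Let_def intro: oper.span_base)
      then show ?thesis
        using R by (auto simp: brel_le_def)
    qed
    moreover have "s \<in> L xs []"
      using R s by (auto simp: is_brel_iff dest: graded_in_L)
    ultimately show "s \<in> ?G"
      by simp
  qed
  then have "oper.span (\<Union>R\<in>?RR. spaces R xs []) \<subseteq> ?G"
    by (intro oper.span_minimal UN_least G)
  moreover have "t \<in> oper.span (\<Union>R\<in>?RR. spaces R xs [])" if t: "t \<in> ?G"
  proof -
    define R where "R = brel_of (map snd vs) [] (\<lambda>ys _. oper.span (if ys = xs then {t} else {}))"
    have "graded R"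
      unfolding R_def by (rule graded_brel_of_span) (use t in auto)
    moreover have "spaces (prod_brel (top_brel [snd x] []) R) ys zs \<subseteq> spaces ?I ys zs" for ys zs
    proof (cases "ys \<in> listset (map snd (x # vs)) \<and> zs = []")
      case False
      then show ?thesis
        using oper.subspace_0[OF sub] by (auto simp: prod_brel_def top_brel_def R_def brel_of_def Let_def)
    next
      case True
      then obtain h ys' where ys: "ys = h # ys'" "h \<in> snd x" "ys' \<in> listset (map snd vs)"
        by auto
      have "tensor 0 (Suc 0) r s \<in> spaces ?I ys []"
        if r: "r \<in> L [h] []" and s: "s \<in> oper.span (if ys' = xs then {t} else {})" for r s
      proof -
        have "cons_oper k s \<in> spaces ?I ys []" if k: "k < hdim h" for k
        proof (cases "ys' = xs")
          case True
          then obtain c where "s = scale_oper c t"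
            using s by (auto simp: oper.span_singleton)
          then show ?thesis
            using t k ys True oper.subspace_scale[OF sub] by (auto simp: cons_oper_linear)
        next
          case False
          then show ?thesis
            using s oper.subspace_0[OF sub] by (simp add: cons_oper_linear)
        qed
        then show ?thesis
          unfolding functional_tensor_eq[OF r]
          by (intro oper.subspace_sum[OF sub] oper.subspace_scale[OF sub]) auto
      qed
      then have "{tensor 0 (Suc 0) r s |r s. r \<in> L [h] [] \<and> s \<in> oper.span (if ys' = xs then {t} else {})}
          \<subseteq> spaces ?I ys []"
        by blast
      then have "oper.span {tensor 0 (Suc 0) r s |r s.
          r \<in> L [h] [] \<and> s \<in> oper.span (if ys' = xs then {t} else {})} \<subseteq> spaces ?I ys []"
        by (intro oper.span_minimal sub)
      then show ?thesis
        using True ys by (simp add: prod_brel_def top_brel_def R_def Let_def)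
    qed
    ultimately have "R \<in> ?RR"
      using sorts by (auto simp: R_def is_brel_iff brel_le_def prod_brel_def top_brel_def Let_def)
    moreover have "t \<in> spaces R xs []"
      using xs by (simp add: R_def oper.span_base)
    ultimately show ?thesis
      by (intro oper.span_base) blast
  qed
  ultimately show ?thesis
    using l by blast
qed

lemma slice_in_L: "s \<in> L (h # xs) [] \<Longrightarrow> (\<lambda>j i. s j (k # i)) \<in> L xs []"
  unfolding L_def mem_Collect_eq
proof (intro allI impI)
  fix j i
  assume s: "\<forall>j i. s j i \<noteq> 0 \<longrightarrow> j \<in> basis ([] :: 'a hilb list) \<and> i \<in> basis (h # xs)"
    and "s j (k # i) \<noteq> 0"
  from this(2) have "j \<in> basis ([] :: 'a hilb list) \<and> k # i \<in> basis (h # xs)"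
    by (rule s[THEN spec, THEN spec, THEN mp])
  then show "j \<in> basis ([] :: 'a hilb list) \<and> i \<in> basis xs"
    by simp
qed

lemma functional_eq_sum_slices:
  assumes s: "s \<in> L (h # xs) []"
  shows "s = (\<Sum>k<hdim h. cons_oper k (\<lambda>j i. s j (k # i)))"
proof (intro ext)
  fix j i
  show "s j i = (\<Sum>k<hdim h. cons_oper k (\<lambda>j i. s j (k # i))) j i"
    using L_zero[OF s, of j i] by (cases i) (simp_all add: sum_apply cons_oper_def)
qed

lemma eq_top_brel_iff:
  assumes R: "graded R" "tgt R = []"
  shows "R = top_brel (src R) [] \<longleftrightarrow> (\<forall>xs\<in>listset (src R). L xs [] \<subseteq> spaces R xs [])"
proof
  assume top: "R = top_brel (src R) []"
  have "spaces (top_brel (src R) []) xs [] = L xs []" if "xs \<in> listset (src R)" for xs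
    using that by (simp add: top_brel_def)
  with top show "\<forall>xs\<in>listset (src R). L xs [] \<subseteq> spaces R xs []"
    by (metis order_refl)
next
  assume all: "\<forall>xs\<in>listset (src R). L xs [] \<subseteq> spaces R xs []"
  show "R = top_brel (src R) []"
  proof (rule brel_eqI[OF R(1) graded_top])
    show "src R = src (top_brel (src R) [])" "tgt R = tgt (top_brel (src R) [])"
      by (simp_all add: top_brel_def R(2))
    fix xs ys
    assume "xs \<in> listset (src (top_brel (src R) []))" "ys \<in> listset (tgt (top_brel (src R) []))"
    then have xs: "xs \<in> listset (src R)" and ys: "ys = []"
      by (simp_all add: top_brel_def)
    have "spaces R xs [] = L xs []"
      using graded_in_L[OF R(1)] all xs by blast
    then show "spaces R xs ys = spaces (top_brel (src R) []) xs ys"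
      using xs by (simp add: ys top_brel_def)
  qed
qed

text \<open>Every functional on \<open>h \<otimes> X\<close> is a sum of functionals \<open>\<delta>\<^sub>k \<otimes> t\<close>, so the quantified formula is
  valid only if its body is.\<close>

lemma interp_All_top_component_iff:
  assumes \<phi>: "graded_fm \<phi>" and sorts: "\<forall>v\<in>set (x # vs). quantum_set (snd v)"
    and xs: "xs \<in> listset (map snd vs)"
  shows "L xs [] \<subseteq> spaces (interp vs (All x \<phi>)) xs [] \<longleftrightarrow>
    (\<forall>h\<in>snd x. L (h # xs) [] \<subseteq> spaces (interp (x # vs) \<phi>) (h # xs) [])"
proof (intro iffI ballI subsetI)
  fix h s
  assume top: "L xs [] \<subseteq> spaces (interp vs (All x \<phi>)) xs []" and h: "h \<in> snd x" and s: "s \<in> L (h # xs) []"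
  have I: "graded (interp (x # vs) \<phi>)"
    using \<phi> by (simp add: graded_fm_def)
  have "cons_oper k (\<lambda>j i. s j (k # i)) \<in> spaces (interp (x # vs) \<phi>) (h # xs) []" if "k < hdim h" for k
    using subsetD[OF top slice_in_L[OF s]] h that unfolding interp_All[OF assms] by simp
  then have "(\<Sum>k<hdim h. cons_oper k (\<lambda>j i. s j (k # i))) \<in> spaces (interp (x # vs) \<phi>) (h # xs) []"
    by (intro oper.subspace_sum[OF graded_subspace[OF I]]) simp
  then show "s \<in> spaces (interp (x # vs) \<phi>) (h # xs) []"
    by (simp flip: functional_eq_sum_slices[OF s])
next
  fix t
  assume "\<forall>h\<in>snd x. L (h # xs) [] \<subseteq> spaces (interp (x # vs) \<phi>) (h # xs) []" and "t \<in> L xs []"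
  then show "t \<in> spaces (interp vs (All x \<phi>)) xs []"
    unfolding interp_All[OF assms] by (auto intro: cons_oper_in_L)
qed

text \<open>Tensoring with \<open>\<top>\<close> leaves the functional unconstrained in the new factors: only its
  slices in the old factors matter.\<close>

lemma prod_brel_top:
  assumes R: "graded R" "tgt R = []" and ws: "ws \<in> listset (src R)" and z: "z \<in> Z"
  shows "spaces (prod_brel R (top_brel [Z] [])) (ws @ [z]) [] =
    {t \<in> L (ws @ [z]) []. \<forall>k<hdim z. (\<lambda>j i. t j (i @ [k])) \<in> spaces R ws []}" (is "?S = ?G")
proof -
  let ?n = "length ws"
  note sub = graded_subspace[OF R(1)]
  let ?gen = "{tensor 0 ?n r s |r s. r \<in> spaces R ws [] \<and> s \<in> L [z] []}"
  have n: "length (src R) = ?n"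
    using ws by (simp add: listset_iff list_all2_lengthD)
  have S: "?S = oper.span ?gen"
    using ws z R(2)
    by (simp add: prod_brel_def top_brel_def Let_def n listset_iff list_all2_appendI)
  have gen_L: "?gen \<subseteq> L (ws @ [z]) []"
    using R(1) by (auto intro!: tensor_in_L dest: graded_in_L)
  have "oper.span ?gen \<subseteq> ?G"
  proof (rule oper.span_minimal)
    have "(\<lambda>j i. tensor 0 ?n r s j (i @ [k])) \<in> spaces R ws []"
      if r: "r \<in> spaces R ws []" and s: "s \<in> L [z] []" for r s k
    proof -
      have "tensor 0 ?n r s j (i @ [k]) = scale_oper (s [] [k]) r j i" for j i
      proof (cases "j = [] \<and> length i = ?n")
        case True
        then show ?thesis
          by (simp add: tensor_def scale_oper_def)
      next
        case False
        then have "r j i = 0"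
          using L_zero[OF graded_in_L[OF R(1) r], of j i] length_basis by auto
        moreover have "s j (drop ?n (i @ [k])) = 0 \<or> r [] (take ?n (i @ [k])) = 0"
          using False L_zero[OF graded_in_L[OF R(1) r], of "[]" "take ?n (i @ [k])"]
            L_zero[OF s, of j "drop ?n (i @ [k])"] length_basis[of "take ?n (i @ [k])" ws]
            length_basis[of "drop ?n (i @ [k])" "[z]"]
          by fastforce
        ultimately show ?thesis
          by (auto simp: tensor_def scale_oper_def)
      qed
      then have "(\<lambda>j i. tensor 0 ?n r s j (i @ [k])) = scale_oper (s [] [k]) r"
        by (intro ext)
      then show ?thesis
        using oper.subspace_scale[OF sub r] by simp
    qed
    then show "?gen \<subseteq> ?G"
      using gen_L by blast
    have "(\<lambda>j i. (a + b) j (i @ [k])) = (\<lambda>j i. a j (i @ [k])) + (\<lambda>j i. b j (i @ [k]))"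
      "(\<lambda>j i. scale_oper c a j (i @ [k])) = scale_oper c (\<lambda>j i. a j (i @ [k]))"
      "(\<lambda>j i. (0 :: oper) j (i @ [k])) = 0" for a b :: oper and c k
      by (auto simp: scale_oper_def fun_eq_iff)
    then show "oper.subspace ?G"
      using sub[of ws "[]"] subspace_L[of "ws @ [z]" "[]"]
      by (auto simp: oper.subspace_def)
  qed
  moreover have "t \<in> oper.span ?gen" if t: "t \<in> ?G" for t
  proof -
    \<comment> \<open>\<open>t\<close> is the sum over \<open>k\<close> of its slice at \<open>k\<close> tensored with the \<open>k\<close>-th coordinate functional\<close>
    define d :: "nat \<Rightarrow> oper" where "d k = (\<lambda>j i. if j = [] \<and> i = [k] then 1 else 0 :: complex)" for k
    define u where "u k = tensor 0 ?n (\<lambda>j i. t j (i @ [k])) (d k)" for k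
    have u: "u k \<in> ?gen" if "k < hdim z" for k
    proof -
      have "d k \<in> L [z] []"
        using that by (auto simp: d_def L_def)
      then show ?thesis
        using t that unfolding u_def by blast
    qed
    have "t = (\<Sum>k<hdim z. u k)"
    proof (rule L_eqI)
      show "t \<in> L (ws @ [z]) []"
        using t by simp
      show "(\<Sum>k<hdim z. u k) \<in> L (ws @ [z]) []"
        using u gen_L by (intro oper.subspace_sum[OF subspace_L]) blast
      fix j i
      assume "j \<in> basis ([] :: 'a hilb list)" "i \<in> basis (ws @ [z])"
      then obtain i' k' where "j = []" "i = i' @ [k']" "length i' = ?n" "k' < hdim z"
        by (auto elim!: basis_appendE simp: basis_Cons length_basis)
      then show "t j i = (\<Sum>k<hdim z. u k) j i"
        by (simp add: sum_apply u_def tensor_def d_def if_distrib cong: if_cong)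
    qed
    also have "\<dots> \<in> oper.span ?gen"
      using u by (intro oper.span_sum oper.span_base) auto
    finally show ?thesis .
  qed
  ultimately show ?thesis
    using S by blast
qed

lemma foldl_prod_brel_simps [simp]:
  "src (foldl prod_brel R (map (\<lambda>X. top_brel [X] []) Zs)) = src R @ Zs"
  "tgt (foldl prod_brel R (map (\<lambda>X. top_brel [X] []) Zs)) = tgt R"
  by (induction Zs arbitrary: R) (simp_all add: prod_brel_def top_brel_def Let_def)

lemma graded_foldl_prod_brel:
  "graded R \<Longrightarrow> graded (foldl prod_brel R (map (\<lambda>X. top_brel [X] []) Zs))"
  by (induction Zs arbitrary: R) (simp_all add: graded_prod graded_top)

lemma foldl_prod_brel_top:
  assumes R: "graded R" "tgt R = []" and ws: "ws \<in> listset (src R)" and "zs \<in> listset Zs"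
  shows "spaces (foldl prod_brel R (map (\<lambda>X. top_brel [X] []) Zs)) (ws @ zs) [] =
    {t \<in> L (ws @ zs) []. \<forall>k\<in>basis zs. (\<lambda>j i. t j (i @ k)) \<in> spaces R ws []}"
  using \<open>zs \<in> _\<close>
proof (induction Zs arbitrary: zs rule: rev_induct)
  case Nil
  then show ?case
    using R by (auto dest: graded_in_L)
next
  case (snoc Z Zs)
  then obtain zs' z where zs: "zs = zs' @ [z]" "zs' \<in> listset Zs" "z \<in> Z"
    by (auto simp: listset_iff list_all2_append2 list_all2_Cons2)
  let ?T = "foldl prod_brel R (map (\<lambda>X. top_brel [X] []) Zs)"
  have "ws @ zs' \<in> listset (src ?T)"
    using ws zs by (simp add: listset_iff list_all2_appendI)
  then have T: "spaces (prod_brel ?T (top_brel [Z] [])) ((ws @ zs') @ [z]) [] =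
      {t \<in> L ((ws @ zs') @ [z]) []. \<forall>k<hdim z. (\<lambda>j i. t j (i @ [k])) \<in> spaces ?T (ws @ zs') []}"
    using R zs by (intro prod_brel_top graded_foldl_prod_brel) simp_all
  have "(\<lambda>j i. t j (i @ [k])) \<in> L (ws @ zs') []"
    if "t \<in> L ((ws @ zs') @ [z]) []" for t k
    unfolding L_def mem_Collect_eq
  proof (intro allI impI)
    fix j i assume "t j (i @ [k]) \<noteq> 0"
    then have "j = [] \<and> i @ [k] \<in> basis ((ws @ zs') @ [z])"
      using that by (auto simp: L_def)
    then show "j \<in> basis ([] :: 'a hilb list) \<and> i \<in> basis (ws @ zs')"
      using length_basis[of "i @ [k]" "(ws @ zs') @ [z]"] by (simp add: append_in_basis flip: append_assoc)
  qed
  moreover have "(\<forall>k\<in>basis zs. P k) \<longleftrightarrow> (\<forall>k<hdim z. \<forall>k'\<in>basis zs'. P (k' @ [k]))" for P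
  proof (intro iffI ballI allI impI)
    fix k k' assume "\<forall>k\<in>basis zs. P k" "k < hdim z" "k' \<in> basis zs'"
    then show "P (k' @ [k])"
      using append_in_basisI[of k' zs' "[k]" "[z]"] zs(1) by simp
  next
    fix k assume P: "\<forall>k<hdim z. \<forall>k'\<in>basis zs'. P (k' @ [k])" and "k \<in> basis zs"
    then obtain k1 k2 where "k = k1 @ k2" "k1 \<in> basis zs'" "k2 \<in> basis [z]"
      unfolding zs(1) by (elim basis_appendE)
    then show "P k"
      using P by (auto simp: basis_Cons)
  qed
  ultimately show ?case
    using T zs by (auto simp: snoc.IH)
qed

lemma position_nth: "u \<in> set vs \<Longrightarrow> position vs u < length vs \<and> vs ! position vs u = u"
  by (induction vs) auto

lemma position_nth_distinct: "distinct vs \<Longrightarrow> k < length vs \<Longrightarrow> position vs (vs ! k) = k"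
  by (metis nth_eq_iff_index_eq nth_mem position_nth)

lemma permute_arg_perm:
  assumes "distinct vs" "set us \<subseteq> set vs"
  shows "permute (arg_perm vs us) (map f vs) = map f (us @ filter (\<lambda>v. v \<notin> set us) vs)"
proof -
  have "filter (\<lambda>v. v \<notin> set us) vs = filter (\<lambda>v. v \<notin> set us) (map ((!) vs) [0..<length vs])"
    by (simp add: map_nth)
  also have "\<dots> = map ((!) vs) (filter (\<lambda>k. vs ! k \<notin> set us) [0..<length vs])"
    by (simp add: filter_map comp_def)
  also have "filter (\<lambda>k. vs ! k \<notin> set us) [0..<length vs] =
      filter (\<lambda>k. k \<notin> set (map (position vs) us)) [0..<length vs]"
    using assms position_nth_distinct[of vs] position_nth[of _ vs]
    by (intro filter_cong) (fastforce simp: image_iff)+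
  finally show ?thesis
    using assms position_nth[of _ vs] by (auto simp: permute_def arg_perm_def subset_iff)
qed

lemma map_in_basis_iff: "map \<iota> vs \<in> basis (map \<alpha> vs) \<longleftrightarrow> (\<forall>v\<in>set vs. \<iota> v < hdim (\<alpha> v))"
  by (simp add: basis_iff list_all2_map1 list_all2_map2 list_all2_same)

lemma basis_mapE:
  assumes "distinct vs" "i \<in> basis (map \<alpha> vs)"
  obtains \<iota> where "i = map \<iota> vs"
proof
  show "i = map (\<lambda>v. i ! position vs v) vs"
    using assms length_basis[OF assms(2)]
    by (intro nth_equalityI) (simp_all add: position_nth_distinct)
qed

definition assign :: "'v list \<Rightarrow> nat list \<Rightarrow> ('v \<Rightarrow> nat) \<Rightarrow> 'v \<Rightarrow> nat" where
  "assign us k \<iota> v = (if v \<in> set us then k ! position us v else \<iota> v)"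

lemma map_assign:
  assumes "distinct us" "length k = length us"
  shows "map (assign us k \<iota>) us = k"
  using assms by (intro nth_equalityI) (simp_all add: assign_def position_nth_distinct)

lemma map_assign_disjoint: "set vs \<inter> set us = {} \<Longrightarrow> map (assign us k \<iota>) vs = map \<iota> vs"
  by (auto simp: assign_def)

text \<open>Tensor factors are addressed by variables rather than by positions: an index of
  \<open>X\<^sub>1 \<otimes> \<dots> \<otimes> X\<^sub>n\<close> is \<open>map \<iota> vs\<close> for an assignment \<open>\<iota>\<close> of basis indices to the variables.  The
  permutation in the definition then disappears, and what is left is that every slice obtained by
  fixing the variables outside \<open>us\<close> belongs to \<open>R\<close>.\<close>

lemma interp_Atm:
  fixes R :: "'l brel" and \<alpha> :: "'l var \<Rightarrow> 'l hilb"
  assumes R: "graded R" "src R = map snd us" "tgt R = []"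
    and us: "distinct vs" "distinct us" "set us \<subseteq> set vs"
    and \<alpha>: "\<forall>v\<in>set vs. \<alpha> v \<in> snd v"
  shows "t \<in> spaces (interp vs (Atm R us)) (map \<alpha> vs) [] \<longleftrightarrow>
    t \<in> L (map \<alpha> vs) [] \<and>
    (\<forall>\<iota>. (\<forall>v\<in>set vs. \<iota> v < hdim (\<alpha> v)) \<longrightarrow>
      (\<lambda>j k. if k \<in> basis (map \<alpha> us) then t j (map (assign us k \<iota>) vs) else 0)
        \<in> spaces R (map \<alpha> us) [])" (is "_ \<longleftrightarrow> ?r t")
proof -
  let ?us = "map \<alpha> us" and ?vs = "map \<alpha> vs"
  let ?p = "arg_perm vs us" and ?rest = "filter (\<lambda>v. v \<notin> set us) vs"
  let ?T = "foldl prod_brel R (map (\<lambda>X. top_brel [X] []) (map snd ?rest))"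
  let ?ws = "map \<alpha> (us @ ?rest)" and ?zs = "map \<alpha> ?rest"
  have listset: "?vs \<in> listset (map snd vs)" "?us \<in> listset (src R)"
    "?zs \<in> listset (map snd ?rest)"
    using \<alpha> us R by (auto simp: listset_iff list_all2_map1 list_all2_map2 intro!: list.rel_refl_strong)
  have perm: "permute ?p (map f vs) = map f (us @ ?rest)" for f :: "'l var \<Rightarrow> 'c"
    using us(1,3) by (rule permute_arg_perm)
  have set: "set (us @ ?rest) = set vs"
    using us by auto
  have atm: "spaces (interp vs (Atm R us)) (?vs) [] =
      (\<lambda>r. mult ?ws r (perm_oper ?p (?vs))) ` spaces ?T ?ws []"
    using listset(1) by (simp add: atm_brel_def Let_def perm)
  have T: "r \<in> spaces ?T ?ws [] \<longleftrightarrow> r \<in> L ?ws [] \<and>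
      (\<forall>k\<in>basis (?zs). (\<lambda>j i. r j (i @ k)) \<in> spaces R (?us) [])" for r
    using foldl_prod_brel_top[OF R(1,3) listset(2,3)] by simp
  have mult: "mult ?ws r (perm_oper ?p (?vs)) j (map \<iota> vs) = r j (map \<iota> (us @ ?rest))"
    if "\<forall>v\<in>set vs. \<iota> v < hdim (\<alpha> v)" for r :: oper and \<iota> j
  proof -
    have "map \<iota> vs \<in> basis (?vs)" "map \<iota> (us @ ?rest) \<in> basis ?ws"
      unfolding map_in_basis_iff using that us by auto
    then show ?thesis
      by (simp add: mult_def perm_oper_def perm if_distrib cong: if_cong)
  qed
  have slice: "map (assign us k \<iota>) (us @ ?rest) = k @ map \<iota> ?rest"
    if "k \<in> basis (?us)" for k \<iota>
    using that us length_basis[OF that] by (simp add: map_assign) (simp add: assign_def)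
  have assign: "\<forall>v\<in>set vs. assign us k \<iota> v < hdim (\<alpha> v)"
    if "k \<in> basis (?us)" "\<forall>v\<in>set vs. \<iota> v < hdim (\<alpha> v)" for k \<iota>
  proof -
    have "map (assign us k \<iota>) (us @ ?rest) \<in> basis (map \<alpha> (us @ ?rest))"
      unfolding slice[OF that(1)] using that us
      by (simp add: append_in_basisI map_in_basis_iff)
    then show ?thesis
      unfolding map_in_basis_iff set .
  qed
  have graded: "graded (interp vs (Atm R us))"
    using R graded_fm_def graded_fm_intros(1) by blast
  show ?thesis
  proof
    assume t: "t \<in> spaces (interp vs (Atm R us)) (?vs) []"
    then obtain r where r: "r \<in> spaces ?T ?ws []" "t = mult ?ws r (perm_oper ?p (?vs))"
      unfolding atm by blast
    have "(\<lambda>j k. if k \<in> basis (?us) then t j (map (assign us k \<iota>) vs) else 0) =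
        (\<lambda>j k. r j (k @ map \<iota> ?rest))" if \<iota>: "\<forall>v\<in>set vs. \<iota> v < hdim (\<alpha> v)" for \<iota>
    proof (intro ext)
      fix j k
      have "r j (k @ map \<iota> ?rest) = 0" if "k \<notin> basis (?us)"
      proof (rule L_zero)
        show "r \<in> L ?ws []"
          using r T by blast
        show "j \<notin> basis ([] :: 'l hilb list) \<or> k @ map \<iota> ?rest \<notin> basis ?ws"
          using that length_basis[of "k @ map \<iota> ?rest" ?ws] by (auto simp: append_in_basis)
      qed
      then show "(if k \<in> basis (?us) then t j (map (assign us k \<iota>) vs) else 0) =
          r j (k @ map \<iota> ?rest)"
        using mult[OF assign[OF _ \<iota>], of k r j] slice[of k \<iota>] r(2)
        by (cases "k \<in> basis (?us)") (simp_all only: if_True if_False simp_thms)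
    qed
    moreover have "map \<iota> ?rest \<in> basis (?zs)" if \<iota>: "\<forall>v\<in>set vs. \<iota> v < hdim (\<alpha> v)" for \<iota>
      unfolding map_in_basis_iff using that by simp
    ultimately show "?r t"
      using r(1) T graded_in_L[OF graded t] by simp
  next
    assume t: "?r t"
    then have tL: "t \<in> L (?vs) []"
      by blast
    let ?r = "\<lambda>j i. if i \<in> basis ?ws then t j (map (\<lambda>v. i ! position (us @ ?rest) v) vs) else 0"
    have r: "?r j (map \<iota> (us @ ?rest)) = t j (map \<iota> vs)" if \<iota>: "\<forall>v\<in>set vs. \<iota> v < hdim (\<alpha> v)" for \<iota> j
    proof -
      have "map \<iota> (us @ ?rest) \<in> basis ?ws"
        unfolding map_in_basis_iff set using \<iota> .
      moreover have "map \<iota> (us @ ?rest) ! position (us @ ?rest) v = \<iota> v" if "v \<in> set vs" for v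
        using position_nth[of v "us @ ?rest"] that set by (metis nth_map)
      ultimately show ?thesis
        by (simp cong: map_cong)
    qed
    have "?r \<in> spaces ?T ?ws []"
      unfolding T
    proof (intro conjI ballI)
      show "?r \<in> L ?ws []"
        using tL by (auto simp: L_def)
      fix k assume k: "k \<in> basis (?zs)"
      then obtain \<iota>0 where \<iota>0: "k = map \<iota>0 ?rest"
        using basis_mapE[OF distinct_filter[OF us(1)]] by blast
      \<comment> \<open>the values on \<open>us\<close> get overwritten below\<close>
      define \<iota> where "\<iota> v = (if v \<in> set ?rest then \<iota>0 v else 0)" for v
      have \<iota>: "k = map \<iota> ?rest"
        unfolding \<iota>0 by (simp add: \<iota>_def)
      show "(\<lambda>j i. ?r j (i @ k)) \<in> spaces R (?us) []"
      proof (cases "\<exists>i. i \<in> basis (?us)")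
        case True
        then obtain i where i: "i \<in> basis (?us)"
          by blast
        have "map (assign us i \<iota>) (us @ ?rest) \<in> basis ?ws"
          unfolding slice[OF i] using i k \<iota> by (simp add: append_in_basisI)
        then have valid: "\<forall>v\<in>set vs. assign us i \<iota> v < hdim (\<alpha> v)"
          unfolding map_in_basis_iff set .
        have "(\<lambda>j i'. ?r j (i' @ k)) = (\<lambda>j i'. if i' \<in> basis (?us)
            then t j (map (assign us i' (assign us i \<iota>)) vs) else 0)"
        proof (intro ext)
          fix j i'
          show "?r j (i' @ k) = (if i' \<in> basis (?us)
              then t j (map (assign us i' (assign us i \<iota>)) vs) else 0)"
          proof (cases "i' \<in> basis (?us)")
            case True
            have eq: "map (assign us i' (assign us i \<iota>)) (us @ ?rest) = i' @ k"
              unfolding slice[OF True] \<iota> by (simp add: assign_def)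
            then show ?thesis
              using r[OF assign[OF True valid], of j] True unfolding eq by (simp only: if_True)
          next
            case False
            then have "i' @ k \<notin> basis ?ws"
              using length_basis[of "i' @ k" ?ws] length_basis[OF k] by (auto simp: append_in_basis)
            then show ?thesis
              using False by simp
          qed
        qed
        then show ?thesis
          using t valid by simp
      next
        case False
        then have "i @ k \<notin> basis ?ws" for i
          using length_basis[of "i @ k" ?ws] length_basis[OF k] by (auto simp: append_in_basis)
        then have "(\<lambda>j i. ?r j (i @ k)) = 0"
          by (simp add: fun_eq_iff)
        then show ?thesis
          using oper.subspace_0[OF graded_subspace[OF R(1)]] by simp
      qed
    qed
    moreover have "t = mult ?ws ?r (perm_oper ?p (?vs))"
    proof (rule L_eqI)
      show "t \<in> L (?vs) []"
        using t by blast
      show "mult ?ws ?r (perm_oper ?p (?vs)) \<in> L (?vs) []"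
        using calculation atm graded_in_L[OF graded] by blast
      fix j i assume i: "i \<in> basis (?vs)"
      then obtain \<iota> where "i = map \<iota> vs"
        using basis_mapE[OF us(1)] by blast
      then show "t j i = mult ?ws ?r (perm_oper ?p (?vs)) j i"
        using mult[of \<iota> ?r j] r[of \<iota> j] i map_in_basis_iff by fastforce
    qed
    ultimately show "t \<in> spaces (interp vs (Atm R us)) (?vs) []"
      unfolding atm by blast
  qed
qed


section \<open>Orthogonal complements of spaces of functionals\<close>

definition perp :: "'l hilb list \<Rightarrow> oper set \<Rightarrow> oper set" where
  "perp xs S = {b \<in> L xs []. \<forall>a\<in>S. (\<Sum>i\<in>basis xs. cnj (a [] i) * b [] i) = 0}"

lemma perp_in_L: "perp xs S \<subseteq> L xs []"
  by (auto simp: perp_def)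

lemma subspace_perp: "oper.subspace (perp xs S)"
  by (rule oper.subspaceI)
    (auto simp: perp_def subspace_L oper.subspace_0 oper.subspace_add oper.subspace_scale
      scale_oper_apply distrib_left sum.distrib mult.left_commute simp flip: sum_distrib_left)

lemma perp_antimono: "S \<subseteq> T \<Longrightarrow> perp xs T \<subseteq> perp xs S"
  by (auto simp: perp_def)

lemma subset_perp_perp: "S \<subseteq> L xs [] \<Longrightarrow> S \<subseteq> perp xs (perp xs S)"
proof
  fix a assume "S \<subseteq> L xs []" "a \<in> S"
  moreover have "(\<Sum>i\<in>basis xs. cnj (b [] i) * a [] i) = cnj (\<Sum>i\<in>basis xs. cnj (a [] i) * b [] i)"
    for b :: oper
    by (simp add: mult.commute)
  then have "(\<Sum>i\<in>basis xs. cnj (b [] i) * a [] i) = 0"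
    if "(\<Sum>i\<in>basis xs. cnj (a [] i) * b [] i) = 0" for b :: oper
    using that by (simp only: complex_cnj_zero)
  ultimately show "a \<in> perp xs (perp xs S)"
    unfolding perp_def by blast
qed

text \<open>As in every Galois connection.\<close>

lemma perp_perp_perp: "S \<subseteq> L xs [] \<Longrightarrow> perp xs (perp xs (perp xs S)) = perp xs S"
  by (intro equalityI perp_antimono subset_perp_perp perp_in_L)

lemma perp_zero [simp]: "perp xs {0} = L xs []"
  by (auto simp: perp_def)

lemma self_orthogonal_zero:
  assumes "a \<in> L xs []" "(\<Sum>i\<in>basis xs. cnj (a [] i) * a [] i) = 0"
  shows "a = 0"
proof -
  have "(\<Sum>i\<in>basis xs. (cmod (a [] i))\<^sup>2) = Re (\<Sum>i\<in>basis xs. cnj (a [] i) * a [] i)"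
    by (simp add: cmod_power2 flip: power2_eq_square)
  then have "\<forall>i\<in>basis xs. a [] i = 0"
    using assms(2) by (simp add: sum_nonneg_eq_0_iff)
  then show ?thesis
    using assms(1) by (intro L_eqI[of a xs "[]"]) auto
qed

lemma perp_L [simp]: "perp xs (L xs []) = {0}"
proof (intro equalityI subsetI)
  show "a \<in> {0}" if "a \<in> perp xs (L xs [])" for a
    using that self_orthogonal_zero[of a xs] by (auto simp: perp_def)
qed (auto simp: perp_def)

lemma perp_eq_L_iff:
  assumes "S \<subseteq> L xs []"
  shows "perp xs S = L xs [] \<longleftrightarrow> S \<subseteq> {0}"
proof
  assume "perp xs S = L xs []"
  then show "S \<subseteq> {0}"
    using subset_perp_perp[OF assms] perp_L[of xs] by simp
qed (auto simp: perp_def)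

lemma perp_UN: "perp xs (\<Union>b\<in>B. S b) = L xs [] \<inter> (\<Inter>b\<in>B. perp xs (S b))"
  by (auto simp: perp_def)


section \<open>Semantics in a context with classical variables\<close>

text \<open>The only basis index of a one-dimensional factor is \<open>0\<close>.  A functional on
  \<open>X\<^sub>1 \<otimes> \<dots> \<otimes> X\<^sub>n\<close> is therefore the same as one on \<open>\<complex> \<otimes> \<dots> \<otimes> \<complex> \<otimes> X\<^sub>1 \<otimes> \<dots> \<otimes> X\<^sub>n\<close>.\<close>

definition pad :: "nat \<Rightarrow> oper \<Rightarrow> oper" where
  "pad m f = (\<lambda>j i. if take m i = replicate m 0 then f j (drop m i) else 0)"

lemma pad_0 [simp]: "pad 0 f = f"
  by (simp add: pad_def)

lemma pad_linear:
  "pad m (f + g) = pad m f + pad m g"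
  "pad m (scale_oper c f) = scale_oper c (pad m f)"
  "pad m 0 = 0"
  by (auto simp: pad_def scale_oper_def fun_eq_iff)

lemma pad_Suc: "pad (Suc m) f = cons_oper 0 (pad m f)"
  by (auto simp: pad_def cons_oper_def fun_eq_iff split: list.split)

lemma basis_append_one_dimensional:
  "\<forall>h\<in>set hs. hdim h = 1 \<Longrightarrow>
    i \<in> basis (hs @ xs) \<longleftrightarrow>
    take (length hs) i = replicate (length hs) 0 \<and> drop (length hs) i \<in> basis xs"
proof (induction hs arbitrary: i)
  case (Cons h hs)
  then show ?case
    by (cases i) auto
qed simp

context
  fixes hs xs :: "'l hilb list"
  assumes one: "\<forall>h\<in>set hs. hdim h = 1"
begin

lemma pad_in_L_iff: "pad (length hs) f \<in> L (hs @ xs) [] \<longleftrightarrow> f \<in> L xs []"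
proof
  assume f: "pad (length hs) f \<in> L (hs @ xs) []"
  show "f \<in> L xs []"
    unfolding L_def mem_Collect_eq
  proof (intro allI impI)
    fix j i assume "f j i \<noteq> 0"
    then have "pad (length hs) f j (replicate (length hs) 0 @ i) \<noteq> 0"
      by (simp add: pad_def)
    then have "j = [] \<and> replicate (length hs) 0 @ i \<in> basis (hs @ xs)"
      using f unfolding L_def by fastforce
    then show "j \<in> basis ([] :: 'l hilb list) \<and> i \<in> basis xs"
      by (simp add: basis_append_one_dimensional[OF one])
  qed
qed (auto simp: L_def pad_def basis_append_one_dimensional[OF one])

lemma L_appendE:
  assumes "t \<in> L (hs @ xs) []"
  obtains f where "f \<in> L xs []" "t = pad (length hs) f"
proof
  let ?f = "\<lambda>j i. t j (replicate (length hs) 0 @ i)"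
  have "t j i = pad (length hs) ?f j i" for j i
  proof (cases "take (length hs) i = replicate (length hs) 0")
    case True
    then have "replicate (length hs) 0 @ drop (length hs) i = i"
      by (metis append_take_drop_id)
    then show ?thesis
      by (simp add: pad_def True)
  next
    case False
    then show ?thesis
      using L_zero[OF assms] by (simp add: pad_def basis_append_one_dimensional[OF one])
  qed
  then show t: "t = pad (length hs) ?f"
    by (intro ext)
  show "?f \<in> L xs []"
    using assms unfolding pad_in_L_iff[symmetric] t[symmetric] .
qed

lemma sum_basis_append:
  "(\<Sum>i\<in>basis (hs @ xs). g i) = (\<Sum>i\<in>basis xs. g (replicate (length hs) 0 @ i))"
  using one by (induction hs arbitrary: g) (simp_all add: sum_basis_Cons)

end

text \<open>The component of \<open>\<phi>\<close> at the atoms \<open>\<alpha>\<close>, as a space of functionals on the factors of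
  \<open>qs\<close> only, the variables \<open>cs\<close> being classical.  A quantifier puts its variable in front of the
  context, and in the two sentences the variables of the sorts \<open>\<X>\<close> and \<open>\<X>\<^sup>*\<close> are quantified
  outermost.  So the contexts that matter have the form \<open>cs @ qs\<close>.\<close>

definition sem :: "'l var list \<Rightarrow> 'l var list \<Rightarrow> ('l var \<Rightarrow> 'l hilb) \<Rightarrow> 'l fm \<Rightarrow> oper set" where
  "sem cs qs \<alpha> \<phi> = {f \<in> L (map \<alpha> qs) [].
     pad (length cs) f \<in> spaces (interp (cs @ qs) \<phi>) (map \<alpha> (cs @ qs)) []}"

definition one_dimensional :: "'l qset \<Rightarrow> bool" where
  "one_dimensional Q \<longleftrightarrow> (\<forall>h\<in>Q. hdim h = 1)"

lemma one_dimensional_qset: "one_dimensional Q \<Longrightarrow> quantum_set Q"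
  by (simp add: one_dimensional_def quantum_set_def)

lemma one_dimensional_qdual [simp]: "one_dimensional (qdual Q) \<longleftrightarrow> one_dimensional Q"
  by (auto simp: one_dimensional_def qdual_def)

lemma one_dimensional_classical [simp]: "one_dimensional (classical A)"
  by (auto simp: one_dimensional_def classical_def)

definition valuation :: "'l var list \<Rightarrow> 'l var list \<Rightarrow> ('l var \<Rightarrow> 'l hilb) \<Rightarrow> bool" where
  "valuation cs qs \<alpha> \<longleftrightarrow> distinct (cs @ qs) \<and>
     (\<forall>v\<in>set (cs @ qs). quantum_set (snd v) \<and> \<alpha> v \<in> snd v) \<and>
     (\<forall>v\<in>set cs. one_dimensional (snd v))"

lemma valuation_Cons:
  assumes "valuation cs qs \<alpha>" "y \<notin> set (cs @ qs)" "one_dimensional (snd y)" "b \<in> snd y"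
  shows "valuation (y # cs) qs (\<alpha>(y := b))"
  using assms by (auto simp: valuation_def one_dimensional_qset)

lemma map_fun_upd_notin [simp]: "y \<notin> set vs \<Longrightarrow> map (\<alpha>(y := b)) vs = map \<alpha> vs"
  by auto

lemma sem_in_L: "sem cs qs \<alpha> \<phi> \<subseteq> L (map \<alpha> qs) []"
  by (auto simp: sem_def)

context
  fixes cs qs :: "'l var list" and \<alpha> :: "'l var \<Rightarrow> 'l hilb"
  assumes val: "valuation cs qs \<alpha>"
begin

lemma val_one: "\<forall>h\<in>set (map \<alpha> cs). hdim h = 1"
  using val by (auto simp: valuation_def one_dimensional_def)

lemma val_listset: "map \<alpha> (cs @ qs) \<in> listset (map snd (cs @ qs))"
  using val by (auto simp: valuation_def listset_iff list_all2_map1 list_all2_map2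
      intro!: list_all2_appendI list.rel_refl_strong)

text \<open>Padding with indices \<open>0\<close> preserves inner products.\<close>

lemma sem_Neg:
  assumes "graded_fm \<phi>"
  shows "sem cs qs \<alpha> (Neg \<phi>) = perp (map \<alpha> qs) (sem cs qs \<alpha> \<phi>)"
proof -
  let ?xs = "map \<alpha> (cs @ qs)" and ?m = "length cs"
  let ?I = "interp (cs @ qs) \<phi>"
  have inner: "Tr ?xs (mult ([] :: 'l hilb list) (adj (pad ?m a)) (pad ?m b)) =
      (\<Sum>i\<in>basis (map \<alpha> qs). cnj (a [] i) * b [] i)" for a b
  proof -
    have "Tr ?xs (mult ([] :: 'l hilb list) (adj (pad ?m a)) (pad ?m b)) =
        (\<Sum>i\<in>basis (map \<alpha> cs @ map \<alpha> qs). cnj (pad ?m a [] i) * pad ?m b [] i)"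
      by (simp add: Tr_def mult_def adj_def)
    then show ?thesis
      unfolding sum_basis_append[OF val_one] by (simp add: pad_def)
  qed
  have "spaces (interp (cs @ qs) (Neg \<phi>)) ?xs [] =
      {b \<in> L ?xs []. \<forall>a\<in>spaces ?I ?xs []. Tr ?xs (mult ([] :: 'l hilb list) (adj a) b) = 0}"
    using val_listset by (simp add: compl_brel_def del: map_append)
  moreover have "(\<forall>a\<in>spaces ?I ?xs []. P a) \<longleftrightarrow> (\<forall>a\<in>sem cs qs \<alpha> \<phi>. P (pad ?m a))" for P
  proof -
    have "\<exists>f\<in>sem cs qs \<alpha> \<phi>. a = pad ?m f" if a: "a \<in> spaces ?I ?xs []" for a
    proof -
      have "a \<in> L (map \<alpha> cs @ map \<alpha> qs) []"
        using a assms graded_in_L by (fastforce simp: graded_fm_def)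
      then show ?thesis
        using a by (elim L_appendE[OF val_one]) (auto simp: sem_def)
    qed
    then show ?thesis
      by (auto simp: sem_def)
  qed
  ultimately show ?thesis
    using pad_in_L_iff[OF val_one, of _ "map \<alpha> qs", folded map_append]
    by (auto simp: sem_def[of _ _ _ "Neg \<phi>"] perp_def inner simp del: map_append interp.simps)
qed

lemma sem_And: "sem cs qs \<alpha> (And \<phi> \<psi>) = sem cs qs \<alpha> \<phi> \<inter> sem cs qs \<alpha> \<psi>"
  using val_listset by (auto simp: sem_def meet_brel_def simp del: map_append)

lemma subspace_sem:
  assumes "graded_fm \<phi>"
  shows "oper.subspace (sem cs qs \<alpha> \<phi>)"
proof -
  have "oper.subspace (spaces (interp (cs @ qs) \<phi>) (map \<alpha> (cs @ qs)) [])"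
    using assms graded_subspace by (auto simp: graded_fm_def)
  then show ?thesis
    using subspace_L[of "map \<alpha> qs" "[]"] by (auto simp: oper.subspace_def sem_def pad_linear)
qed

text \<open>The only functionals on \<open>\<complex>\<^sub>b \<otimes> X\<close> are \<open>\<delta>\<^sub>0 \<otimes> t\<close>, which turns the join in the definition of the
  universal quantifier into an intersection over the elements of the classical sort.\<close>

lemma sem_All:
  assumes "graded_fm \<phi>" "y \<notin> set (cs @ qs)" "one_dimensional (snd y)"
  shows "sem cs qs \<alpha> (All y \<phi>) =
    L (map \<alpha> qs) [] \<inter> (\<Inter>b\<in>snd y. sem (y # cs) qs (\<alpha>(y := b)) \<phi>)"
proof -
  have sorts: "\<forall>v\<in>set (y # cs @ qs). quantum_set (snd v)"
    using val assms(3) by (auto simp: valuation_def one_dimensional_qset)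
  have [simp]: "map (\<alpha>(y := b)) cs = map \<alpha> cs" "map (\<alpha>(y := b)) qs = map \<alpha> qs" for b
    using assms(2) by auto
  have "(\<forall>h\<in>snd y. \<forall>k<hdim h. P h k) \<longleftrightarrow> (\<forall>h\<in>snd y. P h 0)" for P
    using assms(3) by (auto simp: one_dimensional_def)
  then show ?thesis
    using interp_All[OF assms(1) sorts val_listset] pad_in_L_iff[OF val_one, of _ "map \<alpha> qs"]
    by (auto simp: sem_def pad_Suc simp del: interp.simps)
qed

lemma sem_Atm:
  assumes R: "graded R" "src R = map snd us" "tgt R = []"
    and us: "distinct us" "set us \<subseteq> set (cs @ qs)"
  shows "f \<in> sem cs qs \<alpha> (Atm R us) \<longleftrightarrow> f \<in> L (map \<alpha> qs) [] \<and>
    (\<forall>\<iota>. (\<forall>v\<in>set qs. \<iota> v < hdim (\<alpha> v)) \<longrightarrow>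
      (\<lambda>j k. if k \<in> basis (map \<alpha> us) then f j (map (assign us k \<iota>) qs) else 0)
        \<in> spaces R (map \<alpha> us) [])"
proof -
  let ?us = "map \<alpha> us"
  let ?slice = "\<lambda>f vs \<iota> j k. if k \<in> basis (?us) then f j (map (assign us k \<iota>) vs) else 0 :: complex"
  have dist: "distinct (cs @ qs)" and \<alpha>: "\<forall>v\<in>set (cs @ qs). \<alpha> v \<in> snd v"
    and one: "\<forall>c\<in>set cs. hdim (\<alpha> c) = 1"
    using val by (auto simp: valuation_def one_dimensional_def)
  have slice: "?slice (pad (length cs) f) (cs @ qs) \<iota> = ?slice f qs \<iota>"
    if \<iota>: "\<forall>c\<in>set cs. \<iota> c = 0" for \<iota>
  proof -
    have "map (assign us k \<iota>) cs = replicate (length cs) 0" if k: "k \<in> basis (?us)" for k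
    proof -
      have "map (assign us k \<iota>) us \<in> basis (?us)"
        using k us length_basis[OF k] by (simp add: map_assign)
      then have "\<forall>u\<in>set us. assign us k \<iota> u < hdim (\<alpha> u)"
        unfolding map_in_basis_iff .
      then have "assign us k \<iota> c = 0" if "c \<in> set cs" for c
        using that \<iota> one by (cases "c \<in> set us") (auto simp: assign_def)
      then show ?thesis
        by (simp add: map_replicate_const[symmetric] cong: map_cong)
    qed
    then show ?thesis
      by (auto simp: pad_def fun_eq_iff)
  qed
  have "(\<forall>\<iota>. (\<forall>v\<in>set (cs @ qs). \<iota> v < hdim (\<alpha> v)) \<longrightarrow>
        ?slice (pad (length cs) f) (cs @ qs) \<iota> \<in> spaces R (?us) []) \<longleftrightarrow>
      (\<forall>\<iota>. (\<forall>v\<in>set qs. \<iota> v < hdim (\<alpha> v)) \<longrightarrow> ?slice f qs \<iota> \<in> spaces R (?us) [])"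
    (is "?l \<longleftrightarrow> ?r")
  proof
    assume l: ?l
    show ?r
    proof (intro allI impI)
      fix \<iota> :: "'l var \<Rightarrow> nat" assume \<iota>: "\<forall>v\<in>set qs. \<iota> v < hdim (\<alpha> v)"
      \<comment> \<open>\<open>0\<close> is the only index of a classical variable\<close>
      define \<iota>' where "\<iota>' v = (if v \<in> set qs then \<iota> v else 0)" for v
      have "?slice f qs \<iota>' \<in> spaces R (?us) []"
      proof -
        have "\<forall>v\<in>set (cs @ qs). \<iota>' v < hdim (\<alpha> v)" and zero: "\<forall>c\<in>set cs. \<iota>' c = 0"
          using \<iota> dist one by (auto simp: \<iota>'_def)
        from l[THEN spec, THEN mp, OF this(1)] show ?thesis
          unfolding slice[OF zero] .
      qed
      moreover have "map (assign us k \<iota>') qs = map (assign us k \<iota>) qs" for k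
        by (simp add: assign_def \<iota>'_def)
      ultimately show "?slice f qs \<iota> \<in> spaces R (?us) []"
        by (simp only:)
    qed
  next
    assume r: ?r
    show ?l
    proof (intro allI impI)
      fix \<iota> assume \<iota>: "\<forall>v\<in>set (cs @ qs). \<iota> v < hdim (\<alpha> v)"
      have "\<iota> c = 0" if "c \<in> set cs" for c
      proof -
        have "\<iota> c < hdim (\<alpha> c)"
          using that \<iota> by simp
        moreover have "hdim (\<alpha> c) = 1"
          using that one by blast
        ultimately show ?thesis
          by simp
      qed
      then show "?slice (pad (length cs) f) (cs @ qs) \<iota> \<in> spaces R (?us) []"
        using r \<iota> by (subst slice) auto
    qed
  qed
  then show ?thesis
    unfolding sem_def mem_Collect_eq interp_Atm[OF R dist us \<alpha>]
    using pad_in_L_iff[OF val_one, of _ "map \<alpha> qs"] by auto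
qed

lemma sem_Imp:
  assumes "graded_fm \<phi>" "graded_fm \<psi>"
  shows "sem cs qs \<alpha> (Imp \<phi> \<psi>) = perp (map \<alpha> qs)
    (perp (map \<alpha> qs) (perp (map \<alpha> qs) (sem cs qs \<alpha> \<phi>)) \<inter>
     perp (map \<alpha> qs) (sem cs qs \<alpha> \<phi> \<inter> sem cs qs \<alpha> \<psi>))"
  using assms by (simp add: Imp_def Or_def sem_Neg sem_And)

text \<open>The functionals on a tensor product of one-dimensional atoms form a line, so an equation between
  classical variables can only have a truth value, \<open>\<top>\<close> or \<open>\<bottom>\<close>.\<close>

lemma sem_eq_classical:
  assumes "y \<in> set cs" "y' \<in> set cs" "y \<noteq> y'" "snd y' = qdual (snd y)"
  shows "sem cs qs \<alpha> (Atm (eq_brel (snd y)) [y, y']) =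
    (if \<alpha> y' = dual (\<alpha> y) then L (map \<alpha> qs) [] else {0})"
proof -
  let ?L = "L (map \<alpha> qs) []" and ?valid = "\<lambda>\<iota>. \<forall>v\<in>set qs. \<iota> v < hdim (\<alpha> v)"
  let ?R = "spaces (eq_brel (snd y)) [\<alpha> y, \<alpha> y'] []"
  let ?slice = "\<lambda>f \<iota> j k. if k \<in> basis [\<alpha> y, \<alpha> y'] then f j (map (assign [y, y'] k \<iota>) qs) else 0 :: complex"
  have dims: "hdim (\<alpha> y) = 1" "hdim (\<alpha> y') = 1" and atoms: "\<alpha> y \<in> snd y" "\<alpha> y' \<in> snd y'"
    and notin: "y \<notin> set qs" "y' \<notin> set qs"
    using val assms by (auto simp: valuation_def one_dimensional_def)
  have R: "?R = (if \<alpha> y' = dual (\<alpha> y) then oper.span {eval_oper (\<alpha> y)} else {0})"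
    using atoms assms by (simp add: eq_brel_def)
  have basis: "k \<in> basis [\<alpha> y, \<alpha> y'] \<longleftrightarrow> k = [0, 0]" for k
    using dims by (auto simp: basis_Cons)
  have slice: "?slice f \<iota> = scale_oper (f [] (map \<iota> qs)) (eval_oper (\<alpha> y))"
    if f: "f \<in> ?L" for f \<iota>
    using L_zero[OF f] notin dims
    by (auto simp: basis eval_oper_def scale_oper_def fun_eq_iff map_assign_disjoint)
  have "graded (eq_brel (snd y))" "src (eq_brel (snd y)) = map snd [y, y']" "tgt (eq_brel (snd y)) = []"
    using assms by (simp_all add: graded_eq) (simp_all add: eq_brel_def)
  from sem_Atm[OF this] assms
  have Atm: "f \<in> sem cs qs \<alpha> (Atm (eq_brel (snd y)) [y, y']) \<longleftrightarrow> f \<in> ?L \<and>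
      (\<forall>\<iota>. ?valid \<iota> \<longrightarrow> ?slice f \<iota> \<in> ?R)" for f
    by simp
  have mem: "f \<in> sem cs qs \<alpha> (Atm (eq_brel (snd y)) [y, y']) \<longleftrightarrow> f \<in> ?L \<and>
      (\<alpha> y' = dual (\<alpha> y) \<or> f = 0)" for f
  proof (cases "\<alpha> y' = dual (\<alpha> y)")
    case True
    then show ?thesis
      unfolding Atm using slice[of f] R by (auto simp: oper.span_base oper.span_scale)
  next
    case False
    have zero: "f = 0" if f: "f \<in> ?L"
      and zero: "\<forall>\<iota>. ?valid \<iota> \<longrightarrow> ?slice f \<iota> = 0"
    proof (rule L_eqI[OF f zero_in_L])
      fix j i assume "j \<in> basis ([] :: 'l hilb list)" and i: "i \<in> basis (map \<alpha> qs)"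
      moreover obtain \<iota> where \<iota>: "i = map \<iota> qs"
        using val i by (auto simp: valuation_def elim: basis_mapE[rotated])
      moreover from i have "\<forall>v\<in>set qs. \<iota> v < hdim (\<alpha> v)"
        unfolding \<iota> map_in_basis_iff .
      from zero[THEN spec, THEN mp, OF this]
      have "scale_oper (f [] (map \<iota> qs)) (eval_oper (\<alpha> y)) = 0"
        unfolding slice[OF f] .
      then have "scale_oper (f [] (map \<iota> qs)) (eval_oper (\<alpha> y)) [] [0, 0] = 0"
        by (simp only: zero_fun_def)
      ultimately show "f j i = 0 j i"
        using dims by (simp add: scale_oper_apply eval_oper_def)
    qed
    show ?thesis
      unfolding Atm R if_not_P[OF False] singleton_iff
    proof (rule iffI)
      assume f: "f \<in> ?L \<and>
        (\<forall>\<iota>. ?valid \<iota> \<longrightarrow> ?slice f \<iota> = 0)"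
      from zero[OF f[THEN conjunct1] f[THEN conjunct2]] f[THEN conjunct1]
      show "f \<in> ?L \<and> (\<alpha> y' = dual (\<alpha> y) \<or> f = 0)"
        by simp
    next
      assume "f \<in> ?L \<and> (\<alpha> y' = dual (\<alpha> y) \<or> f = 0)"
      with False have "f = 0"
        by simp
      then show "f \<in> ?L \<and>
          (\<forall>\<iota>. ?valid \<iota> \<longrightarrow> ?slice f \<iota> = 0)"
        by (auto simp: fun_eq_iff L_def)
    qed
  qed
  show ?thesis
    by (rule set_eqI, unfold mem) (simp, blast intro: zero_in_L)
qed

end


section \<open>Quantifiers over equal pairs, and terms\<close>

lemma graded_fm_derived [simp, intro]:
  "graded_fm (Imp \<phi> \<psi>)" "graded_fm (AllEq y y' \<phi>)" "graded_fm (ExEq y y' \<phi>)"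
  by (simp_all add: Imp_def Or_def AllEq_def ExEq_def)

text \<open>The Sasaki arrow \<open>E \<rightarrow> \<psi>\<close> is \<open>\<psi>\<close> (up to closure) for \<open>E = \<top>\<close> and \<open>\<top>\<close> for \<open>E = \<bottom>\<close>.\<close>

lemma sem_Imp_eq_classical:
  assumes val: "valuation cs qs \<alpha>" and \<psi>: "graded_fm \<psi>"
    and y: "y \<in> set cs" "y' \<in> set cs" "y \<noteq> y'" "snd y' = qdual (snd y)"
  shows "sem cs qs \<alpha> (Imp (Atm (eq_brel (snd y)) [y, y']) \<psi>) =
    (if \<alpha> y' = dual (\<alpha> y) then perp (map \<alpha> qs) (perp (map \<alpha> qs) (sem cs qs \<alpha> \<psi>))
     else L (map \<alpha> qs) [])"
proof -
  have "sem cs qs \<alpha> \<psi> \<subseteq> L (map \<alpha> qs) []"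
    by (rule sem_in_L)
  moreover have "0 \<in> sem cs qs \<alpha> \<psi>"
    using subspace_sem[OF val \<psi>] oper.subspace_0 by blast
  ultimately show ?thesis
    by (auto simp: sem_Imp[OF val _ \<psi>] graded_eq sem_eq_classical[OF val y]
        Int_absorb1 perp_in_L[THEN Int_absorb1])
qed

text \<open>At atoms that are not dual to each other the equality relation is \<open>\<bottom>\<close> and the implication \<open>\<top>\<close>,
  so only the diagonal contributes to the intersection.\<close>

lemma sem_AllEq:
  assumes val: "valuation cs qs \<alpha>" and \<psi>: "graded_fm \<psi>"
    and y: "y \<notin> set (cs @ qs)" "y' \<notin> set (cs @ qs)" "y \<noteq> y'"
      "snd y' = qdual (snd y)" "one_dimensional (snd y)"
  shows "sem cs qs \<alpha> (AllEq y y' \<psi>) = L (map \<alpha> qs) [] \<inter> (\<Inter>b\<in>snd y.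
    perp (map \<alpha> qs) (perp (map \<alpha> qs) (sem (y # y' # cs) qs (\<alpha>(y' := dual b, y := b)) \<psi>)))"
proof -
  let ?E = "Atm (eq_brel (snd y)) [y, y']"
  let ?L = "L (map \<alpha> qs) []" and ?perp = "perp (map \<alpha> qs)"
  have [simp]: "map (\<alpha>(y' := b')) qs = map \<alpha> qs" "map (\<alpha>(y' := b', y := b)) qs = map \<alpha> qs" for b b'
    using y by auto
  have val': "valuation (y' # cs) qs (\<alpha>(y' := b'))" if "b' \<in> qdual (snd y)" for b'
    using val that y by (intro valuation_Cons) auto
  have val'': "valuation (y # y' # cs) qs (\<alpha>(y' := b', y := b))"
    if "b \<in> snd y" "b' \<in> qdual (snd y)" for b b'
    using that y by (intro valuation_Cons val') auto
  have "sem cs qs \<alpha> (AllEq y y' \<psi>) =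
      ?L \<inter> (\<Inter>b'\<in>qdual (snd y). sem (y' # cs) qs (\<alpha>(y' := b')) (All y (Imp ?E \<psi>)))"
    using y by (simp add: AllEq_def sem_All[OF val])
  also have "\<dots> = ?L \<inter> (\<Inter>b'\<in>qdual (snd y). ?L \<inter>
      (\<Inter>b\<in>snd y. sem (y # y' # cs) qs (\<alpha>(y' := b', y := b)) (Imp ?E \<psi>)))"
    using y by (simp add: sem_All[OF val'])
  also have "\<dots> = ?L \<inter> (\<Inter>b'\<in>qdual (snd y). ?L \<inter> (\<Inter>b\<in>snd y. if b' = dual b
      then ?perp (?perp (sem (y # y' # cs) qs (\<alpha>(y' := b', y := b)) \<psi>)) else ?L))"
    using y by (simp add: sem_Imp_eq_classical[OF val'' \<psi>])
  also have "\<dots> = ?L \<inter> (\<Inter>b\<in>snd y.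
      ?perp (?perp (sem (y # y' # cs) qs (\<alpha>(y' := dual b, y := b)) \<psi>)))"
    by (rule set_eqI, unfold Int_iff INT_iff) (auto split: if_splits)
  finally show ?thesis .
qed

lemma sem_ExEq:
  assumes val: "valuation cs qs \<alpha>" and \<phi>: "graded_fm \<phi>"
    and y: "y \<notin> set (cs @ qs)" "y' \<notin> set (cs @ qs)" "y \<noteq> y'"
      "snd y' = qdual (snd y)" "one_dimensional (snd y)"
  shows "sem cs qs \<alpha> (ExEq y y' \<phi>) = perp (map \<alpha> qs) (perp (map \<alpha> qs)
    (\<Union>b\<in>snd y. sem (y # y' # cs) qs (\<alpha>(y' := dual b, y := b)) \<phi>))"
proof -
  let ?perp = "perp (map \<alpha> qs)"
  let ?sem = "\<lambda>b. sem (y # y' # cs) qs (\<alpha>(y' := dual b, y := b))"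
  have map: "map (\<alpha>(y' := b', y := b)) qs = map \<alpha> qs" for b b'
    using y by auto
  have "valuation (y # y' # cs) qs (\<alpha>(y' := dual b, y := b))" if "b \<in> snd y" for b
    using val that y by (intro valuation_Cons) auto
  then have "?perp (?perp
        (?sem b (Neg \<phi>))) =
      ?perp (?sem b \<phi>)" if "b \<in> snd y" for b
    using that sem_in_L[of "y # y' # cs" qs "\<alpha>(y' := dual b, y := b)" \<phi>]
    by (simp only: sem_Neg \<phi> map perp_perp_perp)
  then show ?thesis
    by (simp add: ExEq_def sem_Neg[OF val] sem_AllEq[OF val _ y] perp_UN)
qed

lemma perp_sem_ExEq:
  assumes "valuation cs qs \<alpha>" "graded_fm \<phi>"
    "y \<notin> set (cs @ qs)" "y' \<notin> set (cs @ qs)" "y \<noteq> y'"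
    "snd y' = qdual (snd y)" "one_dimensional (snd y)"
  shows "perp (map \<alpha> qs) (sem cs qs \<alpha> (ExEq y y' \<phi>)) = L (map \<alpha> qs) [] \<inter>
    (\<Inter>b\<in>snd y. perp (map \<alpha> qs) (sem (y # y' # cs) qs (\<alpha>(y' := dual b, y := b)) \<phi>))"
proof -
  have "sem (y # y' # cs) qs (\<alpha>(y' := dual b, y := b)) \<phi> \<subseteq> L (map \<alpha> qs) []" for b
    using sem_in_L[of "y # y' # cs" qs "\<alpha>(y' := dual b, y := b)" \<phi>] assms by simp
  then show ?thesis
    unfolding sem_ExEq[OF assms] by (subst perp_perp_perp) (auto simp: perp_UN)
qed

lemma eval_oper_dual [simp]: "eval_oper (dual h) = eval_oper h"
  by (simp add: eval_oper_def)

lemma src_eq [simp]: "src (eq_brel Q) = [Q, qdual Q]" "tgt (eq_brel Q) = []"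
  by (simp_all add: eq_brel_def)

lemma spaces_eq:
  "h \<in> Q \<Longrightarrow> h' \<in> qdual Q \<Longrightarrow> spaces (eq_brel Q) [h, h'] [] =
    (if h' = dual h then oper.span {eval_oper h} else {0})"
  by (simp add: eq_brel_def)

text \<open>The evaluation functional has a real matrix, so conjugation leaves it alone.\<close>

lemma conj_eq_brel: "conj_brel (eq_brel Q) = eq_brel (qdual Q)"
proof (rule brel_eqI)
  fix xs ys
  assume "xs \<in> listset (src (eq_brel (qdual Q)))" "ys \<in> listset (tgt (eq_brel (qdual Q)))"
  then obtain h h' where xs: "xs = [h, h']" "h \<in> qdual Q" "h' \<in> Q" and ys: "ys = []"
    by auto
  have "conj_oper (scale_oper c (eval_oper h)) = scale_oper (cnj c) (eval_oper h)" for c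
    by (auto simp: conj_oper_apply scale_oper_def eval_oper_def fun_eq_iff)
  then have "conj_oper ` oper.span {eval_oper h} = range (\<lambda>c. scale_oper (cnj c) (eval_oper h))"
    by (auto simp: oper.span_singleton image_image)
  also have "\<dots> = oper.span {eval_oper h}"
    using surj_cnj by (simp add: oper.span_singleton flip: image_image[of "\<lambda>c. scale_oper c _" cnj])
  finally have "conj_oper ` oper.span {eval_oper h} = oper.span {eval_oper h}" .
  moreover have "conj_oper 0 = 0"
    by (simp add: conj_oper_apply fun_eq_iff)
  moreover have "dual h' = dual (dual h) \<longleftrightarrow> h' = dual h"
    by (metis dual_dual)
  ultimately show "spaces (conj_brel (eq_brel Q)) xs ys = spaces (eq_brel (qdual Q)) xs ys"
    using xs ys by (auto simp: conj_brel_def spaces_eq in_qdual_iff)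
qed (simp_all add: graded_conj graded_eq, simp_all add: conj_brel_def)

text \<open>Composition with the equality relation on one-dimensional atoms only bends the target
  factor round to the source.\<close>

lemma spaces_hat:
  assumes F: "graded F" "tgt F = [Y]" and Y: "one_dimensional Y" "y \<in> Y"
    and xs: "xs \<in> listset (src F)"
  shows "w \<in> spaces (hat_brel F) (xs @ [dual y]) [] \<longleftrightarrow> w \<in> L (xs @ [dual y]) [] \<and>
    (\<lambda>j i. if j = [0] then w [] (i @ [0]) else 0) \<in> spaces F xs [y]"
proof -
  define bend :: "oper \<Rightarrow> oper" where "bend w = (\<lambda>j i. if j = [0] then w [] (i @ [0]) else 0)" for w
  let ?P = "prod_brel F (id_brel [qdual Y])"
  let ?xs = "xs @ [dual y]" and ?n = "length xs"
  let ?G = "{w \<in> L ?xs []. bend w \<in> spaces F xs [y]}"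
  let ?gen = "{mult ys s r | ys s r. ys \<in> listset (tgt ?P) \<and>
    s \<in> spaces (eq_brel Y) ys [] \<and> r \<in> spaces ?P ?xs ys}"
  have n: "length (src F) = ?n"
    using xs by (simp add: listset_iff list_all2_lengthD)
  have dim: "hdim b = 1" if "b \<in> Y" for b
    using that Y by (simp add: one_dimensional_def)
  have listset: "?xs \<in> listset (src F @ [qdual Y])"
    using xs Y by (simp add: listset_iff list_all2_appendI)
  have tgt: "tgt ?P = [Y, qdual Y]" "src ?P = src F @ [qdual Y]"
    using F by (simp_all add: prod_brel_def id_brel_def Let_def)
  have hat: "spaces (hat_brel F) ?xs [] = oper.span ?gen"
    using F listset by (simp add: hat_brel_def comp_brel_def Let_def tgt)
  have P: "spaces ?P ?xs [b, dual b'] = oper.span {tensor 1 ?n f i |f i.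
      f \<in> spaces F xs [b] \<and> i \<in> spaces (id_brel [qdual Y]) [dual y] [dual b']}"
    if "b \<in> Y" "b' \<in> Y" for b b'
    using F listset that by (simp add: prod_brel_def id_brel_def Let_def n)
  have basis1: "basis [b] = {[0]}" if "b \<in> Y" for b
    using dim[OF that] by (auto simp: basis_Cons)
  have basis: "basis [b, dual b] = {[0, 0]}" if "b \<in> Y" for b
    using dim[OF that] by (auto simp: basis_Cons)
  have bend_linear: "bend (a + b) = bend a + bend b" "bend (scale_oper c a) = scale_oper c (bend a)"
    "bend 0 = 0" for a b c
    by (auto simp: bend_def scale_oper_def fun_eq_iff)
  have G: "oper.subspace ?G"
    using subspace_L[of ?xs "[]"] graded_subspace[OF F(1), of xs "[y]"]
    by (auto simp: oper.subspace_def bend_linear)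
  have bend_tensor: "bend (mult [b, dual b] (eval_oper b) (tensor 1 ?n f i)) = scale_oper (i [0] [0]) f"
    if f: "f \<in> spaces F xs [b]" and b: "b \<in> Y" and i: "i \<in> L [dual y] [dual b]" for f i b
  proof (intro ext)
    fix j k
    have fL: "f \<in> L xs [b]"
      using f F graded_in_L by blast
    have "mult [b, dual b] (eval_oper b) (tensor 1 ?n f i) [] (k @ [0]) =
        f [0] (take ?n (k @ [0])) * i [0] (drop ?n (k @ [0]))"
      using basis[OF b] dim[OF b] by (simp add: mult_def tensor_def eval_oper_def)
    also have "\<dots> = i [0] [0] * f [0] k"
    proof (cases "length k = ?n")
      case False
      have "f [0] k = 0"
        using False L_zero[OF fL] length_basis by blast
      moreover have "i [0] (drop ?n (k @ [0])) = 0"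
        using False L_zero[OF i, of "[0]" "drop ?n (k @ [0])"] length_basis[of "drop ?n (k @ [0])" "[dual y]"]
        by fastforce
      ultimately show ?thesis
        by simp
    qed simp
    finally show "bend (mult [b, dual b] (eval_oper b) (tensor 1 ?n f i)) j k =
        scale_oper (i [0] [0]) f j k"
      using L_zero[OF fL, of j k] basis1[OF b] by (auto simp: bend_def scale_oper_apply)
  qed
  have "?gen \<subseteq> ?G"
  proof clarify
    fix ys s r
    assume ys: "ys \<in> listset (tgt ?P)" and s: "s \<in> spaces (eq_brel Y) ys []"
      and r: "r \<in> spaces ?P ?xs ys"
    then obtain b b' where b: "ys = [b, dual b']" "b \<in> Y" "b' \<in> Y"
      unfolding tgt by (auto simp: in_qdual_iff) (metis dual_dual)
    show "mult ys s r \<in> L ?xs [] \<and> bend (mult ys s r) \<in> spaces F xs [y]"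
    proof (cases "b' = b")
      case False
      then have "s = 0"
        using s b spaces_eq[of b Y "dual b'"] by (metis dual_dual dual_in_qdual singletonD)
      then have "mult ys s r = 0"
        by (simp add: mult_def fun_eq_iff)
      then show ?thesis
        using oper.subspace_0[OF G] by simp
    next
      case True
      then obtain c where c: "s = scale_oper c (eval_oper b)"
        using s b spaces_eq[of b Y "dual b'"] by (auto simp: oper.span_singleton)
      let ?tens = "{tensor 1 ?n f i |f i.
          f \<in> spaces F xs [b] \<and> i \<in> spaces (id_brel [qdual Y]) [dual y] [dual b]}"
      have "r \<in> {r. mult [b, dual b] (eval_oper b) r \<in> ?G}"
      proof (rule subsetD[OF oper.span_minimal])
        show "r \<in> oper.span ?tens"
          using r P b True by simp
        show "?tens \<subseteq>
            {r. mult [b, dual b] (eval_oper b) r \<in> ?G}"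
        proof clarify
          fix f i
          assume f: "f \<in> spaces F xs [b]" and i: "i \<in> spaces (id_brel [qdual Y]) [dual y] [dual b]"
          have iL: "i \<in> L [dual y] [dual b]"
            using i graded_in_L[OF graded_id] by blast
          have "f \<in> L xs [b]"
            using f F graded_in_L by blast
          then have "tensor 1 ?n f i \<in> L ?xs [b, dual b]"
            using iL by (intro tensor_in_L) simp_all
          moreover have "eval_oper b \<in> L [b, dual b] []"
            by (simp add: eval_oper_in_L)
          ultimately have "mult [b, dual b] (eval_oper b) (tensor 1 ?n f i) \<in> L ?xs []"
            by (rule mult_in_L[rotated])
          moreover have "scale_oper (i [0] [0]) f \<in> spaces F xs [y]"
          proof (cases "b = y")
            case True
            then show ?thesis
              using f oper.subspace_scale[OF graded_subspace[OF F(1)]] by simp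
          next
            case False
            then have "dual y \<noteq> dual b"
              by (metis dual_dual)
            then have "i = 0"
              using i Y b by (auto simp: id_brel_def)
            then show ?thesis
              using oper.subspace_0[OF graded_subspace[OF F(1)]] by simp
          qed
          ultimately show "mult [b, dual b] (eval_oper b) (tensor 1 ?n f i) \<in> L ?xs [] \<and>
              bend (mult [b, dual b] (eval_oper b) (tensor 1 ?n f i)) \<in> spaces F xs [y]"
            using bend_tensor[OF f b(2) iL] by simp
        qed
        have "mult [b, dual b] e (p + q) = mult [b, dual b] e p + mult [b, dual b] e q"
          "mult [b, dual b] e (scale_oper d p) = scale_oper d (mult [b, dual b] e p)"
          "mult [b, dual b] e 0 = 0" for e p q d
          by (simp_all add: mult_def scale_oper_def fun_eq_iff distrib_left sum.distrib
              sum_distrib_left mult.left_commute)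
        then show "oper.subspace {r. mult [b, dual b] (eval_oper b) r \<in> ?G}"
          using G by (simp add: oper.subspace_def)
      qed
      moreover have "mult [b, dual b] s r = scale_oper c (mult [b, dual b] (eval_oper b) r)"
        by (simp add: c mult_def scale_oper_def fun_eq_iff sum_distrib_left mult.assoc)
      ultimately show ?thesis
        using oper.subspace_scale[OF G] b True by simp
    qed
  qed
  then have "oper.span ?gen \<subseteq> ?G"
    by (rule oper.span_minimal[OF _ G])
  moreover have "w \<in> oper.span ?gen" if w: "w \<in> ?G"
  proof -
    have wL: "w \<in> L ?xs []" and bw: "bend w \<in> spaces F xs [y]"
      using w by auto
    let ?i = "id_oper [dual y]"
    have i: "?i \<in> spaces (id_brel [qdual Y]) [dual y] [dual y]"
      using Y by (simp add: id_brel_def oper.span_base)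
    have "tensor 1 ?n (bend w) ?i \<in> spaces ?P ?xs [y, dual y]"
      unfolding P[OF Y(2) Y(2)] using bw i by (intro oper.span_base) blast
    moreover have "eval_oper y \<in> spaces (eq_brel Y) [y, dual y] []"
      using Y by (simp add: spaces_eq oper.span_base)
    ultimately have "mult [y, dual y] (eval_oper y) (tensor 1 ?n (bend w) ?i) \<in> ?gen"
      using Y tgt by fastforce
    moreover have "mult [y, dual y] (eval_oper y) (tensor 1 ?n (bend w) ?i) = w"
    proof (intro ext)
      fix j k
      have "mult [y, dual y] (eval_oper y) (tensor 1 ?n (bend w) ?i) j k =
          (if j = [] then w [] (take ?n k @ [0]) * ?i [0] (drop ?n k) else 0)"
        using basis[OF Y(2)] dim[OF Y(2)] by (simp add: mult_def tensor_def eval_oper_def bend_def)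
      also have "\<dots> = w j k"
      proof (cases "j = [] \<and> k \<in> basis ?xs")
        case True
        then obtain k' where "k = k' @ [0]" "k' \<in> basis xs"
          using dim[OF Y(2)] by (auto elim!: basis_appendE simp: basis_Cons)
        then show ?thesis
          using True dim[OF Y(2)] by (simp add: length_basis id_oper_def)
      next
        case False
        have "w [] (take ?n k @ [0]) * ?i [0] (drop ?n k) = 0" if "k \<notin> basis ?xs"
        proof (cases "drop ?n k = [0]")
          case True
          then have "take ?n k @ [0] = k"
            by (metis append_take_drop_id)
          then show ?thesis
            using L_zero[OF wL, of "[]" k] that by simp
        qed (simp add: id_oper_def)
        then show ?thesis
          using False L_zero[OF wL, of j k] by auto
      qed
      finally show "mult [y, dual y] (eval_oper y) (tensor 1 ?n (bend w) ?i) j k = w j k" .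
    qed
    ultimately show ?thesis
      by (simp add: oper.span_base)
  qed
  ultimately show ?thesis
    unfolding hat by (auto simp: bend_def)
qed


text \<open>The equation \<open>F(x, a) = b\<close> with a fixed atom \<open>b\<close> on the right, as a space of functionals on all
  factors of \<open>qs\<close>: the variables other than \<open>x\<close> are unconstrained.\<close>

definition slices :: "'l brel \<Rightarrow> 'l var list \<Rightarrow> ('l var \<Rightarrow> 'l hilb) \<Rightarrow> 'l var \<Rightarrow> 'l var \<Rightarrow> 'l hilb \<Rightarrow> oper set" where
  "slices F qs \<alpha> x a b = {f \<in> L (map \<alpha> qs) []. \<forall>\<iota>. (\<forall>v\<in>set qs. \<iota> v < hdim (\<alpha> v)) \<longrightarrow>
     (\<lambda>j i. if j = [0] \<and> i \<in> basis [\<alpha> x, \<alpha> a] then f [] (map (\<iota>(x := hd i)) qs) else 0)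
       \<in> spaces F [\<alpha> x, \<alpha> a] [b]}"

lemma slices_fun_upd [simp]:
  assumes "v \<notin> set qs" "x \<noteq> v" "a \<noteq> v"
  shows "slices F qs (\<alpha>(v := h)) x a b = slices F qs \<alpha> x a b"
proof -
  have "(\<forall>u\<in>set qs. \<iota> u < hdim ((\<alpha>(v := h)) u)) \<longleftrightarrow> (\<forall>u\<in>set qs. \<iota> u < hdim (\<alpha> u))" for \<iota> :: "'a var \<Rightarrow> nat"
    using assms by auto
  then show ?thesis
    unfolding slices_def map_fun_upd_notin[OF assms(1)] using assms(2,3) by simp
qed

lemma slices_in_L: "slices F qs \<alpha> x a b \<subseteq> L (map \<alpha> qs) []"
  by (auto simp: slices_def)

text \<open>The atom of \<open>y'\<close> is the dual of a value of \<open>F\<close>; bending it back turns a slice of \<open>f\<close> into an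
  operator that \<open>F\<close> has to contain.\<close>

lemma sem_hat:
  assumes val: "valuation cs qs \<alpha>"
    and F: "graded F" "src F = [snd x, snd a]" "tgt F = [Y]" "one_dimensional Y"
    and vars: "x \<in> set qs" "a \<in> set cs" "y' \<in> set cs" "a \<noteq> y'" "snd y' = qdual Y"
  shows "sem cs qs \<alpha> (Atm (hat_brel F) [x, a, y']) = slices F qs \<alpha> x a (dual (\<alpha> y'))"
proof -
  let ?xa = "[\<alpha> x, \<alpha> a]" and ?xay = "[\<alpha> x, \<alpha> a, \<alpha> y']" and ?vs = "[x, a, y']"
  let ?slice = "\<lambda>f \<iota> j k. if k \<in> basis ?xay then f j (map (assign ?vs k \<iota>) qs) else 0 :: complex"
  have notin: "a \<notin> set qs" "y' \<notin> set qs" "x \<noteq> a" "x \<noteq> y'"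
    using val vars by (auto simp: valuation_def)
  have atoms: "\<alpha> x \<in> snd x" "\<alpha> a \<in> snd a" "dual (\<alpha> y') \<in> Y" and dim: "hdim (\<alpha> y') = 1"
    using val vars F(4) by (auto simp: valuation_def one_dimensional_def in_qdual_iff)
  have hat: "graded (hat_brel F)" "src (hat_brel F) = map snd ?vs" "tgt (hat_brel F) = []"
    using F vars by (simp_all add: graded_hat) (simp_all add: hat_brel_def comp_brel_def prod_brel_def id_brel_def Let_def)
  have slice: "?slice f \<iota> \<in> spaces (hat_brel F) ?xay [] \<longleftrightarrow>
      (\<lambda>j i. if j = [0] \<and> i \<in> basis ?xa then f [] (map (\<iota>(x := hd i)) qs) else 0)
        \<in> spaces F ?xa [dual (\<alpha> y')]"
    if f: "f \<in> L (map \<alpha> qs) []" for f \<iota>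
  proof -
    have inL: "?slice f \<iota> \<in> L ?xay []"
      using L_zero[OF f] by (auto simp: L_def)
    have bend: "(\<lambda>(j :: nat list) i. if j = [0] then ?slice f \<iota> [] (i @ [0]) else 0) =
        (\<lambda>j i. if j = [0] \<and> i \<in> basis ?xa then f [] (map (\<iota>(x := hd i)) qs) else 0)"
    proof (intro ext)
      fix j i :: "nat list"
      have "i @ [0] \<in> basis ?xay \<longleftrightarrow> i \<in> basis ?xa"
        using append_in_basis[of i "?xa" "[0]" "[\<alpha> y']"] dim
          length_basis[of i "?xa"] length_basis[of "i @ [0]" "?xay"] by auto
      moreover have "map (assign ?vs (i @ [0]) \<iota>) qs = map (\<iota>(x := hd i)) qs"
        if "i \<in> basis ?xa"
        using that notin by (auto simp: assign_def basis_Cons)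
      ultimately show "(if j = [0] then ?slice f \<iota> [] (i @ [0]) else 0) =
          (if j = [0] \<and> i \<in> basis ?xa then f [] (map (\<iota>(x := hd i)) qs) else 0)"
        by (cases "i \<in> basis ?xa")
          (simp_all only: list.map simp_thms if_True if_False if_cancel)
    qed
    have "?xa \<in> listset (src F)"
      using atoms F(2) by simp
    from spaces_hat[OF F(1,3,4) atoms(3) this, of "?slice f \<iota>", unfolded bend] show ?thesis
      using inL by (simp only: append.simps dual_dual simp_thms)
  qed
  have "f \<in> sem cs qs \<alpha> (Atm (hat_brel F) ?vs) \<longleftrightarrow> f \<in> L (map \<alpha> qs) [] \<and>
      (\<forall>\<iota>. (\<forall>v\<in>set qs. \<iota> v < hdim (\<alpha> v)) \<longrightarrow>
        ?slice f \<iota> \<in> spaces (hat_brel F) ?xay [])" for f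
    using sem_Atm[OF val hat, of f] vars notin by (simp only: list.map) auto
  then show ?thesis
    unfolding slices_def by (intro set_eqI) (simp only: slice mem_Collect_eq cong: conj_cong)
qed

lemma Rel_vars: "Rel k R (map Var vs) = Atm R vs"
  by (subst Rel.simps) (simp add: comp_def)

lemma Rel_App_Var:
  assumes "src R = [Y, Y']"
  shows "Rel k R [App F [Var x, Var a], Var v] =
    ExEq (k + 2, Y') (k + 3, qdual Y') (ExEq (k, Y) (k + 1, qdual Y)
      (And (And (Atm R [(k, Y), (k + 2, Y')]) (Atm (hat_brel F) [x, a, (k + 1, qdual Y)]))
        (Atm (eq_brel Y') [v, (k + 3, qdual Y')])))"
  using assms Rel_vars[of "k + 4" "hat_brel F" "[x, a, (k + 1, qdual Y)]"]
  by (subst Rel.simps) (simp add: upt_rec numeral_eq_Suc)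

lemma Rel_App_App:
  assumes "src R = [Y, Y']"
  shows "Rel k R [App F [Var x, Var a], App F' [Var x', Var a']] =
    ExEq (k + 2, Y') (k + 3, qdual Y') (ExEq (k, Y) (k + 1, qdual Y)
      (And (And (Atm R [(k, Y), (k + 2, Y')]) (Atm (hat_brel F) [x, a, (k + 1, qdual Y)]))
        (Atm (hat_brel F') [x', a', (k + 3, qdual Y')])))"
  using assms Rel_vars[of "k + 4" "hat_brel F" "[x, a, (k + 1, qdual Y)]"]
    Rel_vars[of "k + 4" "hat_brel F'" "[x', a', (k + 3, qdual Y')]"]
  by (subst Rel.simps) (simp add: upt_rec numeral_eq_Suc)

lemma graded_fm_Rel:
  assumes "src R = [Y, Y']"
  shows "graded_fm (Rel k R [App F [Var x, Var a], Var v])"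
    and "graded_fm (Rel k R [App F [Var x, Var a], App F' [Var x', Var a']])"
  unfolding Rel_App_Var[OF assms] Rel_App_App[OF assms] by simp_all

text \<open>The atomic formulas without \<open>F\<close> are equations between classical variables, which vanish except
  at one choice of atoms for the fresh variables.  There the formula reduces to \<open>F(x, a) = v\<close>.\<close>

lemma perp_sem_Rel_App_Var:
  assumes val: "valuation cs qs \<alpha>"
    and F: "graded F" "src F = [snd x, snd a]" "tgt F = [Y]" "one_dimensional Y"
    and vars: "x \<in> set qs" "a \<in> set cs" "v \<in> set cs" "snd v = qdual Y"
    and fresh: "\<forall>u\<in>set (cs @ qs). fst u < k"
  shows "perp (map \<alpha> qs) (sem cs qs \<alpha> (Rel k (eq_brel Y) [App F [Var x, Var a], Var v])) =
    perp (map \<alpha> qs) (slices F qs \<alpha> x a (dual (\<alpha> v)))"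
proof -
  let ?perp = "perp (map \<alpha> qs)" and ?L = "L (map \<alpha> qs) []"
  let ?V = "?perp (slices F qs \<alpha> x a (dual (\<alpha> v)))"
  let ?y0 = "(k, Y)" and ?y0' = "(k + 1, qdual Y)" and ?y1 = "(k + 2, qdual Y)" and ?y1' = "(k + 3, Y)"
  let ?hat = "Atm (hat_brel F) [x, a, ?y0']" and ?eq = "Atm (eq_brel Y) [?y0, ?y1]"
    and ?eq' = "Atm (eq_brel (qdual Y)) [v, ?y1']"
  let ?cs1 = "?y1 # ?y1' # cs" and ?cs0 = "?y0 # ?y0' # ?y1 # ?y1' # cs"
  let ?\<beta> = "\<lambda>c. \<alpha>(?y1' := dual c, ?y1 := c)"
  let ?\<gamma> = "\<lambda>c b. (?\<beta> c)(?y0' := dual b, ?y0 := b)"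
  have notin: "(m, S) \<notin> set cs" "(m, S) \<notin> set qs" if "k \<le> m" for m S
    using fresh that by (metis (no_types) Un_iff fst_conv linorder_not_less set_append)+
  have neq: "x \<noteq> (m, S)" "a \<noteq> (m, S)" "v \<noteq> (m, S)" if "k \<le> m" for m S
    using notin that vars by metis+
  have val1: "valuation ?cs1 qs (?\<beta> c)" if "c \<in> qdual Y" for c
    using val that notin F(4) by (intro valuation_Cons) (auto simp: in_qdual_iff)
  have val0: "valuation ?cs0 qs (?\<gamma> c b)" if "c \<in> qdual Y" "b \<in> Y" for c b
    using that notin F(4) by (intro valuation_Cons val1) auto
  have map: "map (?\<beta> c) qs = map \<alpha> qs" "map (?\<gamma> c b) qs = map \<alpha> qs" for c b
    using notin by auto
  have S: "?perp (sem ?cs0 qs (?\<gamma> c b) (And (And ?eq ?hat) ?eq')) =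
      (if c = dual b \<and> c = \<alpha> v then ?V
       else ?L)" if c: "c \<in> qdual Y" and b: "b \<in> Y" for c b
  proof -
    note val0 = val0[OF that]
    have eq: "sem ?cs0 qs (?\<gamma> c b) ?eq = (if c = dual b then ?L else {0})"
      using sem_eq_classical[OF val0, of ?y0 ?y1, unfolded map] by simp
    have hat: "sem ?cs0 qs (?\<gamma> c b) ?hat = slices F qs \<alpha> x a b"
      using sem_hat[OF val0, of F x a Y ?y0'] F vars neq notin by simp
    have "dual c = dual (\<alpha> v) \<longleftrightarrow> c = \<alpha> v"
      by (metis dual_dual)
    then have eq': "sem ?cs0 qs (?\<gamma> c b) ?eq' = (if c = \<alpha> v then ?L else {0})"
      using sem_eq_classical[OF val0, of v ?y1', unfolded map] vars neq by simp
    have "oper.subspace (sem ?cs0 qs (?\<gamma> c b) ?hat)"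
      using F by (intro subspace_sem[OF val0]) (simp add: graded_hat)
    then have "0 \<in> slices F qs \<alpha> x a b"
      unfolding hat by (rule oper.subspace_0)
    then show ?thesis
      using slices_in_L[of F qs \<alpha> x a b]
      unfolding sem_And[OF val0] eq hat eq' by (auto simp: Int_absorb1 Int_absorb2)
  qed
  let ?A = "And (And ?eq ?hat) ?eq'"
  have graded: "graded_fm ?A"
    using F by (auto simp: graded_eq graded_hat)
  have "?perp (sem ?cs1 qs (?\<beta> c) (ExEq ?y0 ?y0' ?A)) =
      ?L \<inter> (\<Inter>b\<in>Y. ?perp (sem ?cs0 qs (?\<gamma> c b) ?A))" if "c \<in> qdual Y" for c
    using perp_sem_ExEq[OF val1[OF that] graded, of ?y0 ?y0'] notin F(4) map by simp
  then have "?perp (sem cs qs \<alpha> (ExEq ?y1 ?y1' (ExEq ?y0 ?y0' ?A))) =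
      ?L \<inter> (\<Inter>c\<in>qdual Y. ?L \<inter>
        (\<Inter>b\<in>Y. ?perp (sem ?cs0 qs (?\<gamma> c b) ?A)))"
    using perp_sem_ExEq[OF val, of "ExEq ?y0 ?y0' ?A" ?y1 ?y1'] notin F(4) by simp
  also have "\<dots> = ?L \<inter> (\<Inter>c\<in>qdual Y. ?L \<inter>
        (\<Inter>b\<in>Y. if c = dual b \<and> c = \<alpha> v
          then ?V else ?L))"
    using S by simp
  also have "\<dots> = ?V" (is "?J = _")
  proof (intro equalityI subsetI)
    have v: "\<alpha> v \<in> qdual Y" "dual (\<alpha> v) \<in> Y"
      using val vars by (auto simp: valuation_def in_qdual_iff)
    fix f assume "f \<in> ?J"
    then have "f \<in> (if \<alpha> v = dual (dual (\<alpha> v)) \<and> \<alpha> v = \<alpha> v then ?V else ?L)"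
      using v unfolding Int_iff INT_iff by blast
    then show "f \<in> ?V"
      by simp
  qed (auto dest: subsetD[OF perp_in_L] split: if_splits)
  finally show ?thesis
    by (simp add: Rel_App_Var)
qed

text \<open>The equation between the fresh variables leaves one free value \<open>b\<close>, the common value of the two
  terms.\<close>

lemma sem_Rel_App_App:
  assumes val: "valuation cs qs \<alpha>"
    and F: "graded F" "src F = [snd x, snd a]" "tgt F = [qdual Y]"
    and F': "graded F'" "src F' = [snd x', snd a']" "tgt F' = [Y]"
    and Y: "one_dimensional Y"
    and vars: "x \<in> set qs" "a \<in> set cs" "x' \<in> set qs" "a' \<in> set cs"
    and fresh: "\<forall>u\<in>set (cs @ qs). fst u < k"
  shows "sem cs qs \<alpha> (Rel k (eq_brel (qdual Y)) [App F [Var x, Var a], App F' [Var x', Var a']]) =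
    perp (map \<alpha> qs) (perp (map \<alpha> qs)
      (\<Union>b\<in>Y. slices F qs \<alpha> x a (dual b) \<inter> slices F' qs \<alpha> x' a' b))"
proof -
  let ?y0 = "(k, qdual Y)" and ?y0' = "(k + 1, Y)" and ?y1 = "(k + 2, Y)" and ?y1' = "(k + 3, qdual Y)"
  let ?eq = "Atm (eq_brel (qdual Y)) [?y0, ?y1]"
    and ?hat = "Atm (hat_brel F) [x, a, ?y0']" and ?hat' = "Atm (hat_brel F') [x', a', ?y1']"
  let ?cs1 = "?y1 # ?y1' # cs" and ?cs0 = "?y0 # ?y0' # ?y1 # ?y1' # cs"
  let ?\<beta> = "\<lambda>c. \<alpha>(?y1' := dual c, ?y1 := c)"
  let ?\<gamma> = "\<lambda>c b. (?\<beta> c)(?y0' := dual b, ?y0 := b)"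
  let ?W = "\<lambda>b. slices F qs \<alpha> x a (dual b) \<inter> slices F' qs \<alpha> x' a' b"
  let ?perp = "perp (map \<alpha> qs)" and ?L = "L (map \<alpha> qs) []"
  have notin: "(m, S) \<notin> set cs" "(m, S) \<notin> set qs" if "k \<le> m" for m S
    using fresh that by (metis (no_types) Un_iff fst_conv linorder_not_less set_append)+
  have neq: "x \<noteq> (m, S)" "a \<noteq> (m, S)" "x' \<noteq> (m, S)" "a' \<noteq> (m, S)" if "k \<le> m" for m S
    using notin that vars by metis+
  have val1: "valuation ?cs1 qs (?\<beta> c)" if "c \<in> Y" for c
    using val that notin Y by (intro valuation_Cons) auto
  have val0: "valuation ?cs0 qs (?\<gamma> c b)" if "c \<in> Y" "b \<in> qdual Y" for c b
    using that notin Y by (intro valuation_Cons val1) (auto simp: in_qdual_iff)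
  have map: "map (?\<beta> c) qs = map \<alpha> qs" "map (?\<gamma> c b) qs = map \<alpha> qs" for c b
    using notin by auto
  have S: "?perp (sem ?cs0 qs (?\<gamma> c b) (And (And ?eq ?hat) ?hat')) =
      (if b = dual c then ?perp (?W c) else ?L)" if c: "c \<in> Y" and b: "b \<in> qdual Y" for c b
  proof -
    note val0 = val0[OF that]
    have "c = dual b \<longleftrightarrow> b = dual c"
      by (metis dual_dual)
    then have eq: "sem ?cs0 qs (?\<gamma> c b) ?eq = (if b = dual c then ?L else {0})"
      using sem_eq_classical[OF val0, of ?y0 ?y1, unfolded map] by simp
    have hat: "sem ?cs0 qs (?\<gamma> c b) ?hat = slices F qs \<alpha> x a b"
      using sem_hat[OF val0, of F x a "qdual Y" ?y0'] F Y vars neq notin by simp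
    have hat': "sem ?cs0 qs (?\<gamma> c b) ?hat' = slices F' qs \<alpha> x' a' c"
      using sem_hat[OF val0, of F' x' a' Y ?y1'] F' Y vars neq notin by simp
    have "oper.subspace (sem ?cs0 qs (?\<gamma> c b) (And ?hat ?hat'))"
      using F F' by (intro subspace_sem[OF val0]) (simp add: graded_hat)
    then have "0 \<in> slices F qs \<alpha> x a b \<inter> slices F' qs \<alpha> x' a' c"
      unfolding sem_And[OF val0] hat hat' by (rule oper.subspace_0)
    then show ?thesis
      using slices_in_L[of F qs \<alpha> x a b]
      unfolding sem_And[OF val0] eq hat hat' by (auto simp: Int_absorb1 Int_absorb2 Int_assoc[symmetric])
  qed
  let ?A = "And (And ?eq ?hat) ?hat'"
  have graded: "graded_fm ?A"
    using F F' by (auto simp: graded_eq graded_hat)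
  have "?perp (sem ?cs1 qs (?\<beta> c) (ExEq ?y0 ?y0' ?A)) = ?perp (?W c)" if c: "c \<in> Y" for c
  proof -
    have "?perp (sem ?cs1 qs (?\<beta> c) (ExEq ?y0 ?y0' ?A)) =
        ?L \<inter> (\<Inter>b\<in>qdual Y. ?perp (sem ?cs0 qs (?\<gamma> c b) ?A))"
      using perp_sem_ExEq[OF val1[OF that] graded, of ?y0 ?y0'] notin Y map by simp
    also have "\<dots> = ?L \<inter> (\<Inter>b\<in>qdual Y. if b = dual c then ?perp (?W c) else ?L)"
      using S[OF c] by simp
    also have "\<dots> = ?perp (?W c)"
      using c perp_in_L[of "map \<alpha> qs" "?W c"]
      by (intro set_eqI, unfold Int_iff INT_iff) (auto split: if_splits)
    finally show ?thesis .
  qed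
  then have "?perp (\<Union>c\<in>Y. sem ?cs1 qs (?\<beta> c) (ExEq ?y0 ?y0' ?A)) = ?perp (\<Union>c\<in>Y. ?W c)"
    by (simp add: perp_UN)
  then show ?thesis
    using sem_ExEq[OF val, of "ExEq ?y0 ?y0' ?A" ?y1 ?y1'] notin Y by (simp add: Rel_App_App)
qed


section \<open>Projections in a finite-dimensional Hilbert space\<close>

lemma cinner_add_left: "cinner (x + y) z = cinner x z + cinner (y :: 'h::fd_hilbert) z"
  by (metis cinner_add_right cinner_commute complex_cnj_add)

lemma cinner_scaleC_left: "cinner (scaleC c x) y = cnj c * cinner x (y :: 'h::fd_hilbert)"
  by (metis cinner_commute cinner_scaleC_right complex_cnj_mult)

lemma cinner_zero [simp]: "cinner x 0 = 0" "cinner 0 (x :: 'h::fd_hilbert) = 0"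
  using cinner_add_right[of x 0 0] cinner_add_left[of 0 0 x] by simp_all

lemma cinner_sum_right: "cinner x (\<Sum>i\<in>I. f i) = (\<Sum>i\<in>I. cinner x (f i :: 'h::fd_hilbert))"
  by (induction I rule: infinite_finite_induct) (auto simp: cinner_add_right)

lemma cinner_sum_left: "cinner (\<Sum>i\<in>I. f i) x = (\<Sum>i\<in>I. cinner (f i :: 'h::fd_hilbert) x)"
  by (induction I rule: infinite_finite_induct) (auto simp: cinner_add_left)

lemma cinner_diff_right: "cinner x (y - z) = cinner x y - cinner x (z :: 'h::fd_hilbert)"
  by (metis add_diff_cancel_right' cinner_add_right diff_add_cancel)

lemma cinner_self_nonneg: "0 \<le> Re (cinner x (x :: 'h::fd_hilbert))"
  using cinner_pos[of x] by (cases "x = 0") auto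

lemma cinner_self_eq_zero [simp]: "Re (cinner x (x :: 'h::fd_hilbert)) = 0 \<longleftrightarrow> x = 0"
  using cinner_pos[of x] by (cases "x = 0") auto

lemma cinner_extensionality: "(\<And>y. cinner y x = cinner y x') \<Longrightarrow> x = (x' :: 'h::fd_hilbert)"
  using cinner_self_eq_zero[of "x - x'"] by (simp add: cinner_diff_right)

lemma projectionD:
  assumes "projection p"
  shows "p (x + y) = p x + p y" "p (scaleC c x) = scaleC c (p x)" "p (p x) = p x"
    "cinner (p x) y = cinner x (p y)"
  using assms by (auto simp: projection_def Vector_Spaces.linear_iff fun_eq_iff)

lemma projection_zero: "projection p \<Longrightarrow> p 0 = 0"
  using projectionD(1)[of p 0 0] by simp

lemma projection_sum: "projection p \<Longrightarrow> p (\<Sum>i\<in>I. f i) = (\<Sum>i\<in>I. p (f i))"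
  by (induction I rule: infinite_finite_induct) (auto simp: projection_zero projectionD)

lemma projectionI:
  assumes "\<And>x y. p (x + y) = p x + p y" "\<And>c x. p (scaleC c x) = scaleC c (p x)"
    "\<And>x. p (p x) = p x" "\<And>x y. cinner (p x) y = cinner x (p y)"
  shows "projection p"
  using assms cvec.vector_space_axioms
  by (auto simp: projection_def Vector_Spaces.linear_iff fun_eq_iff)

text \<open>The squared norm of \<open>y = p i x\<close> is the sum over \<open>k\<close> of those of \<open>p k y\<close>.  As \<open>p i y = y\<close>, the summand
  with \<open>k = i\<close> exhausts it.\<close>

lemma projections_sum_orthogonal:
  fixes p :: "'i \<Rightarrow> 'h::fd_hilbert \<Rightarrow> 'h"
  assumes "finite I" and p: "\<And>i. i \<in> I \<Longrightarrow> projection (p i)"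
    and sum: "\<And>x. (\<Sum>i\<in>I. p i x) = x" and ij: "i \<in> I" "j \<in> I" "i \<noteq> j"
  shows "p j (p i x) = 0"
proof -
  let ?y = "p i x"
  have "Re (cinner ?y ?y) = (\<Sum>k\<in>I. Re (cinner (p k ?y) (p k ?y)))"
  proof -
    have "cinner ?y ?y = (\<Sum>k\<in>I. cinner ?y (p k ?y))"
      using sum[of ?y] by (simp flip: cinner_sum_right)
    also have "\<dots> = (\<Sum>k\<in>I. cinner (p k ?y) (p k ?y))"
      using projectionD(3,4)[OF p] by (intro sum.cong refl) simp
    finally show ?thesis
      by simp
  qed
  also have "\<dots> = Re (cinner ?y ?y) + (\<Sum>k\<in>I - {i}. Re (cinner (p k ?y) (p k ?y)))"
    using assms(1) ij projectionD(3)[OF p] by (simp add: sum.remove)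
  finally have "(\<Sum>k\<in>I - {i}. Re (cinner (p k ?y) (p k ?y))) = 0"
    by simp
  then show ?thesis
    using assms(1) ij cinner_self_nonneg by (subst (asm) sum_nonneg_eq_0_iff) auto
qed

lemma projection_eq_of_range_eq:
  assumes p: "projection p" and q: "projection q" and range: "range p = range q"
  shows "p = q"
proof
  fix x
  have "p (q y) = q y" "q (p y) = p y" for y
    using range projectionD(3)[OF p] projectionD(3)[OF q] by (metis imageE rangeI)+
  then have "cinner y (p x) = cinner y (q x)" for y
    using projectionD(4)[OF p] projectionD(4)[OF q] by metis
  then show "p x = q x"
    by (rule cinner_extensionality)
qed

text \<open>An orthogonal decomposition into subspaces \<open>U i\<close> comes from projections: the component
  of \<open>x\<close> in \<open>U i\<close> is unique, and uniqueness makes it depend linearly on \<open>x\<close>.\<close>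

lemma projections_of_orthogonal_decomposition:
  fixes U :: "'i \<Rightarrow> 'h::fd_hilbert set"
  assumes I: "finite I"
    and zero: "\<And>i. i \<in> I \<Longrightarrow> 0 \<in> U i"
    and add: "\<And>i x y. i \<in> I \<Longrightarrow> x \<in> U i \<Longrightarrow> y \<in> U i \<Longrightarrow> x + y \<in> U i"
    and scale: "\<And>i c x. i \<in> I \<Longrightarrow> x \<in> U i \<Longrightarrow> scaleC c x \<in> U i"
    and orth: "\<And>i j x y. i \<in> I \<Longrightarrow> j \<in> I \<Longrightarrow> i \<noteq> j \<Longrightarrow> x \<in> U i \<Longrightarrow> y \<in> U j \<Longrightarrow> cinner x y = 0"
    and decomp: "\<And>x. \<exists>u. (\<forall>i\<in>I. u i \<in> U i) \<and> x = (\<Sum>i\<in>I. u i)"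
  shows "\<exists>p. (\<forall>i\<in>I. projection (p i) \<and> range (p i) = U i) \<and> (\<forall>x. (\<Sum>i\<in>I. p i x) = x)"
proof -
  have unique: "u i = v i"
    if "\<forall>i\<in>I. u i \<in> U i" "\<forall>i\<in>I. v i \<in> U i" "(\<Sum>i\<in>I. u i) = (\<Sum>i\<in>I. v i)" "i \<in> I" for u v i
  proof -
    \<comment> \<open>the difference, written with the operations under which \<open>U j\<close> is closed\<close>
    define w where "w j = u j + scaleC (- 1) (v j)" for j
    have w: "w j \<in> U j" if "j \<in> I" for j
      using that \<open>\<forall>i\<in>I. u i \<in> U i\<close> \<open>\<forall>i\<in>I. v i \<in> U i\<close> unfolding w_def by (intro add scale) auto
    have w_diff: "w j = u j - v j" for j
      by (simp add: w_def)
    have "0 = cinner (w i) (\<Sum>j\<in>I. w j)"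
      using that by (simp add: w_diff sum_subtractf)
    also have "\<dots> = (\<Sum>j\<in>I. if j = i then cinner (w i) (w i) else 0)"
      unfolding cinner_sum_right using orth w \<open>i \<in> I\<close> by (intro sum.cong) auto
    also have "\<dots> = cinner (w i) (w i)"
      using I \<open>i \<in> I\<close> by simp
    finally have "Re (cinner (w i) (w i)) = 0"
      by simp
    then show ?thesis
      by (simp add: w_diff)
  qed
  obtain q where q: "\<And>x i. i \<in> I \<Longrightarrow> q x i \<in> U i" "\<And>x. (\<Sum>i\<in>I. q x i) = x"
    using decomp by metis
  have q_unique: "q x i = u i" if "\<forall>i\<in>I. u i \<in> U i" "(\<Sum>i\<in>I. u i) = x" "i \<in> I" for x u i
    using unique[of "q x" u i] that q by simp
  have q_in: "q x i = x" if "x \<in> U i" "i \<in> I" for x i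
    using q_unique[of "\<lambda>j. if j = i then x else 0" x i] that I zero by simp
  have "projection (\<lambda>x. q x i)" if i: "i \<in> I" for i
  proof (rule projectionI)
    show "q (x + y) i = q x i + q y i" for x y
      using q i add by (intro q_unique) (auto simp: sum.distrib)
    show "q (scaleC c x) i = scaleC c (q x i)" for c x
      using q i scale by (intro q_unique) (auto simp flip: cvec.scale_sum_right)
    show "q (q x i) i = q x i" for x
      using q_in q i by blast
    show "cinner (q x i) y = cinner x (q y i)" for x y
    proof -
      have "cinner (q x i) y = (\<Sum>j\<in>I. cinner (q x i) (q y j))"
        using q(2)[of y] by (simp flip: cinner_sum_right)
      also have "\<dots> = (\<Sum>j\<in>I. if j = i then cinner (q x i) (q y i) else 0)"
        using orth q(1) i by (intro sum.cong) auto
      also have "\<dots> = (\<Sum>j\<in>I. cinner (q x j) (q y i))"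
        using orth q(1) i by (intro sum.cong) auto
      also have "\<dots> = cinner x (q y i)"
        using q(2)[of x] by (simp flip: cinner_sum_left)
      finally show ?thesis .
    qed
  qed
  moreover have "range (\<lambda>x. q x i) = U i" if "i \<in> I" for i
    using q(1) q_in that by (metis (no_types, lifting) image_subset_iff rangeI subsetI subset_antisym)
  ultimately show ?thesis
    using q(2) by (intro exI[of _ "\<lambda>i x. q x i"]) auto
qed


section \<open>Coordinates\<close>

text \<open>By the Riesz representation theorem the functionals on \<open>H\<close> are \<open>\<langle>u, -\<rangle>\<close> with \<open>u\<close> a vector.\<close>

locale coordinates =
  fixes H :: "'l hilb" and e :: "nat \<Rightarrow> 'h::fd_hilbert"
  assumes onb: "orthonormal_basis (hdim H) e" and pos: "0 < hdim H"
begin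

lemma cinner_basis: "i < hdim H \<Longrightarrow> j < hdim H \<Longrightarrow> cinner (e i) (e j) = (if i = j then 1 else 0)"
  using onb by (simp add: orthonormal_basis_def)

lemma expansion: "x = (\<Sum>k<hdim H. scaleC (cinner (e k) x) (e k))"
proof -
  let ?S = "{x. x = (\<Sum>k<hdim H. scaleC (cinner (e k) x) (e k))}"
  have "cvec.span (e ` {..<hdim H}) \<subseteq> ?S"
  proof (rule cvec.span_minimal)
    have "e m = (\<Sum>k<hdim H. scaleC (cinner (e k) (e m)) (e k))" if "m < hdim H" for m
    proof -
      have "(\<Sum>k<hdim H. scaleC (cinner (e k) (e m)) (e k)) = (\<Sum>k<hdim H. if k = m then e m else 0)"
        using that by (intro sum.cong) (auto simp: cinner_basis)
      then show ?thesis
        using that by simp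
    qed
    then show "e ` {..<hdim H} \<subseteq> ?S"
      by auto
    have "(\<Sum>k<hdim H. scaleC (cinner (e k) (scaleC c x)) (e k)) =
        scaleC c (\<Sum>k<hdim H. scaleC (cinner (e k) x) (e k))" for c x
      by (simp add: cinner_scaleC_right cvec.scale_sum_right)
    then show "cvec.subspace ?S"
      by (intro cvec.subspaceI)
        (simp_all add: cinner_add_right cvec.scale_left_distrib sum.distrib)
  qed
  then show ?thesis
    using onb by (auto simp: orthonormal_basis_def)
qed

lemma parseval: "cinner x y = (\<Sum>k<hdim H. cinner x (e k) * cinner (e k) y)"
  by (subst expansion[of y]) (simp add: cinner_sum_right cinner_scaleC_right mult.commute)

lemma cinner_basis_ext: "(\<And>k. k < hdim H \<Longrightarrow> cinner u (e k) = cinner v (e k)) \<Longrightarrow> u = v"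
  by (rule cinner_extensionality) (metis (no_types, lifting) cinner_commute lessThan_iff parseval sum.cong)

lemma riesz: obtains u where "\<And>k. k < hdim H \<Longrightarrow> cinner u (e k) = g k"
proof
  fix k assume "k < hdim H"
  then have "cinner (\<Sum>m<hdim H. scaleC (cnj (g m)) (e m)) (e k) = (\<Sum>m<hdim H. if m = k then g k else 0)"
    unfolding cinner_sum_left by (intro sum.cong) (auto simp: cinner_scaleC_left cinner_basis)
  then show "cinner (\<Sum>m<hdim H. scaleC (cnj (g m)) (e m)) (e k) = g k"
    using \<open>k < hdim H\<close> by simp
qed

text \<open>The operator \<open>\<langle>u, -\<rangle> \<otimes> 1\<close> from \<open>H \<otimes> C\<close> to a one-dimensional space.\<close>

definition row :: "'h \<Rightarrow> oper" where
  "row u = (\<lambda>j i. if j = [0] \<and> (\<exists>k<hdim H. i = [k, 0]) then cinner u (e (hd i)) else 0)"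

lemma row_apply: "k < hdim H \<Longrightarrow> row u [0] [k, 0] = cinner u (e k)"
  by (simp add: row_def)

lemma row_linear:
  "row (u + v) = row u + row v" "row (scaleC c u) = scale_oper (cnj c) (row u)" "row 0 = 0"
  by (auto simp: row_def scale_oper_def fun_eq_iff cinner_add_left cinner_scaleC_left)

lemma row_inject [simp]: "row u = row v \<longleftrightarrow> u = v"
  by (metis cinner_basis_ext row_apply)

lemma basis_row: "hdim C = 1 \<Longrightarrow> i \<in> basis [H, C] \<longleftrightarrow> (\<exists>k<hdim H. i = [k, 0])"
  by (auto simp: basis_Cons)

lemma basis_one: "hdim C = 1 \<Longrightarrow> j \<in> basis [C] \<longleftrightarrow> j = [0]"
  by (auto simp: basis_Cons)

lemma row_in_L: "hdim C = 1 \<Longrightarrow> hdim D = 1 \<Longrightarrow> row u \<in> L [H, C] [D]"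
  by (auto simp: L_def basis_row basis_one row_def split: if_splits)

lemma rowE:
  assumes "f \<in> L [H, C] [D]" "hdim C = 1" "hdim D = 1"
  obtains u where "f = row u"
proof -
  obtain u where u: "\<And>k. k < hdim H \<Longrightarrow> cinner u (e k) = f [0] [k, 0]"
    using riesz[of "\<lambda>k. f [0] [k, 0]"] by blast
  have "f = row u"
    using assms u by (intro L_eqI[OF assms(1) row_in_L]) (auto simp: basis_row basis_one row_apply)
  then show thesis
    by (rule that)
qed

text \<open>Since \<open>p\<close> is self-adjoint, \<open>\<langle>u, -\<rangle> \<circ> p = \<langle>p u, -\<rangle>\<close>.\<close>

lemma spaces_family_function:
  assumes p: "projection (p (a, b))" and "a \<in> A" "b \<in> B"
  shows "spaces (family_function H e A B p) [H, Hilb a 1 False] [Hilb b 1 False] = row ` range (p (a, b))"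
proof -
  let ?C = "Hilb a 1 False" and ?D = "Hilb b 1 False"
  let ?T = "tensor 1 1 (matrix_of H e (p (a, b))) (id_oper [?C])"
  have "mult [H, ?C] (row u) ?T = row (p (a, b) u)" for u
  proof (intro ext)
    fix j i
    have T: "?T [m, 0] i = (if \<exists>k<hdim H. i = [k, 0] then cinner (e m) (p (a, b) (e (hd i))) else 0)"
      if "m < hdim H" for m
      using that pos
      by (cases i) (auto simp: tensor_def matrix_of_def id_oper_def basis_Cons)
    have "mult [H, ?C] (row u) ?T j i = (\<Sum>m<hdim H. row u j [m, 0] * ?T [m, 0] i)"
      by (simp add: mult_def sum_basis_Cons)
    also have "\<dots> = (\<Sum>m<hdim H. if j = [0] \<and> (\<exists>k<hdim H. i = [k, 0])
        then cinner u (e m) * cinner (e m) (p (a, b) (e (hd i))) else 0)"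
      using T by (intro sum.cong) (auto simp: row_def)
    also have "\<dots> = row (p (a, b) u) j i"
      using parseval[of u "p (a, b) (e (hd i))"] projectionD(4)[OF p]
      by (auto simp: row_def intro!: sum.neutral)
    finally show "mult [H, ?C] (row u) ?T j i = row (p (a, b) u) j i" .
  qed
  moreover have "L [H, ?C] [?D] = range row"
    by (auto intro: row_in_L elim: rowE)
  ultimately have "{mult [H, ?C] f ?T | f. f \<in> L [H, ?C] [?D]} = row ` range (p (a, b))"
    by (simp only: Setcompr_eq_image image_image)
  then show ?thesis
    using assms by (simp add: family_function_def classical_def Let_def)
qed


text \<open>The functional \<open>\<langle>u, -\<rangle>\<close> on \<open>H\<close>.\<close>

definition covector :: "'h \<Rightarrow> oper" where
  "covector u = (\<lambda>j i. if j = [] \<and> (\<exists>k<hdim H. i = [k]) then cinner u (e (hd i)) else 0)"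

lemma L_functionals: "L [H] [] = range covector"
proof (intro equalityI subsetI)
  fix f assume f: "f \<in> L [H] []"
  obtain u where "\<And>k. k < hdim H \<Longrightarrow> cinner u (e k) = f [] [k]"
    using riesz[of "\<lambda>k. f [] [k]"] by blast
  then have "f j i = covector u j i" for j i
    using L_zero[OF f, of j i] by (auto simp: covector_def basis_Cons image_iff)
  then show "f \<in> range covector"
    by (auto simp: fun_eq_iff)
qed (auto simp: L_def covector_def basis_Cons split: if_splits)

lemma covector_inject: "covector u = covector v \<longleftrightarrow> u = v"
proof
  assume eq: "covector u = covector v"
  have "cinner u (e k) = cinner v (e k)" if "k < hdim H" for k
    using fun_cong[OF fun_cong[OF eq, of "[]"], of "[k]"] that by (simp add: covector_def)
  then show "u = v"
    by (rule cinner_basis_ext)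
qed simp

lemma covector_eq_zero [simp]: "covector u = 0 \<longleftrightarrow> u = 0"
proof -
  have "covector 0 = 0"
    by (simp add: covector_def fun_eq_iff)
  then show ?thesis
    using covector_inject[of u 0] by simp
qed

lemma perp_covectors: "perp [H] (covector ` U) = covector ` {v. \<forall>u\<in>U. cinner v u = 0}"
proof -
  have "(\<Sum>i\<in>basis [H]. cnj (covector u [] i) * covector v [] i) = cinner v u" for u v
    using parseval[of v u] cinner_commute[of "e _" u]
    by (simp add: sum_basis_Cons covector_def mult.commute)
  then show ?thesis
    by (auto simp: perp_def L_functionals)
qed


end


section \<open>The meaning of the two sentences\<close>

lemma interp_All_eq_top:
  assumes \<phi>: "graded_fm \<phi>" and sorts: "\<forall>v\<in>set (x # vs). quantum_set (snd v)"
  shows "interp vs (All x \<phi>) = top_brel (map snd vs) [] \<longleftrightarrow>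
    interp (x # vs) \<phi> = top_brel (map snd (x # vs)) []"
proof -
  have top_iff: "interp us \<psi> = top_brel (map snd us) [] \<longleftrightarrow>
      (\<forall>xs\<in>listset (map snd us). L xs [] \<subseteq> spaces (interp us \<psi>) xs [])" if "graded_fm \<psi>" for us \<psi>
    using eq_top_brel_iff[of "interp us \<psi>"] that by (simp add: graded_fm_def)
  have cons: "(\<forall>xs\<in>listset (map snd (x # vs)). P xs) \<longleftrightarrow>
      (\<forall>xs\<in>listset (map snd vs). \<forall>h\<in>snd x. P (h # xs))" for P
    by auto
  show ?thesis
    unfolding top_iff[OF \<phi>] top_iff[OF graded_fm_intros(4)] cons
    by (intro ball_cong refl interp_All_top_component_iff[OF assms])
qed

lemma interp_eq_top_iff:
  assumes \<phi>: "graded_fm \<phi>" and qs: "distinct qs" "\<forall>v\<in>set qs. quantum_set (snd v)"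
  shows "interp qs \<phi> = top_brel (map snd qs) [] \<longleftrightarrow>
    (\<forall>\<alpha>. valuation [] qs \<alpha> \<longrightarrow> sem [] qs \<alpha> \<phi> = L (map \<alpha> qs) [])" (is "?l \<longleftrightarrow> ?r")
proof -
  have I: "graded (interp qs \<phi>)"
    using \<phi> by (simp add: graded_fm_def)
  have sem: "sem [] qs \<alpha> \<phi> = spaces (interp qs \<phi>) (map \<alpha> qs) []" for \<alpha>
    using graded_in_L[OF I] by (auto simp: sem_def)
  show ?thesis
  proof
    assume ?l
    then show ?r
      using val_listset[of "[]" qs] by (auto simp: sem top_brel_def)
  next
    assume r: ?r
    show ?l
    proof (rule brel_eqI[OF I graded_top])
      fix xs ys
      assume "xs \<in> listset (src (top_brel (map snd qs) []))"
        and "ys \<in> listset (tgt (top_brel (map snd qs) []))"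
      then have xs: "list_all2 (\<in>) xs (map snd qs)" and ys: "ys = []"
        by (simp_all add: top_brel_def listset_iff)
      define \<alpha> where "\<alpha> v = xs ! position qs v" for v
      have map: "map \<alpha> qs = xs"
        using list_all2_lengthD[OF xs] qs(1)
        by (intro nth_equalityI) (simp_all add: \<alpha>_def position_nth_distinct)
      have "\<alpha> v \<in> snd v" if "v \<in> set qs" for v
        using list_all2_nthD2[OF xs, of "position qs v"] position_nth[OF that] by (simp add: \<alpha>_def)
      then have "valuation [] qs \<alpha>"
        using qs by (simp add: valuation_def)
      then show "spaces (interp qs \<phi>) xs ys = spaces (top_brel (map snd qs) []) xs ys"
        using r sem[of \<alpha>] map xs ys by (simp add: top_brel_def listset_iff)
    qed (simp_all add: top_brel_def)
  qed
qed

context coordinates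
begin

text \<open>At \<open>a = i\<close> and \<open>v = j\<close> the complement of the component of \<open>E(F(x, a), v)\<close> corresponds to the kernel
  of \<open>p (i, j)\<close>, and the existential quantifier over \<open>a\<close> gives the complement of the intersection of
  these kernels.\<close>

lemma holds_surjectivity_iff:
  fixes F :: "'l brel" and A B :: "'l set" and p :: "'l \<times> 'l \<Rightarrow> 'h \<Rightarrow> 'h"
    and x v a :: "'l var"
  defines "x \<equiv> (0, {H})" and "v \<equiv> (1, qdual (classical B))" and "a \<equiv> (2, classical A)"
  assumes F: "graded F" "src F = [{H}, classical A]" "tgt F = [classical B]"
    and p: "\<And>i j. i \<in> A \<Longrightarrow> j \<in> B \<Longrightarrow> projection (p (i, j))"
    and spaces: "\<And>i j. i \<in> A \<Longrightarrow> j \<in> B \<Longrightarrow>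
      spaces F [H, Hilb i 1 False] [Hilb j 1 False] = row ` range (p (i, j))"
  shows "holds (All x (All v (Ex a (Rel 3 (eq_brel (classical B)) [App F [Var x, Var a], Var v])))) \<longleftrightarrow>
    (\<forall>j\<in>B. \<forall>u. (\<forall>i\<in>A. p (i, j) u = 0) \<longrightarrow> u = 0)"
proof -
  let ?R = "Rel 3 (eq_brel (classical B)) [App F [Var x, Var a], Var v]"
  have graded: "graded_fm ?R"
    by (rule graded_fm_Rel) simp
  have quantum: "quantum_set {H}"
    using pos by (simp add: quantum_set_def)
  let ?pt = "\<lambda>i. Hilb i 1 False"
  let ?sem = "\<lambda>\<alpha> j. sem [v] [x] (\<alpha>(v := dual (?pt j))) (Ex a ?R)"
  have slices: "slices F [x] \<alpha> x a (?pt j) = covector ` range (p (i, j))"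
    if "\<alpha> x = H" "\<alpha> a = ?pt i" "i \<in> A" "j \<in> B" for \<alpha> i j
  proof -
    have row: "(\<lambda>j' k. if j' = [0] \<and> k \<in> basis [\<alpha> x, \<alpha> a]
        then covector u [] (map (\<iota>(x := hd k)) [x]) else 0) = row u" for u \<iota>
      using that by (auto simp: fun_eq_iff row_def covector_def basis_row)
    have "\<exists>\<iota> :: 'l var \<Rightarrow> nat. \<iota> x < hdim H"
      using pos by (intro exI[of _ "\<lambda>_. 0"])
    moreover have "row u \<in> row ` U \<longleftrightarrow> u \<in> U" for u U
      by auto
    ultimately have "covector u \<in> slices F [x] \<alpha> x a (?pt j) \<longleftrightarrow> u \<in> range (p (i, j))" for u
      unfolding slices_def mem_Collect_eq row using that by (simp add: spaces L_functionals del: One_nat_def)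
    moreover have "slices F [x] \<alpha> x a (?pt j) \<subseteq> range covector"
      using slices_in_L[of F "[x]" \<alpha> x a "?pt j"] that by (simp add: L_functionals)
    ultimately show ?thesis
      by blast
  qed
  have Ex: "sem [v] [x] \<alpha> (Ex a ?R) = perp [H] (L [H] [] \<inter> (\<Inter>i\<in>A. covector ` {u. p (i, j) u = 0}))"
    if \<alpha>: "valuation [v] [x] \<alpha>" and j: "j \<in> B" "\<alpha> v = dual (?pt j)" for \<alpha> j
  proof -
    have H: "\<alpha> x = H"
      using \<alpha> by (simp add: valuation_def x_def)
    have "sem [a, v] [x] (\<alpha>(a := ?pt i)) (Neg ?R) = covector ` {u. p (i, j) u = 0}" if i: "i \<in> A" for i
    proof -
      let ?\<beta> = "\<alpha>(a := ?pt i)"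
      have \<beta>: "valuation [a, v] [x] ?\<beta>"
        using \<alpha> i by (intro valuation_Cons) (auto simp: a_def v_def x_def classical_def one_dimensional_def)
      have "?\<beta> x = H" "?\<beta> a = ?pt i"
        using H by (auto simp: a_def x_def)
      note slices = slices[OF this i j(1)]
      have "sem [a, v] [x] ?\<beta> (Neg ?R) = perp [H] (slices F [x] ?\<beta> x a (?pt j))"
        using sem_Neg[OF \<beta> graded] perp_sem_Rel_App_Var[OF \<beta> F(1), of x a "classical B" v 3] F H j
        by (simp add: x_def a_def v_def)
      also have "\<dots> = covector ` {u. \<forall>w\<in>range (p (i, j)). cinner u w = 0}"
        unfolding slices by (rule perp_covectors)
      also have "{u. \<forall>w\<in>range (p (i, j)). cinner u w = 0} = {u. p (i, j) u = 0}"
      proof -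
        have "(\<forall>w. cinner u (p (i, j) w) = 0) \<longleftrightarrow> p (i, j) u = 0" for u
          using projectionD(4)[OF p[OF i j(1)]] cinner_self_eq_zero[of "p (i, j) u"] by (metis cinner_zero(2) zero_complex.sel(1))
        then show ?thesis
          by auto
      qed
      finally show ?thesis .
    qed
    moreover have "a \<notin> set ([v] @ [x])" "one_dimensional (snd a)"
      by (simp_all add: a_def v_def x_def)
    ultimately show ?thesis
      using sem_Neg[OF \<alpha>, of "All a (Neg ?R)"] sem_All[OF \<alpha>, of "Neg ?R" a] H
      by (simp add: Ex_def a_def classical_def)
  qed
  have Ex_top: "sem [v] [x] \<alpha> (Ex a ?R) = L [H] [] \<longleftrightarrow> (\<forall>u. (\<forall>i\<in>A. p (i, j) u = 0) \<longrightarrow> u = 0)"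
    if "valuation [v] [x] \<alpha>" and "j \<in> B" "\<alpha> v = dual (?pt j)" for \<alpha> j
  proof -
    have eq: "L [H] [] \<inter> (\<Inter>i\<in>A. covector ` {u. p (i, j) u = 0}) = covector ` {u. \<forall>i\<in>A. p (i, j) u = 0}"
      by (auto simp: L_functionals image_iff covector_inject)
    show ?thesis
      unfolding Ex[OF that] eq by (subst perp_eq_L_iff) (auto simp: L_functionals image_subset_iff)
  qed
  have "holds (All x (All v (Ex a ?R))) \<longleftrightarrow> interp [x] (All v (Ex a ?R)) = top_brel (map snd [x]) []"
    unfolding holds_def using interp_All_eq_top[of "All v (Ex a ?R)" x "[]"] quantum by (simp add: x_def)
  also have "\<dots> \<longleftrightarrow> (\<forall>\<alpha>. valuation [] [x] \<alpha> \<longrightarrow> sem [] [x] \<alpha> (All v (Ex a ?R)) = L (map \<alpha> [x]) [])"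
    using quantum by (intro interp_eq_top_iff) (simp_all add: x_def)
  also have "\<dots> \<longleftrightarrow> (\<forall>\<alpha>. valuation [] [x] \<alpha> \<longrightarrow>
      (\<forall>j\<in>B. ?sem \<alpha> j = L [H] []))"
  proof (intro all_cong1 imp_cong refl)
    fix \<alpha> assume \<alpha>: "valuation [] [x] \<alpha>"
    then have H: "\<alpha> x = H"
      by (simp add: valuation_def x_def)
    have "sem [] [x] \<alpha> (All v (Ex a ?R)) = L [H] [] \<inter>
        (\<Inter>b\<in>qdual (classical B). sem [v] [x] (\<alpha>(v := b)) (Ex a ?R))"
      using sem_All[OF \<alpha>, of "Ex a ?R" v] H by (simp add: v_def x_def Ex_def)
    also have "\<dots> = L [H] [] \<inter> (\<Inter>j\<in>B. ?sem \<alpha> j)"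
      by (simp add: qdual_def classical_def)
    finally have All: "sem [] [x] \<alpha> (All v (Ex a ?R)) = \<dots>" .
    have "?sem \<alpha> j \<subseteq> L [H] []" for j
      using sem_in_L[of "[v]" "[x]" "\<alpha>(v := dual (?pt j))"] H by (simp add: v_def x_def)
    then show "sem [] [x] \<alpha> (All v (Ex a ?R)) = L (map \<alpha> [x]) [] \<longleftrightarrow>
        (\<forall>j\<in>B. ?sem \<alpha> j = L [H] [])"
      unfolding All using H by auto
  qed
  also have "\<dots> \<longleftrightarrow> (\<forall>\<alpha>. valuation [] [x] \<alpha> \<longrightarrow> (\<forall>j\<in>B. \<forall>u. (\<forall>i\<in>A. p (i, j) u = 0) \<longrightarrow> u = 0))"
  proof (intro all_cong1 imp_cong refl ball_cong)
    fix \<alpha> j assume "valuation [] [x] \<alpha>" "j \<in> B"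
    then have "valuation [v] [x] (\<alpha>(v := dual (?pt j)))"
      by (intro valuation_Cons) (auto simp: v_def x_def classical_def one_dimensional_def qdual_def)
    then show "?sem \<alpha> j = L [H] [] \<longleftrightarrow>
        (\<forall>u. (\<forall>i\<in>A. p (i, j) u = 0) \<longrightarrow> u = 0)"
      using \<open>j \<in> B\<close> by (intro Ex_top) simp_all
  qed
  also have "\<dots> \<longleftrightarrow> (\<forall>j\<in>B. \<forall>u. (\<forall>i\<in>A. p (i, j) u = 0) \<longrightarrow> u = 0)"
  proof -
    have "valuation [] [x] (\<lambda>_. H)"
      using quantum by (simp add: valuation_def x_def)
    then show ?thesis
      by blast
  qed
  finally show ?thesis .
qed

end


text \<open>The Sasaki arrow \<open>E \<rightarrow> S\<close> is valid exactly if \<open>E \<le> S\<close>.  For a line \<open>E\<close> outside \<open>S\<close> the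
  meet \<open>E \<and> S\<close> is zero, and \<open>E\<close> itself obstructs validity.\<close>

lemma sasaki_arrow_valid_iff:
  assumes v: "v \<in> L xs []" and S: "oper.subspace S" "S \<subseteq> L xs []"
  defines "E \<equiv> oper.span {v}"
  shows "perp xs (perp xs (perp xs E) \<inter> perp xs (E \<inter> S)) = L xs [] \<longleftrightarrow> v \<in> S"
proof -
  have E: "E \<subseteq> L xs []"
    unfolding E_def using v by (intro oper.span_minimal subspace_L) simp
  have "perp xs (perp xs (perp xs E) \<inter> perp xs (E \<inter> S)) = L xs [] \<longleftrightarrow>
      perp xs (perp xs E) \<inter> perp xs (E \<inter> S) \<subseteq> {0}"
    using perp_in_L by (intro perp_eq_L_iff) blast
  also have "\<dots> \<longleftrightarrow> v \<in> S"
  proof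
    assume "v \<in> S"
    then have "E \<inter> S = E"
      unfolding E_def using S by (intro Int_absorb2 oper.span_minimal) simp_all
    then show "perp xs (perp xs E) \<inter> perp xs (E \<inter> S) \<subseteq> {0}"
      using self_orthogonal_zero[of _ xs] by (auto simp: perp_def)
  next
    assume small: "perp xs (perp xs E) \<inter> perp xs (E \<inter> S) \<subseteq> {0}"
    show "v \<in> S"
    proof (rule ccontr)
      assume "v \<notin> S"
      have "E \<inter> S \<subseteq> {0}"
      proof
        fix f assume f: "f \<in> E \<inter> S"
        then obtain c where c: "f = scale_oper c v"
          by (auto simp: E_def oper.span_singleton)
        show "f \<in> {0}"
        proof (cases "c = 0")
          case False
          then have "v = scale_oper (inverse c) f"
            by (simp add: c)
          then have "v \<in> S"
            using f oper.subspace_scale[OF S(1)] by auto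
          then show ?thesis
            using \<open>v \<notin> S\<close> by simp
        qed (simp add: c)
      qed
      then have "perp xs (E \<inter> S) = L xs []"
        by (auto simp: perp_def)
      moreover have "v \<in> perp xs (perp xs E)"
        using subset_perp_perp[OF E] oper.span_base[of v "{v}"] by (auto simp: E_def)
      ultimately have "v = 0"
        using small v by auto
      then show False
        using \<open>v \<notin> S\<close> oper.subspace_0[OF S(1)] by simp
    qed
  qed
  finally show ?thesis .
qed

text \<open>The biconditional of a truth value \<open>P\<close> with a closed \<open>\<psi>\<close> is \<open>\<psi>\<close> or \<open>\<not>\<psi>\<close>.\<close>

lemma sem_Iff:
  assumes val: "valuation cs qs \<alpha>" and graded: "graded_fm \<phi>" "graded_fm \<psi>"
    and W: "W \<subseteq> L (map \<alpha> qs) []"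
    and \<psi>: "sem cs qs \<alpha> \<psi> = perp (map \<alpha> qs) (perp (map \<alpha> qs) W)"
    and \<phi>: "sem cs qs \<alpha> \<phi> = (if P then L (map \<alpha> qs) [] else {0})"
  shows "sem cs qs \<alpha> (Iff \<phi> \<psi>) = perp (map \<alpha> qs) (if P then perp (map \<alpha> qs) W else W)"
proof -
  let ?perp = "perp (map \<alpha> qs)" and ?L = "L (map \<alpha> qs) []"
  have ppp: "?perp (?perp (?perp W)) = ?perp W"
    using W by (rule perp_perp_perp)
  have zero: "0 \<in> ?perp S" for S
    using subspace_perp oper.subspace_0 by blast
  have "?perp (?perp W) \<inter> ?perp W = {0}"
  proof (intro equalityI subsetI)
    show "f \<in> {0}" if "f \<in> ?perp (?perp W) \<inter> ?perp W" for f
      using that self_orthogonal_zero[of f "map \<alpha> qs"] by (auto simp: perp_def)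
  qed (use zero in auto)
  then show ?thesis
    using zero sem_Imp[OF val graded] sem_Imp[OF val graded(2,1)]
    by (auto simp: Iff_def sem_And[OF val] \<phi> \<psi> ppp perp_in_L[THEN Int_absorb1]
        perp_in_L[THEN Int_absorb2] split: if_splits)
qed

text \<open>If the body is closed in each component, so is the quantified formula.  This lets nested
  quantifiers be evaluated one after the other.\<close>

lemma sem_AllEq_perp:
  assumes "valuation cs qs \<alpha>" "graded_fm \<psi>"
    "y \<notin> set (cs @ qs)" "y' \<notin> set (cs @ qs)" "y \<noteq> y'"
    "snd y' = qdual (snd y)" "one_dimensional (snd y)"
    and S: "\<And>b. b \<in> snd y \<Longrightarrow> S b \<subseteq> L (map \<alpha> qs) [] \<and>
      sem (y # y' # cs) qs (\<alpha>(y' := dual b, y := b)) \<psi> = perp (map \<alpha> qs) (S b)"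
  shows "sem cs qs \<alpha> (AllEq y y' \<psi>) = perp (map \<alpha> qs) (\<Union>b\<in>snd y. S b)"
  unfolding sem_AllEq[OF assms(1-7)] perp_UN using S by (simp add: perp_perp_perp)

context coordinates
begin

lemma sem_eq_quantum:
  assumes val: "valuation [] [y, y'] \<alpha>" and sorts: "snd y = {H}" "snd y' = {dual H}"
  shows "sem [] [y, y'] \<alpha> (Atm (eq_brel {H}) [y, y']) = oper.span {eval_oper H}"
proof -
  have \<alpha>: "\<alpha> y = H" "\<alpha> y' = dual H" and dist: "distinct [y, y']"
    using val sorts by (auto simp: valuation_def)
  have span: "oper.span {eval_oper H} \<subseteq> L [H, dual H] []"
    by (intro oper.span_minimal subspace_L) (simp add: eval_oper_in_L)
  have spaces: "spaces (eq_brel {H}) [H, dual H] [] = oper.span {eval_oper H}"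
    by (simp add: spaces_eq qdual_def)
  have whole: "(\<lambda>j k. if k \<in> basis [H, dual H] then f j (map (assign [y, y'] k \<iota>) [y, y']) else 0) = f"
    if f: "f \<in> L [H, dual H] []" for f \<iota>
  proof (intro ext)
    fix j k
    show "(if k \<in> basis [H, dual H] then f j (map (assign [y, y'] k \<iota>) [y, y']) else 0) = f j k"
      using L_zero[OF f, of j k] map_assign[OF dist, of k \<iota>] length_basis[of k "[H, dual H]"]
      by (cases "k \<in> basis [H, dual H]") (simp_all del: list.map)
  qed
  have "f \<in> sem [] [y, y'] \<alpha> (Atm (eq_brel {H}) [y, y']) \<longleftrightarrow> f \<in> L [H, dual H] [] \<and>
      (\<forall>\<iota>. (\<forall>v\<in>set [y, y']. \<iota> v < hdim (\<alpha> v)) \<longrightarrow> f \<in> oper.span {eval_oper H})" for f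
    using sem_Atm[OF val, of "eq_brel {H}" "[y, y']" f] dist sorts whole[of f] graded_eq[of "{H}"]
    by (auto simp: \<alpha> spaces qdual_def)
  moreover have "\<exists>\<iota>. \<forall>v\<in>set [y, y']. \<iota> v < hdim (\<alpha> v)"
    using pos by (intro exI[of _ "\<lambda>_. 0"]) (simp add: \<alpha>)
  ultimately show ?thesis
    using span by blast
qed

text \<open>Let \<open>S\<close> be the operator with \<open>\<langle>e\<^sub>m, S e\<^sub>k\<rangle> = T k m\<close>.  The conditions on \<open>T\<close> say that \<open>S = S q\<close> and
  \<open>S = p S\<close>, so that \<open>tr S = tr (p S q) = tr (S q p) = 0\<close>.\<close>

lemma trace_zero_of_orthogonal:
  assumes p: "projection p" and q: "projection q" and orth: "\<And>x. q (p x) = 0"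
    and col: "\<And>m. m < hdim H \<Longrightarrow> \<exists>u\<in>range q. \<forall>k<hdim H. T k m = cinner u (e k)"
    and row: "\<And>k. k < hdim H \<Longrightarrow> \<exists>w\<in>range p. \<forall>m<hdim H. T k m = cinner (e m) w"
  shows "(\<Sum>k<hdim H. T k k) = 0"
proof -
  obtain w where w: "\<And>k. k < hdim H \<Longrightarrow> w k \<in> range p"
      "\<And>k m. k < hdim H \<Longrightarrow> m < hdim H \<Longrightarrow> T k m = cinner (e m) (w k)"
    using row by metis
  have T: "T k m = (\<Sum>l<hdim H. T l m * cinner (e l) (q (e k)))" if km: "k < hdim H" "m < hdim H" for k m
  proof -
    obtain u where u: "u \<in> range q" "\<And>k. k < hdim H \<Longrightarrow> T k m = cinner u (e k)"
      using col[OF km(2)] by blast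
    have "q u = u"
      using u(1) projectionD(3)[OF q] by auto
    then have "T k m = cinner u (q (e k))"
      using u(2)[OF km(1)] projectionD(4)[OF q, of u] by simp
    then show ?thesis
      using u(2) by (simp add: parseval[of u "q (e k)"])
  qed
  have "(\<Sum>k<hdim H. T k k) = (\<Sum>k<hdim H. \<Sum>l<hdim H. cinner (q (e l)) (e k) * cinner (e k) (w l))"
  proof (rule sum.cong[OF refl])
    fix k assume "k \<in> {..<hdim H}"
    then show "T k k = (\<Sum>l<hdim H. cinner (q (e l)) (e k) * cinner (e k) (w l))"
      using T[of k k] w(2) projectionD(4)[OF q] by (simp add: mult.commute)
  qed
  also have "\<dots> = (\<Sum>l<hdim H. cinner (q (e l)) (w l))"
    by (subst sum.swap) (simp add: parseval[of "q _" "w _"])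
  also have "\<dots> = 0"
  proof (rule sum.neutral, rule ballI)
    fix l assume "l \<in> {..<hdim H}"
    then have "q (w l) = 0"
      using w(1)[of l] orth by auto
    then show "cinner (q (e l)) (w l) = 0"
      by (simp add: projectionD(4)[OF q])
  qed
  finally show ?thesis .
qed

text \<open>The functionals on \<open>H \<otimes> H\<^sup>*\<close> that correspond to the operators \<open>S = p S q\<close> on \<open>H\<close>, the value on
  \<open>e\<^sub>k \<otimes> e\<^sub>m\<^sup>*\<close> being \<open>\<langle>e\<^sub>m, S e\<^sub>k\<rangle>\<close>.\<close>

definition corner :: "('h \<Rightarrow> 'h) \<Rightarrow> ('h \<Rightarrow> 'h) \<Rightarrow> oper set" where
  "corner p q = {f \<in> L [H, dual H] [].
     (\<forall>m<hdim H. \<exists>u\<in>range q. \<forall>k<hdim H. f [] [k, m] = cinner u (e k)) \<and>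
     (\<forall>k<hdim H. \<exists>w\<in>range p. \<forall>m<hdim H. f [] [k, m] = cinner (e m) w)}"

lemma inner_eval_oper:
  "(\<Sum>i\<in>basis [H, dual H]. cnj (f [] i) * eval_oper H [] i) = cnj (\<Sum>k<hdim H. f [] [k, k])"
proof -
  have "(\<Sum>i\<in>basis [H, dual H]. cnj (f [] i) * eval_oper H [] i) =
      (\<Sum>k<hdim H. \<Sum>m<hdim H. if m = k then cnj (f [] [k, k]) else 0)"
    unfolding sum_basis_Cons by (intro sum.cong) (auto simp: eval_oper_def)
  then show ?thesis
    by simp
qed

text \<open>The inner product with the evaluation functional is the trace, up to conjugation.\<close>

lemma eval_orthogonal_corner_iff:
  assumes p: "projection p" and q: "projection q"
  shows "(\<forall>f\<in>corner p q. (\<Sum>i\<in>basis [H, dual H]. cnj (f [] i) * eval_oper H [] i) = 0) \<longleftrightarrow>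
    (\<forall>x. q (p x) = 0)"
proof
  assume orth: "\<forall>x. q (p x) = 0"
  show "\<forall>f\<in>corner p q. (\<Sum>i\<in>basis [H, dual H]. cnj (f [] i) * eval_oper H [] i) = 0"
  proof
    fix f assume "f \<in> corner p q"
    then have "(\<Sum>k<hdim H. f [] [k, k]) = 0"
      using orth by (intro trace_zero_of_orthogonal[OF p q]) (auto simp: corner_def)
    then show "(\<Sum>i\<in>basis [H, dual H]. cnj (f [] i) * eval_oper H [] i) = 0"
      unfolding inner_eval_oper by simp
  qed
next
  assume zero: "\<forall>f\<in>corner p q. (\<Sum>i\<in>basis [H, dual H]. cnj (f [] i) * eval_oper H [] i) = 0"
  show "\<forall>x. q (p x) = 0"
  proof
    fix x
    have "cinner y (q (p x)) = 0" for y
    proof -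
      \<comment> \<open>the rank-one matrix with trace \<open>\<langle>q y, p x\<rangle>\<close>\<close>
      define f :: oper where "f = (\<lambda>j i. if j = [] \<and> i \<in> basis [H, dual H]
        then cinner (q y) (e (i ! 0)) * cinner (e (i ! 1)) (p x) else 0)"
      have f: "f [] [k, m] = cinner (q y) (e k) * cinner (e m) (p x)" if "k < hdim H" "m < hdim H" for k m
        using that by (simp add: f_def)
      have "f \<in> corner p q"
        unfolding corner_def mem_Collect_eq
      proof (intro conjI allI impI)
        show "f \<in> L [H, dual H] []"
          by (auto simp: f_def L_def)
        fix m assume m: "m < hdim H"
        show "\<exists>u\<in>range q. \<forall>k<hdim H. f [] [k, m] = cinner u (e k)"
          using m f by (intro bexI[OF _ rangeI[of q "scaleC (cnj (cinner (e m) (p x))) y"]])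
            (auto simp: projectionD(2)[OF q] cinner_scaleC_left)
        show "\<exists>w\<in>range p. \<forall>k<hdim H. f [] [m, k] = cinner (e k) w"
          using m f by (intro bexI[OF _ rangeI[of p "scaleC (cinner (q y) (e m)) x"]])
            (auto simp: projectionD(2)[OF p] cinner_scaleC_right)
      qed
      then have "(\<Sum>k<hdim H. f [] [k, k]) = 0"
        using zero unfolding inner_eval_oper complex_cnj_zero_iff by blast
      then show ?thesis
        using f parseval[of "q y" "p x"] by (simp add: projectionD(4)[OF q])
    qed
    then show "q (p x) = 0"
      by (intro cinner_extensionality) simp
  qed
qed

lemma corner_in_L: "corner p q \<subseteq> L [H, dual H] []"
  by (auto simp: corner_def)

text \<open>The evaluation functional corresponds to the identity operator, which is the sum of the \<open>p j\<close>.\<close>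

lemma eval_in_perp_perp_corners:
  fixes p :: "'i \<Rightarrow> 'h \<Rightarrow> 'h"
  assumes "finite B" and p: "\<And>j. j \<in> B \<Longrightarrow> projection (p j)" and sum: "\<And>x. (\<Sum>j\<in>B. p j x) = x"
  shows "eval_oper H \<in> perp [H, dual H] (perp [H, dual H] (\<Union>j\<in>B. corner (p j) (p j)))"
proof -
  let ?W = "\<Union>j\<in>B. corner (p j) (p j)"
  define f :: "'i \<Rightarrow> oper" where "f j = (\<lambda>j' i. if j' = [] \<and> i \<in> basis [H, dual H]
    then cinner (e (i ! 1)) (p j (e (i ! 0))) else 0)" for j
  have f: "f j [] [k, m] = cinner (e m) (p j (e k))" if "k < hdim H" "m < hdim H" for j k m
    using that by (simp add: f_def)
  have fL: "f j \<in> L [H, dual H] []" for j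
    by (auto simp: f_def L_def)
  have "f j \<in> ?W" if j: "j \<in> B" for j
  proof -
    have "\<exists>u\<in>range (p j). \<forall>k<hdim H. f j [] [k, m] = cinner u (e k)" if "m < hdim H" for m
      using that f projectionD(4)[OF p[OF j]] by (intro bexI[OF _ rangeI[of "p j" "e m"]]) auto
    moreover have "\<exists>w\<in>range (p j). \<forall>m<hdim H. f j [] [k, m] = cinner (e m) w" if "k < hdim H" for k
      using that f by (intro bexI[OF _ rangeI[of "p j" "e k"]]) auto
    ultimately show ?thesis
      using fL j by (auto simp: corner_def)
  qed
  moreover have "?W \<subseteq> perp [H, dual H] (perp [H, dual H] ?W)"
    using corner_in_L by (intro subset_perp_perp) blast
  ultimately have "(\<Sum>j\<in>B. f j) \<in> perp [H, dual H] (perp [H, dual H] ?W)"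
    by (intro oper.subspace_sum[OF subspace_perp]) blast
  moreover have "eval_oper H = (\<Sum>j\<in>B. f j)"
  proof (rule L_eqI)
    show "eval_oper H \<in> L [H, dual H] []"
      by (simp add: eval_oper_in_L)
    show "(\<Sum>j\<in>B. f j) \<in> L [H, dual H] []"
      using fL by (intro oper.subspace_sum[OF subspace_L])
    fix j i
    assume "j \<in> basis ([] :: 'l hilb list)" "i \<in> basis [H, dual H]"
    then obtain k m where "j = []" "i = [k, m]" "k < hdim H" "m < hdim H"
      by (auto simp: basis_Cons)
    then show "eval_oper H j i = (\<Sum>j\<in>B. f j) j i"
      using sum[of "e k"] by (auto simp: sum_apply f eval_oper_def cinner_basis simp flip: cinner_sum_right)
  qed
  ultimately show ?thesis
    by simp
qed

text \<open>For the operator \<open>S\<close> of a functional the condition on \<open>x\<close> says that \<open>S = S q\<close> with \<open>q = p (i', j)\<close>,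
  and the condition on the dual variable \<open>x'\<close> that \<open>S = q S\<close> with \<open>q = p (i, j)\<close>.\<close>

lemma slices_corner:
  fixes F :: "'l brel" and p :: "'l \<times> 'l \<Rightarrow> 'h \<Rightarrow> 'h"
  assumes "x \<noteq> x'" and \<alpha>: "\<alpha> x = H" "\<alpha> x' = dual H" "\<alpha> a = dual (Hilb i 1 False)" "\<alpha> a' = Hilb i' 1 False"
    and F: "src F = [{H}, classical A]" "tgt F = [classical B]"
    and ij: "i \<in> A" "i' \<in> A" "j \<in> B"
    and spaces: "\<And>i j. i \<in> A \<Longrightarrow> j \<in> B \<Longrightarrow>
      spaces F [H, Hilb i 1 False] [Hilb j 1 False] = row ` range (p (i, j))"
  shows "slices (conj_brel F) [x, x'] \<alpha> x' a (dual (Hilb j 1 False)) \<inter>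
    slices F [x, x'] \<alpha> x a' (Hilb j 1 False) = corner (p (i, j)) (p (i', j))"
proof -
  let ?pt = "\<lambda>i. Hilb i 1 False :: 'l hilb"
  have conj: "spaces (conj_brel F) [dual H, dual (?pt i)] [dual (?pt j)] = conj_oper ` row ` range (p (i, j))"
  proof -
    have "[dual H, dual (?pt i)] \<in> listset (map qdual (src F))" "[dual (?pt j)] \<in> listset (map qdual (tgt F))"
      using ij by (simp_all add: F classical_def)
    then show ?thesis
      using spaces[OF ij(1,3)] by (simp add: conj_brel_def)
  qed
  have row: "(\<lambda>j' k. if j' = [0] \<and> k \<in> basis [H, ?pt c] then g (hd k) else 0) = row u \<longleftrightarrow>
      (\<forall>k<hdim H. g k = cinner u (e k))" for g c u
  proof
    assume eq: "(\<lambda>j' k. if j' = [0] \<and> k \<in> basis [H, ?pt c] then g (hd k) else 0) = row u"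
    show "\<forall>k<hdim H. g k = cinner u (e k)"
    proof (intro allI impI)
      fix k assume "k < hdim H"
      then show "g k = cinner u (e k)"
        using fun_cong[OF fun_cong[OF eq, of "[0]"], of "[k, 0]"] by (simp add: row_apply)
    qed
  qed (auto simp: fun_eq_iff row_def basis_row)
  have cnj_row: "(\<lambda>j' k. if j' = [0] \<and> k \<in> basis [dual H, dual (?pt c)] then g (hd k) else 0) = conj_oper (row u) \<longleftrightarrow>
      (\<forall>k<hdim H. g k = cinner (e k) u)" for g c u
  proof -
    have "basis [dual H, dual (?pt c)] = basis [H, ?pt c]"
      using basis_map_dual[of "[H, ?pt c]"] by simp
    moreover have "(\<lambda>j' k. if j' = [0] \<and> k \<in> basis [H, ?pt c] then g (hd k) else 0) = conj_oper (row u) \<longleftrightarrow>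
        (\<lambda>j' k. if j' = [0] \<and> k \<in> basis [H, ?pt c] then cnj (g (hd k)) else 0) = row u"
      unfolding conj_oper_apply fun_eq_iff by (metis complex_cnj_cnj complex_cnj_zero)
    moreover have "cnj (g k) = cinner u (e k) \<longleftrightarrow> g k = cinner (e k) u" for k
      by (metis cinner_commute complex_cnj_cnj)
    ultimately show ?thesis
      using row[where g = "\<lambda>k. cnj (g k)"] by simp
  qed
  have all_\<iota>: "(\<forall>\<iota>. (\<forall>v\<in>set [x, x']. \<iota> v < hdim (\<alpha> v)) \<longrightarrow> Q (\<iota> y)) \<longleftrightarrow> (\<forall>m<hdim H. Q m)"
    if "y \<in> {x, x'}" for y Q
  proof (intro iffI allI impI)
    fix m
    assume all: "\<forall>\<iota>. (\<forall>v\<in>set [x, x']. \<iota> v < hdim (\<alpha> v)) \<longrightarrow> Q (\<iota> y)" and "m < hdim H"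
    then show "Q m"
      using all[THEN spec, of "\<lambda>_. m"] \<alpha> by simp
  qed (use that \<alpha> in auto)
  have "(\<lambda>j' k. if j' = [0] \<and> k \<in> basis [\<alpha> x, \<alpha> a'] then f [] (map (\<iota>(x := hd k)) [x, x']) else 0)
      \<in> row ` U \<longleftrightarrow> (\<exists>u\<in>U. \<forall>k<hdim H. f [] [k, \<iota> x'] = cinner u (e k))" for f :: oper and \<iota> U
  proof -
    have map: "map (\<iota>(x := h)) [x, x'] = [h, \<iota> x']" for h
      using \<open>x \<noteq> x'\<close> by simp
    show ?thesis
      unfolding image_iff \<alpha> map row[where g = "\<lambda>h. f [] [h, \<iota> x']"] by (rule refl)
  qed
  then have "f \<in> slices F [x, x'] \<alpha> x a' (?pt j) \<longleftrightarrow> f \<in> L [H, dual H] [] \<and>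
      (\<forall>m<hdim H. \<exists>u\<in>range (p (i', j)). \<forall>k<hdim H. f [] [k, m] = cinner u (e k))" for f
    using all_\<iota>[of x' "\<lambda>m. \<exists>u\<in>range (p (i', j)). \<forall>k<hdim H. f [] [k, m] = cinner u (e k)"]
    unfolding slices_def mem_Collect_eq spaces[OF ij(2,3), folded \<alpha>] by (simp add: \<alpha>)
  moreover have "(\<lambda>j' k. if j' = [0] \<and> k \<in> basis [\<alpha> x', \<alpha> a] then f [] (map (\<iota>(x' := hd k)) [x, x']) else 0)
      \<in> conj_oper ` row ` U \<longleftrightarrow> (\<exists>u\<in>U. \<forall>k<hdim H. f [] [\<iota> x, k] = cinner (e k) u)" for f :: oper and \<iota> U
  proof -
    have map: "map (\<iota>(x' := h)) [x, x'] = [\<iota> x, h]" for h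
      using \<open>x \<noteq> x'\<close> by simp
    show ?thesis
      unfolding image_image image_iff \<alpha> map cnj_row[where g = "\<lambda>h. f [] [\<iota> x, h]"] by (rule refl)
  qed
  then have "f \<in> slices (conj_brel F) [x, x'] \<alpha> x' a (dual (?pt j)) \<longleftrightarrow> f \<in> L [H, dual H] [] \<and>
      (\<forall>k<hdim H. \<exists>w\<in>range (p (i, j)). \<forall>m<hdim H. f [] [k, m] = cinner (e m) w)" for f
    using all_\<iota>[of x "\<lambda>k. \<exists>w\<in>range (p (i, j)). \<forall>m<hdim H. f [] [k, m] = cinner (e m) w"]
    unfolding slices_def mem_Collect_eq conj[folded \<alpha>] by (simp add: \<alpha>)
  ultimately show ?thesis
    by (auto simp: corner_def)
qed

end


context coordinates
begin

text \<open>The sentence holds if and only if the evaluation functional lies in the component of the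
  biconditional for all values \<open>i\<close> of \<open>a1\<close> and \<open>i'\<close> of \<open>a2\<close>.  That component is the complement of
  \<open>?S i i'\<close>, where the double complement of \<open>?W i i'\<close> is the component of
  \<open>F\<^sub>*(x', a1') = F(x, a2)\<close>.\<close>

lemma holds_injectivity_iff:
  fixes F :: "'l brel" and A B :: "'l set" and p :: "'l \<times> 'l \<Rightarrow> 'h \<Rightarrow> 'h"
    and x x' a1 a1' a2 a2' :: "'l var"
  defines "x \<equiv> (0, {H})" and "x' \<equiv> (1, qdual {H})"
    and "a1 \<equiv> (2, classical A)" and "a1' \<equiv> (3, qdual (classical A))"
    and "a2 \<equiv> (4, classical A)" and "a2' \<equiv> (5, qdual (classical A))"
  assumes F: "graded F" "src F = [{H}, classical A]" "tgt F = [classical B]"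
    and p: "\<And>i j. i \<in> A \<Longrightarrow> j \<in> B \<Longrightarrow> projection (p (i, j))"
    and spaces: "\<And>i j. i \<in> A \<Longrightarrow> j \<in> B \<Longrightarrow>
      spaces F [H, Hilb i 1 False] [Hilb j 1 False] = row ` range (p (i, j))"
    and sum: "finite B" "\<And>i v. i \<in> A \<Longrightarrow> (\<Sum>j\<in>B. p (i, j) v) = v"
  shows "holds (AllEq x x' (AllEq a1 a1' (AllEq a2 a2'
      (Iff (Rel 6 (eq_brel (classical A)) [Var a1, Var a2'])
        (Rel 6 (conj_brel (eq_brel (classical B)))
          [App (conj_brel F) [Var x', Var a1'], App F [Var x, Var a2]]))))) \<longleftrightarrow>
    (\<forall>i\<in>A. \<forall>i'\<in>A. i \<noteq> i' \<longrightarrow> (\<forall>j\<in>B. \<forall>v. p (i', j) (p (i, j) v) = 0))"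
proof -
  let ?qs = "[x, x']" and ?cs1 = "[a1, a1']" and ?cs2 = "[a2, a2', a1, a1']"
  let ?pt = "\<lambda>i. Hilb i 1 False :: 'l hilb"
  let ?E = "Atm (eq_brel {H}) [x, x']"
  let ?P = "Atm (eq_brel (classical A)) [a1, a2']"
  let ?Q = "Rel 6 (eq_brel (qdual (classical B))) [App (conj_brel F) [Var x', Var a1'], App F [Var x, Var a2]]"
  let ?\<psi> = "AllEq a1 a1' (AllEq a2 a2' (Iff ?P ?Q))"
  let ?perp = "perp [H, dual H]" and ?L = "L [H, dual H] []"
  let ?W = "\<lambda>i i'. \<Union>j\<in>B. corner (p (i, j)) (p (i', j))"
  let ?S = "\<lambda>i i'. if i = i' then ?perp (?W i i') else ?W i i'"
  have gQ: "graded_fm ?Q" and gP: "graded_fm ?P" and gE: "graded_fm ?E"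
    by (auto intro: graded_fm_Rel(2)[where Y = "qdual (classical B)" and Y' = "classical B"] simp: graded_eq)
  have gI: "graded_fm (Iff ?P ?Q)"
    by (simp add: Iff_def)
  have quantum: "quantum_set {H}" "quantum_set (qdual {H})"
    using pos by (simp_all add: quantum_set_def qdual_def)
  have ptA: "classical A = ?pt ` A" and ptB: "classical B = ?pt ` B"
    by (simp_all add: classical_def)
  have W_L: "?W i i' \<subseteq> ?L" for i i'
    using corner_in_L by blast
  have S_L: "?S i i' \<subseteq> ?L" for i i'
    using W_L by (auto dest: subsetD[OF perp_in_L])
  have eval: "eval_oper H \<in> ?L"
    by (simp add: eval_oper_in_L)
  have main: "sem ?cs2 ?qs \<beta> (Iff ?P ?Q) = ?perp (?S i i')"
    if \<beta>: "valuation ?cs2 ?qs \<beta>"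
      and at: "\<beta> x = H" "\<beta> x' = dual H" "\<beta> a1 = ?pt i" "\<beta> a1' = dual (?pt i)"
        "\<beta> a2 = ?pt i'" "\<beta> a2' = dual (?pt i')"
      and i: "i \<in> A" "i' \<in> A" for \<beta> i i'
  proof -
    have map: "map \<beta> [x, x'] = [H, dual H]"
      using at by simp
    have "sem ?cs2 ?qs \<beta> ?Q = perp (map \<beta> ?qs) (perp (map \<beta> [x, x'])
        (\<Union>b\<in>classical B. slices (conj_brel F) [x, x'] \<beta> x' a1' (dual b) \<inter> slices F [x, x'] \<beta> x a2 b))"
    proof (rule sem_Rel_App_App[OF \<beta>])
      show "graded (conj_brel F)"
        using F(1) by (rule graded_conj)
      show "src (conj_brel F) = [snd x', snd a1']" "tgt (conj_brel F) = [qdual (classical B)]"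
        using F by (simp_all add: conj_brel_def x'_def a1'_def)
    qed (use F in \<open>simp_all add: x_def x'_def a1_def a1'_def a2_def a2'_def\<close>)
    also have "(\<Union>b\<in>classical B. slices (conj_brel F) [x, x'] \<beta> x' a1' (dual b) \<inter>
        slices F [x, x'] \<beta> x a2 b) = ?W i i'"
    proof -
      have "slices (conj_brel F) [x, x'] \<beta> x' a1' (dual (?pt j)) \<inter> slices F [x, x'] \<beta> x a2 (?pt j) =
          corner (p (i, j)) (p (i', j))" if "j \<in> B" for j
        using at i that F spaces by (intro slices_corner) (auto simp: x_def x'_def)
      then show ?thesis
        by (simp add: ptB)
    qed
    finally have Q: "sem ?cs2 ?qs \<beta> ?Q = ?perp (?perp (?W i i'))"
      unfolding map .
    have "dual (?pt i') = dual (?pt i) \<longleftrightarrow> i = i'"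
      by (auto simp: dual_def)
    then have "sem ?cs2 ?qs \<beta> ?P = (if i = i' then ?L else {0})"
      using sem_eq_classical[OF \<beta>, of a1 a2'] at
      by (simp add: a1_def a2'_def a1'_def a2_def)
    then show ?thesis
      using sem_Iff[OF \<beta> gP gQ, of "?W i i'" "i = i'"] Q W_L map by simp
  qed
  have \<psi>: "sem [] ?qs \<alpha> ?\<psi> = ?perp (\<Union>i\<in>A. \<Union>i'\<in>A. ?S i i')"
    if \<alpha>: "valuation [] ?qs \<alpha>" for \<alpha>
  proof -
    have at: "\<alpha> x = H" "\<alpha> x' = dual H"
      using \<alpha> by (simp_all add: valuation_def x_def x'_def qdual_def)
    let ?\<beta> = "\<lambda>i. \<alpha>(a1' := dual (?pt i), a1 := ?pt i)"
    let ?\<gamma> = "\<lambda>i i'. (?\<beta> i)(a2' := dual (?pt i'), a2 := ?pt i')"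
    have val1: "valuation ?cs1 ?qs (?\<beta> i)" if "i \<in> A" for i
      using \<alpha> that by (intro valuation_Cons)
        (auto simp: x_def x'_def a1_def a1'_def classical_def qdual_def one_dimensional_def)
    have val2: "valuation ?cs2 ?qs (?\<gamma> i i')" if "i \<in> A" "i' \<in> A" for i i'
      using that by (intro valuation_Cons val1)
        (auto simp: x_def x'_def a1_def a1'_def a2_def a2'_def classical_def qdual_def one_dimensional_def)
    have inner: "sem ?cs1 ?qs (?\<beta> i) (AllEq a2 a2' (Iff ?P ?Q)) = ?perp (\<Union>i'\<in>A. ?S i i')"
      if i: "i \<in> A" for i
    proof -
      have map: "map (?\<beta> i) [x, x'] = [H, dual H]"
        using at by (simp add: x_def x'_def a1_def a1'_def)
      have "sem ?cs1 ?qs (?\<beta> i) (AllEq a2 a2' (Iff ?P ?Q)) =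
          perp (map (?\<beta> i) ?qs) (\<Union>b\<in>snd a2. ?S i (hlabel b))"
      proof (rule sem_AllEq_perp[OF val1[OF i] gI])
        fix b assume "b \<in> snd a2"
        then obtain i' where i': "b = ?pt i'" "i' \<in> A"
          by (auto simp: a2_def classical_def)
        have "sem ?cs2 ?qs (?\<gamma> i i') (Iff ?P ?Q) = ?perp (?S i i')"
          using at i i' by (intro main val2)
            (simp_all add: x_def x'_def a1_def a1'_def a2_def a2'_def)
        with S_L[of i i'] show "?S i (hlabel b) \<subseteq> L (map (?\<beta> i) ?qs) [] \<and>
            sem ?cs2 ?qs ((?\<beta> i)(a2' := dual b, a2 := b)) (Iff ?P ?Q) =
            perp (map (?\<beta> i) ?qs) (?S i (hlabel b))"
          unfolding map i'(1) hilb.sel by (rule conjI)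
      qed (simp_all add: x_def x'_def a1_def a1'_def a2_def a2'_def)
      also have "(\<Union>b\<in>snd a2. ?S i (hlabel b)) = (\<Union>i'\<in>A. ?S i i')"
        by (simp only: a2_def snd_conv ptA image_image hilb.sel)
      finally show ?thesis
        unfolding map .
    qed
    have map: "map \<alpha> [x, x'] = [H, dual H]"
      using at by simp
    have "sem [] ?qs \<alpha> ?\<psi> = perp (map \<alpha> ?qs) (\<Union>b\<in>snd a1. \<Union>i'\<in>A. ?S (hlabel b) i')"
    proof (rule sem_AllEq_perp[OF \<alpha>])
      fix b assume "b \<in> snd a1"
      then obtain i where i: "b = ?pt i" "i \<in> A"
        by (auto simp: a1_def classical_def)
      have "(\<Union>i'\<in>A. ?S i i') \<subseteq> ?L"
        using S_L by (intro UN_least)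
      then show "(\<Union>i'\<in>A. ?S (hlabel b) i') \<subseteq> L (map \<alpha> ?qs) [] \<and>
          sem ?cs1 ?qs (\<alpha>(a1' := dual b, a1 := b)) (AllEq a2 a2' (Iff ?P ?Q)) =
          perp (map \<alpha> ?qs) (\<Union>i'\<in>A. ?S (hlabel b) i')"
        unfolding map i(1) hilb.sel inner[OF i(2)] by simp
    qed (simp_all add: x_def x'_def a1_def a1'_def)
    also have "(\<Union>b\<in>snd a1. \<Union>i'\<in>A. ?S (hlabel b) i') = (\<Union>i\<in>A. \<Union>i'\<in>A. ?S i i')"
      by (simp only: a1_def snd_conv ptA image_image hilb.sel)
    finally show ?thesis
      unfolding map .
  qed
  have g\<psi>: "graded_fm ?\<psi>" and gImp: "graded_fm (Imp ?E ?\<psi>)"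
    by simp_all
  have "holds (AllEq x x' ?\<psi>) \<longleftrightarrow> interp [x'] (All x (Imp ?E ?\<psi>)) = top_brel (map snd [x']) []"
    unfolding holds_def AllEq_def[of x]
    using interp_All_eq_top[of "All x (Imp ?E ?\<psi>)" x' "[]"] quantum by (simp add: x_def x'_def)
  also have "\<dots> \<longleftrightarrow> interp [x, x'] (Imp ?E ?\<psi>) = top_brel (map snd ?qs) []"
    using interp_All_eq_top[OF gImp, of x "[x']"] quantum by (simp add: x_def x'_def)
  also have "\<dots> \<longleftrightarrow> (\<forall>\<alpha>. valuation [] ?qs \<alpha> \<longrightarrow>
      sem [] ?qs \<alpha> (Imp ?E ?\<psi>) = L (map \<alpha> ?qs) [])"
    using quantum by (intro interp_eq_top_iff[OF gImp]) (auto simp: x_def x'_def)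
  also have "\<dots> \<longleftrightarrow> (\<forall>\<alpha>. valuation [] ?qs \<alpha> \<longrightarrow> eval_oper H \<in> ?perp (\<Union>i\<in>A. \<Union>i'\<in>A. ?S i i'))"
  proof (intro all_cong1 imp_cong refl)
    fix \<alpha> assume \<alpha>: "valuation [] ?qs \<alpha>"
    then have map: "map \<alpha> [x, x'] = [H, dual H]"
      by (simp add: valuation_def x_def x'_def qdual_def)
    have E: "sem [] ?qs \<alpha> ?E = oper.span {eval_oper H}"
      using \<alpha> by (rule sem_eq_quantum) (simp_all add: x_def x'_def qdual_def)
    show "sem [] ?qs \<alpha> (Imp ?E ?\<psi>) = L (map \<alpha> ?qs) [] \<longleftrightarrow>
        eval_oper H \<in> ?perp (\<Union>i\<in>A. \<Union>i'\<in>A. ?S i i')"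
      unfolding sem_Imp[OF \<alpha> gE g\<psi>] map E \<psi>[OF \<alpha>]
      by (rule sasaki_arrow_valid_iff[OF eval subspace_perp perp_in_L])
  qed
  also have "\<dots> \<longleftrightarrow> eval_oper H \<in> ?perp (\<Union>i\<in>A. \<Union>i'\<in>A. ?S i i')"
  proof -
    have "valuation [] ?qs (\<lambda>v. if v = x then H else dual H)"
      using quantum by (simp add: valuation_def x_def x'_def qdual_def)
    then show ?thesis
      by blast
  qed
  also have "\<dots> \<longleftrightarrow> (\<forall>i\<in>A. \<forall>i'\<in>A. eval_oper H \<in> ?perp (?S i i'))"
    unfolding perp_UN using eval by auto
  also have "\<dots> \<longleftrightarrow> (\<forall>i\<in>A. \<forall>i'\<in>A. i \<noteq> i' \<longrightarrow> (\<forall>j\<in>B. \<forall>v. p (i', j) (p (i, j) v) = 0))"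
  proof (intro ball_cong refl)
    fix i i' assume i: "i \<in> A" "i' \<in> A"
    show "eval_oper H \<in> ?perp (?S i i') \<longleftrightarrow> (i \<noteq> i' \<longrightarrow> (\<forall>j\<in>B. \<forall>v. p (i', j) (p (i, j) v) = 0))"
    proof (cases "i = i'")
      case True
      then show ?thesis
        using eval_in_perp_perp_corners[OF sum(1), of "\<lambda>j. p (i, j)"] p sum(2) i by simp
    next
      case False
      have "eval_oper H \<in> ?perp (corner (p (i, j)) (p (i', j))) \<longleftrightarrow> (\<forall>v. p (i', j) (p (i, j) v) = 0)"
        if "j \<in> B" for j
        using eval_orthogonal_corner_iff[OF p[OF i(1) that] p[OF i(2) that]] eval
        by (simp add: perp_def)
      then show ?thesis
        using False eval by (simp add: perp_UN)
    qed
  qed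
  finally show ?thesis
    using Rel_vars[of 6 "eq_brel (classical A)" "[a1, a2']"] by (simp add: conj_eq_brel)
qed


section \<open>Functions and families of projections\<close>

lemma mult_row_adj:
  assumes "hdim C = 1"
  shows "mult [H, C] (row u) (adj (row v)) = (\<lambda>j i. if j = [0] \<and> i = [0] then cinner u v else 0)"
proof (intro ext)
  fix j i
  have "mult [H, C] (row u) (adj (row v)) j i =
      (\<Sum>k<hdim H. if j = [0] \<and> i = [0] then cinner u (e k) * cinner (e k) v else 0)"
    unfolding mult_def sum_basis_Cons using assms cinner_commute[of v]
    by (intro sum.cong) (auto simp: adj_def row_def)
  then show "mult [H, C] (row u) (adj (row v)) j i = (if j = [0] \<and> i = [0] then cinner u v else 0)"
    by (auto simp: parseval[of u v] intro: sum.neutral)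
qed

lemma mult_adj_row:
  assumes "hdim D = 1" "k < hdim H" "m < hdim H"
  shows "mult [D] (adj (row u)) (row v) [k, 0] [m, 0] = cinner (e k) u * cinner v (e m)"
  using assms cinner_commute[of "e k" u] by (simp add: mult_def sum_basis_Cons adj_def row_apply)

lemma graded_family_function:
  assumes "\<And>a b. a \<in> A \<Longrightarrow> b \<in> B \<Longrightarrow> projection (p (a, b))"
  shows "graded (family_function H e A B p)"
  unfolding graded_def
proof (intro allI)
  fix xs ys
  let ?V = "spaces (family_function H e A B p) xs ys"
  show "oper.subspace ?V \<and> ?V \<subseteq> L xs ys \<and>
      (xs \<notin> listset (src (family_function H e A B p)) \<or> ys \<notin> listset (tgt (family_function H e A B p)) \<longrightarrow> ?V = {0})"
  proof (cases "xs \<in> listset [{H}, classical A] \<and> ys \<in> listset [classical B]")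
    case True
    then obtain a b where ab: "xs = [H, Hilb a 1 False]" "ys = [Hilb b 1 False]" "a \<in> A" "b \<in> B"
      by (auto simp: classical_def)
    have V: "?V = row ` range (p (a, b))"
      unfolding ab(1,2) using assms ab by (intro spaces_family_function) auto
    note pab = assms[OF ab(3,4)]
    have "oper.subspace (row ` range (p (a, b)))"
    proof (rule oper.subspaceI)
      show "0 \<in> row ` range (p (a, b))"
        using projection_zero[OF pab] row_linear(3) by (metis imageI rangeI)
      show "s + t \<in> row ` range (p (a, b))" if "s \<in> row ` range (p (a, b))" "t \<in> row ` range (p (a, b))" for s t
        using that by (auto simp flip: row_linear projectionD(1)[OF pab])
      show "scale_oper c s \<in> row ` range (p (a, b))" if s: "s \<in> row ` range (p (a, b))" for c s
      proof -
        obtain u where "s = row (p (a, b) u)"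
          using s by auto
        then have "scale_oper c s = row (p (a, b) (scaleC (cnj c) u))"
          by (simp add: projectionD(2)[OF pab] row_linear)
        then show ?thesis
          by blast
      qed
    qed
    then show ?thesis
      using True row_in_L unfolding V by (auto simp: family_function_def ab)
  next
    case False
    then have "?V = {0}"
      by (auto simp: family_function_def brel_of_def)
    then show ?thesis
      by (simp add: subspace_zero)
  qed
qed

end


context coordinates
begin

text \<open>Each \<open>p (a, b)\<close> is the sum over \<open>k\<close> of \<open>r\<^sup>\<dagger> r\<close> with \<open>r = \<langle>p (a, b) e\<^sub>k, -\<rangle>\<close>, so that the identity is
  in \<open>F\<^sup>\<dagger> \<circ> F\<close>; the other inequality is the orthogonality of the projections in a row.\<close>

lemma is_function_family_function:
  fixes p :: "'l \<times> 'l \<Rightarrow> 'h \<Rightarrow> 'h"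
  assumes p: "\<And>a b. a \<in> A \<Longrightarrow> b \<in> B \<Longrightarrow> projection (p (a, b))" and "finite B"
    and sum: "\<And>a v. a \<in> A \<Longrightarrow> (\<Sum>b\<in>B. p (a, b) v) = v"
  shows "is_function (family_function H e A B p)"
proof -
  let ?F = "family_function H e A B p" and ?pt = "\<lambda>i. Hilb i 1 False :: 'l hilb"
  have F: "graded ?F" "src ?F = [{H}, classical A]" "tgt ?F = [classical B]"
    using p by (simp_all add: graded_family_function) (simp_all add: family_function_def)
  note spaces = spaces_family_function[of p _ _ A B, OF p]
  have graded: "graded (comp_brel (adj_brel ?F) ?F)" "graded (comp_brel ?F (adj_brel ?F))"
    using F(1) by (simp_all add: graded_comp graded_adj)
  have ids: "spaces (id_brel (src ?F)) xs ys \<subseteq> spaces (comp_brel (adj_brel ?F) ?F) xs ys" for xs ys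
  proof (cases "xs \<in> listset (src ?F) \<and> ys = xs")
    case False
    then have "spaces (id_brel (src ?F)) xs ys = {0}"
      by (auto simp: id_brel_def brel_of_def)
    then show ?thesis
      using oper.subspace_0[OF graded_subspace[OF graded(1)]] by simp
  next
    case True
    then obtain a where a: "xs = [H, ?pt a]" "a \<in> A"
      by (auto simp: F classical_def)
    let ?V = "spaces (comp_brel (adj_brel ?F) ?F) xs xs"
    let ?t = "\<lambda>b k. mult [?pt b] (adj (row (p (a, b) (e k)))) (row (p (a, b) (e k)))"
    have t: "?t b k \<in> ?V" if b: "b \<in> B" for b k
    proof -
      have ptb: "[?pt b] \<in> listset [classical B]" and xs: "xs \<in> listset [{H}, classical A]"
        using b a by (simp_all add: classical_def)
      have r: "row (p (a, b) (e k)) \<in> spaces ?F xs [?pt b]"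
        unfolding a spaces[OF a(2) b a(2) b] by blast
      then have s: "adj (row (p (a, b) (e k))) \<in> spaces (adj_brel ?F) [?pt b] xs"
        using ptb xs by (simp add: adj_brel_def F)
      have "?t b k \<in> {mult ys s r |ys s r. ys \<in> listset (tgt ?F) \<and>
          s \<in> spaces (adj_brel ?F) ys xs \<and> r \<in> spaces ?F xs ys}"
        using r s ptb F(3) by (intro CollectI exI conjI refl) simp_all
      then show ?thesis
        using xs by (simp add: comp_brel_def F adj_brel_def oper.span_base)
    qed
    have "id_oper xs = (\<Sum>b\<in>B. \<Sum>k<hdim H. ?t b k)"
    proof (rule L_eqI[of _ xs xs])
      show "id_oper xs \<in> L xs xs"
        by (rule id_oper_in_L)
      show "(\<Sum>b\<in>B. \<Sum>k<hdim H. ?t b k) \<in> L xs xs"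
        using t graded_in_L[OF graded(1)] by (intro oper.subspace_sum[OF subspace_L]) blast
      fix j i assume "j \<in> basis xs" "i \<in> basis xs"
      then obtain m m' where m: "j = [m, 0]" "i = [m', 0]" "m < hdim H" "m' < hdim H"
        by (auto simp: a basis_row)
      have "(\<Sum>b\<in>B. \<Sum>k<hdim H. ?t b k) j i =
          (\<Sum>b\<in>B. \<Sum>k<hdim H. cinner (e m) (p (a, b) (e k)) * cinner (p (a, b) (e k)) (e m'))"
        using m by (simp add: sum_apply mult_adj_row del: One_nat_def)
      also have "\<dots> = (\<Sum>b\<in>B. cinner (e m) (p (a, b) (e m')))"
      proof (rule sum.cong[OF refl])
        fix b assume b: "b \<in> B"
        note pab = projectionD(3,4)[OF p[OF a(2) b]]
        have "(\<Sum>k<hdim H. cinner (e m) (p (a, b) (e k)) * cinner (p (a, b) (e k)) (e m')) =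
            (\<Sum>k<hdim H. cinner (p (a, b) (e m)) (e k) * cinner (e k) (p (a, b) (e m')))"
          by (simp add: pab)
        also have "\<dots> = cinner (e m) (p (a, b) (e m'))"
          using parseval[of "p (a, b) (e m)" "p (a, b) (e m')"] by (simp add: pab)
        finally show "(\<Sum>k<hdim H. cinner (e m) (p (a, b) (e k)) * cinner (p (a, b) (e k)) (e m')) =
            cinner (e m) (p (a, b) (e m'))" .
      qed
      also have "\<dots> = cinner (e m) (e m')"
        using sum[OF a(2)] by (simp flip: cinner_sum_right)
      finally show "id_oper xs j i = (\<Sum>b\<in>B. \<Sum>k<hdim H. ?t b k) j i"
        using m by (simp add: cinner_basis id_oper_def a)
    qed
    also have "\<dots> \<in> ?V"
      using t by (intro oper.subspace_sum[OF graded_subspace[OF graded(1)]])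
    finally have "oper.span {id_oper xs} \<subseteq> ?V"
      by (intro oper.span_minimal graded_subspace[OF graded(1)]) simp
    then show ?thesis
      using True by (simp add: id_brel_def)
  qed
  have coids: "spaces (comp_brel ?F (adj_brel ?F)) ys zs \<subseteq> spaces (id_brel (tgt ?F)) ys zs" for ys zs
  proof (cases "ys \<in> listset (tgt ?F) \<and> zs \<in> listset (tgt ?F)")
    case False
    then have "spaces (comp_brel ?F (adj_brel ?F)) ys zs = {0}"
      by (auto simp: comp_brel_def adj_brel_def brel_of_def)
    then show ?thesis
      using oper.subspace_0[OF graded_subspace[OF graded_id]] by simp
  next
    case True
    then obtain b b' where b: "ys = [?pt b]" "zs = [?pt b']" "b \<in> B" "b' \<in> B"
      by (auto simp: F classical_def)
    have "mult xs r s \<in> spaces (id_brel (tgt ?F)) ys zs"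
      if xs: "xs \<in> listset (src ?F)" and r: "r \<in> spaces ?F xs zs" and s: "s \<in> spaces (adj_brel ?F) ys xs"
      for xs r s
    proof -
      obtain a where a: "xs = [H, ?pt a]" "a \<in> A"
        using xs by (auto simp: F classical_def)
      obtain u where u: "r = row (p (a, b') u)"
        using r unfolding a b spaces[OF a(2) b(4) a(2) b(4)] by auto
      have "s \<in> adj ` spaces ?F xs ys"
        using s xs True by (simp add: adj_brel_def)
      then obtain v where v: "s = adj (row (p (a, b) v))"
        unfolding a b spaces[OF a(2) b(3) a(2) b(3)] by auto
      have m: "mult xs r s = (\<lambda>j i. if j = [0] \<and> i = [0] then cinner (p (a, b') u) (p (a, b) v) else 0)"
        unfolding a u v by (rule mult_row_adj) simp
      show ?thesis
      proof (cases "b = b'")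
        case True
        have "mult xs r s = scale_oper (cinner (p (a, b') u) (p (a, b) v)) (id_oper ys)"
          unfolding m b by (auto simp: scale_oper_def id_oper_def basis_one fun_eq_iff)
        then show ?thesis
          using True \<open>ys \<in> _ \<and> zs \<in> _\<close> b by (simp add: id_brel_def oper.span_base oper.span_scale)
      next
        case False
        have "p (a, b') (p (a, b) v) = 0"
          using assms(2) p sum a(2) b False
          by (intro projections_sum_orthogonal[of B "\<lambda>b. p (a, b)"]) auto
        then have "cinner (p (a, b') u) (p (a, b) v) = 0"
          using projectionD(4)[OF p[OF a(2) b(4)]] by simp
        then have "mult xs r s = 0"
          unfolding m by (auto simp: fun_eq_iff)
        then show ?thesis
          using oper.subspace_0[OF graded_subspace[OF graded_id]] by simp
      qed
    qed
    then have "oper.span {mult xs r s |xs r s. xs \<in> listset (tgt (adj_brel ?F)) \<and>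
        r \<in> spaces ?F xs zs \<and> s \<in> spaces (adj_brel ?F) ys xs} \<subseteq> spaces (id_brel (tgt ?F)) ys zs"
      by (intro oper.span_minimal graded_subspace[OF graded_id]) (auto simp: adj_brel_def)
    then show ?thesis
      using True by (simp add: comp_brel_def adj_brel_def)
  qed
  have "quantum_set {H}" "quantum_set (classical C)" for C :: "'l set"
    using pos by (simp_all add: quantum_set_def classical_def)
  then have "is_brel ?F"
    using F by (simp add: is_brel_iff)
  then show ?thesis
    using ids coids by (auto simp: is_function_def brel_le_def id_brel_def comp_brel_def adj_brel_def)
qed

text \<open>For a function \<open>F\<close> and a fixed \<open>a\<close> the components \<open>F(H \<otimes> \<complex>\<^sub>a, \<complex>\<^sub>b)\<close> are pairwise
  orthogonal by \<open>F \<circ> F\<^sup>\<dagger> \<le> I\<close> and span \<open>H\<^sup>*\<close> by \<open>F\<^sup>\<dagger> \<circ> F \<ge> I\<close>.\<close>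

lemma projections_of_function:
  fixes F :: "'l brel"
  assumes F: "is_function F" "src F = [{H}, classical A]" "tgt F = [classical B]"
    and "finite B" and a: "a \<in> A"
  shows "\<exists>q. (\<forall>b\<in>B. projection (q b) \<and>
      spaces F [H, Hilb a 1 False] [Hilb b 1 False] = row ` range (q b)) \<and> (\<forall>v. (\<Sum>b\<in>B. q b v) = v)"
proof -
  let ?pt = "\<lambda>i. Hilb i 1 False :: 'l hilb"
  let ?xs = "[H, ?pt a]"
  have graded: "graded F"
    using F by (simp add: is_function_def is_brel_iff)
  define U where "U b = {u. row u \<in> spaces F ?xs [?pt b]}" for b
  note sub = graded_subspace[OF graded, of ?xs]
  have xs: "?xs \<in> listset [{H}, classical A]" and ptb: "\<And>b. b \<in> B \<Longrightarrow> [?pt b] \<in> listset [classical B]"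
    using a by (simp_all add: classical_def)
  have spaces: "spaces F ?xs [?pt b] = row ` U b" if "b \<in> B" for b
  proof -
    have "f \<in> row ` U b" if f: "f \<in> spaces F ?xs [?pt b]" for f
    proof -
      obtain u where "f = row u"
        using graded_in_L[OF graded f] by (rule rowE) simp_all
      then show ?thesis
        using f by (auto simp: U_def)
    qed
    then show ?thesis
      by (auto simp: U_def)
  qed
  have U: "0 \<in> U b" "u \<in> U b \<Longrightarrow> v \<in> U b \<Longrightarrow> u + v \<in> U b" "u \<in> U b \<Longrightarrow> scaleC c u \<in> U b" for b c u v
    using sub[of "[?pt b]"] by (simp_all add: U_def row_linear oper.subspace_0 oper.subspace_add oper.subspace_scale)
  have orth: "cinner u v = 0" if b: "b \<in> B" "b' \<in> B" "b \<noteq> b'" and uv: "u \<in> U b" "v \<in> U b'" for b b' u v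
  proof -
    have "row u \<in> spaces F ?xs [?pt b]" "adj (row v) \<in> spaces (adj_brel F) [?pt b'] ?xs"
      using uv xs ptb b F by (auto simp: U_def adj_brel_def)
    then have "mult ?xs (row u) (adj (row v)) \<in> {mult xs r s |xs r s. xs \<in> listset (tgt (adj_brel F)) \<and>
        r \<in> spaces F xs [?pt b] \<and> s \<in> spaces (adj_brel F) [?pt b'] xs}"
      using xs F by (simp add: adj_brel_def) blast
    then have "mult ?xs (row u) (adj (row v)) \<in> spaces (comp_brel F (adj_brel F)) [?pt b'] [?pt b]"
      using ptb b F by (simp add: comp_brel_def adj_brel_def oper.span_base)
    then have "mult ?xs (row u) (adj (row v)) \<in> spaces (id_brel (tgt F)) [?pt b'] [?pt b]"
      using F(1) unfolding is_function_def brel_le_def by blast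
    then have "mult ?xs (row u) (adj (row v)) = 0"
      using b ptb F by (auto simp: id_brel_def)
    then have "mult ?xs (row u) (adj (row v)) [0] [0] = 0"
      by simp
    then show ?thesis
      by (subst (asm) mult_row_adj) simp_all
  qed
  define D where "D = {x. \<exists>u. (\<forall>b\<in>B. u b \<in> U b) \<and> x = (\<Sum>b\<in>B. u b)}"
  have D: "cvec.subspace D"
  proof (rule cvec.subspaceI)
    show "0 \<in> D"
      unfolding D_def mem_Collect_eq using U by (intro exI[of _ "\<lambda>_. 0"]) simp
  next
    fix x y assume "x \<in> D" "y \<in> D"
    then obtain u v where "\<forall>b\<in>B. u b \<in> U b" "x = (\<Sum>b\<in>B. u b)" "\<forall>b\<in>B. v b \<in> U b" "y = (\<Sum>b\<in>B. v b)"
      unfolding D_def by blast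
    then show "x + y \<in> D"
      unfolding D_def mem_Collect_eq using U by (intro exI[of _ "\<lambda>b. u b + v b"]) (simp add: sum.distrib)
  next
    fix c x assume "x \<in> D"
    then obtain u where "\<forall>b\<in>B. u b \<in> U b" "x = (\<Sum>b\<in>B. u b)"
      unfolding D_def by blast
    then show "scaleC c x \<in> D"
      unfolding D_def mem_Collect_eq using U by (intro exI[of _ "\<lambda>b. scaleC c (u b)"]) (simp add: cvec.scale_sum_right)
  qed
  have U_D: "u \<in> D" if "b \<in> B" "u \<in> U b" for b u
    unfolding D_def mem_Collect_eq using that U \<open>finite B\<close>
    by (intro exI[of _ "\<lambda>b'. if b' = b then u else 0"]) simp
  \<comment> \<open>the columns of an operator, read as vectors\<close>
  define col where "col t m' = (\<Sum>m<hdim H. scaleC (t [m, 0] [m', 0]) (e m))" for t :: oper and m'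
  let ?gen = "{mult ys s r |ys s r. ys \<in> listset (tgt F) \<and> s \<in> spaces (adj_brel F) ys ?xs \<and> r \<in> spaces F ?xs ys}"
  have "id_oper ?xs \<in> spaces (id_brel (src F)) ?xs ?xs"
    using xs F by (simp add: id_brel_def oper.span_base)
  then have "id_oper ?xs \<in> spaces (comp_brel (adj_brel F) F) ?xs ?xs"
    using F(1) unfolding is_function_def brel_le_def by blast
  then have "id_oper ?xs \<in> oper.span ?gen"
    using xs F by (simp add: comp_brel_def adj_brel_def)
  moreover have "oper.span ?gen \<subseteq> {t. \<forall>m'<hdim H. col t m' \<in> D}"
  proof (rule oper.span_minimal)
    show "?gen \<subseteq> {t. \<forall>m'<hdim H. col t m' \<in> D}"
    proof clarify
      fix ys s r m'
      assume ys: "ys \<in> listset (tgt F)" and s: "s \<in> spaces (adj_brel F) ys ?xs"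
        and r: "r \<in> spaces F ?xs ys" and m': "m' < hdim H"
      obtain b where b: "ys = [?pt b]" "b \<in> B"
        using ys by (auto simp: F classical_def)
      obtain v where v: "r = row v"
        using r spaces[OF b(2)] b(1) by auto
      have "s \<in> adj ` spaces F ?xs ys"
        using s ys xs F by (simp add: adj_brel_def)
      then obtain u where u: "s = adj (row u)" "u \<in> U b"
        using spaces[OF b(2)] b(1) by auto
      have "col (mult ys s r) m' = (\<Sum>m<hdim H. scaleC (cinner (e m) u * cinner v (e m')) (e m))"
        unfolding col_def b u v using m' by (intro sum.cong refl) (simp add: mult_adj_row del: One_nat_def)
      also have "\<dots> = scaleC (cinner v (e m')) (\<Sum>m<hdim H. scaleC (cinner (e m) u) (e m))"
        by (simp add: cvec.scale_sum_right mult.commute)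
      also have "\<dots> = scaleC (cinner v (e m')) u"
        by (simp flip: expansion)
      finally show "col (mult ys s r) m' \<in> D"
        using U_D[OF b(2)] U(3)[OF u(2)] by simp
    qed
    have "col 0 m' = 0" "col (s + t) m' = col s m' + col t m'" "col (scale_oper c t) m' = scaleC c (col t m')" for s t c m'
      by (simp_all add: col_def scale_oper_apply cvec.scale_left_distrib sum.distrib cvec.scale_sum_right)
    then show "oper.subspace {t. \<forall>m'<hdim H. col t m' \<in> D}"
      using D by (simp add: oper.subspace_def cvec.subspace_def)
  qed
  moreover have "col (id_oper ?xs) m' = e m'" if "m' < hdim H" for m'
  proof -
    have "col (id_oper ?xs) m' = (\<Sum>m<hdim H. if m = m' then e m' else 0)"
      unfolding col_def using that by (intro sum.cong) (auto simp: id_oper_def)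
    then show ?thesis
      using that by simp
  qed
  ultimately have "e ` {..<hdim H} \<subseteq> D"
    by fastforce
  then have "cvec.span (e ` {..<hdim H}) \<subseteq> D"
    using D by (rule cvec.span_minimal)
  then have "x \<in> D" for x
    using onb by (auto simp: orthonormal_basis_def)
  then have "\<exists>u. (\<forall>b\<in>B. u b \<in> U b) \<and> x = (\<Sum>b\<in>B. u b)" for x
    unfolding D_def by blast
  with \<open>finite B\<close> U orth
  have "\<exists>q. (\<forall>b\<in>B. projection (q b) \<and> range (q b) = U b) \<and> (\<forall>v. (\<Sum>b\<in>B. q b v) = v)"
    by (intro projections_of_orthogonal_decomposition) auto
  then obtain q where "\<forall>b\<in>B. projection (q b) \<and> range (q b) = U b" "\<forall>v. (\<Sum>b\<in>B. q b v) = v"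
    by blast
  then show ?thesis
    using spaces by (intro exI[of _ q]) simp
qed

lemma bij_betw_family_function:
  fixes A B :: "'l set"
  assumes "finite B"
  shows "bij_betw (family_function H e A B) (row_families A B)
    {F. is_function F \<and> src F = [{H}, classical A] \<and> tgt F = [classical B]}"
  unfolding bij_betw_def
proof (intro conjI inj_onI equalityI subsetI)
  fix p q :: "'l \<times> 'l \<Rightarrow> 'h \<Rightarrow> 'h"
  assume p: "p \<in> row_families A B" and q: "q \<in> row_families A B"
    and eq: "family_function H e A B p = family_function H e A B q"
  have pe: "p \<in> (A \<times> B) \<rightarrow>\<^sub>E {q. projection q}" and qe: "q \<in> (A \<times> B) \<rightarrow>\<^sub>E {q. projection q}"
    using p q by (simp_all add: row_families_def)
  show "p = q"
  proof (rule PiE_ext[OF pe qe])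
    fix ab assume "ab \<in> A \<times> B"
    then obtain a b where ab: "ab = (a, b)" "a \<in> A" "b \<in> B"
      by auto
    have proj: "projection (p (a, b))" "projection (q (a, b))"
      using pe qe ab by (auto dest: PiE_mem)
    have "row ` range (p (a, b)) = row ` range (q (a, b))"
      using spaces_family_function[of p a b A B, OF proj(1) ab(2,3)]
        spaces_family_function[of q a b A B, OF proj(2) ab(2,3)] eq by simp
    then have "range (p (a, b)) = range (q (a, b))"
      by (simp add: inj_image_eq_iff inj_def)
    then show "p ab = q ab"
      using projection_eq_of_range_eq[OF proj] ab by simp
  qed
next
  fix F assume "F \<in> family_function H e A B ` row_families A B"
  then obtain p :: "'l \<times> 'l \<Rightarrow> 'h \<Rightarrow> 'h" where p: "p \<in> row_families A B" "F = family_function H e A B p"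
    by blast
  then have "is_function F"
    unfolding p(2) using assms
    by (intro is_function_family_function) (auto simp: row_families_def fun_eq_iff dest: PiE_mem)
  then show "F \<in> {F. is_function F \<and> src F = [{H}, classical A] \<and> tgt F = [classical B]}"
    by (simp add: p(2) family_function_def)
next
  fix F :: "'l brel" assume "F \<in> {F. is_function F \<and> src F = [{H}, classical A] \<and> tgt F = [classical B]}"
  then have F: "is_function F" "src F = [{H}, classical A]" "tgt F = [classical B]"
    by auto
  then obtain q where q: "\<And>a b. a \<in> A \<Longrightarrow> b \<in> B \<Longrightarrow> projection (q a b)"
      "\<And>a b. a \<in> A \<Longrightarrow> b \<in> B \<Longrightarrow>
        spaces F [H, Hilb a 1 False] [Hilb b 1 False] = row ` range (q a b)"
      "\<And>a v. a \<in> A \<Longrightarrow> (\<Sum>b\<in>B. q a b v) = v"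
    using projections_of_function[OF F assms] by metis
  define p where "p = restrict (\<lambda>(a, b). q a b) (A \<times> B)"
  have p: "p \<in> row_families A B"
    using q by (auto simp: row_families_def p_def fun_eq_iff)
  have "F = family_function H e A B p"
  proof (rule brel_eqI)
    show "graded F"
      using F by (simp add: is_function_def is_brel_iff)
    show "graded (family_function H e A B p)"
      using q by (intro graded_family_function) (simp add: p_def)
    fix xs ys
    assume "xs \<in> listset (src (family_function H e A B p))" "ys \<in> listset (tgt (family_function H e A B p))"
    then obtain a b where ab: "xs = [H, Hilb a 1 False]" "ys = [Hilb b 1 False]" "a \<in> A" "b \<in> B"
      by (auto simp: family_function_def classical_def)
    have pq: "p (a, b) = q a b"
      using ab by (simp add: p_def)
    show "spaces F xs ys = spaces (family_function H e A B p) xs ys"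
      unfolding ab(1,2) using spaces_family_function[of p a b A B] q ab pq by simp
  qed (simp_all add: F family_function_def)
  then show "F \<in> family_function H e A B ` row_families A B"
    using p by blast
qed

text \<open>The ranges of the \<open>p (a, b)\<close> with \<open>b\<close> fixed are an orthogonal decomposition if and only if
  they are pairwise orthogonal and no vector is orthogonal to all of them.\<close>

lemma magic_unitary_iff:
  fixes p :: "'l \<times> 'l \<Rightarrow> 'h \<Rightarrow> 'h"
  assumes "finite A" and p: "p \<in> row_families A B"
  shows "p \<in> magic_unitaries A B \<longleftrightarrow>
    (\<forall>j\<in>B. \<forall>v. (\<forall>i\<in>A. p (i, j) v = 0) \<longrightarrow> v = 0) \<and>
    (\<forall>i\<in>A. \<forall>i'\<in>A. i \<noteq> i' \<longrightarrow> (\<forall>j\<in>B. \<forall>v. p (i', j) (p (i, j) v) = 0))" (is "_ \<longleftrightarrow> ?faithful \<and> ?orth")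
proof -
  have proj: "projection (p (i, j))" if "i \<in> A" "j \<in> B" for i j
    using p that by (auto simp: row_families_def dest: PiE_mem)
  have "p \<in> magic_unitaries A B \<longleftrightarrow> (\<forall>j\<in>B. \<forall>v. (\<Sum>i\<in>A. p (i, j) v) = v)"
    using p by (auto simp: row_families_def magic_unitaries_def fun_eq_iff)
  also have "\<dots> \<longleftrightarrow> ?faithful \<and> ?orth"
  proof (intro iffI conjI)
    assume sum: "\<forall>j\<in>B. \<forall>v. (\<Sum>i\<in>A. p (i, j) v) = v"
    show ?faithful
    proof (intro ballI allI impI)
      fix j v assume "j \<in> B" "\<forall>i\<in>A. p (i, j) v = 0"
      then have "v = (\<Sum>i\<in>A. p (i, j) v)"
        using sum[rule_format, of j v] by simp
      also have "\<dots> = 0"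
        using \<open>\<forall>i\<in>A. p (i, j) v = 0\<close> by simp
      finally show "v = 0" .
    qed
    show ?orth
    proof (intro ballI impI allI)
      fix i i' j v assume "i \<in> A" "i' \<in> A" "i \<noteq> i'" "j \<in> B"
      then show "p (i', j) (p (i, j) v) = 0"
        using sum proj \<open>finite A\<close> by (intro projections_sum_orthogonal[of A "\<lambda>i. p (i, j)"]) auto
    qed
  next
    assume fo: "?faithful \<and> ?orth"
    show "\<forall>j\<in>B. \<forall>v. (\<Sum>i\<in>A. p (i, j) v) = v"
    proof (intro ballI allI)
      fix j v assume j: "j \<in> B"
      let ?s = "\<Sum>i\<in>A. p (i, j) v"
      have "p (i', j) (v - ?s) = 0" if i': "i' \<in> A" for i'
      proof -
        note pij = projectionD[OF proj[OF i' j]]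
        have "p (i', j) ?s = (\<Sum>i\<in>A. p (i', j) (p (i, j) v))"
          by (rule projection_sum[OF proj[OF i' j]])
        also have "\<dots> = (\<Sum>i\<in>A. if i = i' then p (i', j) v else 0)"
          using fo i' j pij(3) by (intro sum.cong) auto
        also have "\<dots> = p (i', j) v"
          using i' \<open>finite A\<close> by simp
        finally have "p (i', j) ?s = p (i', j) v" .
        moreover have "p (i', j) v = p (i', j) (v - ?s) + p (i', j) ?s"
          by (simp flip: pij(1))
        ultimately show ?thesis
          by simp
      qed
      then have "v - ?s = 0"
        using fo j by blast
      then show "?s = v"
        by simp
    qed
  qed
  finally show ?thesis .
qed

end

theorem corollary4p6p10:
  fixes A B :: "'l set"
    and e :: "nat \<Rightarrow> 'h::fd_hilbert"
    and n :: nat and l :: 'l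
    and H :: "'l hilb" and X qA qB :: "'l qset"
    and \<Phi> :: "('l \<times> 'l \<Rightarrow> 'h \<Rightarrow> 'h) \<Rightarrow> 'l brel"
    and \<F> :: "'l brel set"
    and \<sigma>\<^sub>1 \<sigma>\<^sub>2 :: "'l brel \<Rightarrow> 'l fm"
  assumes "finite A" and "finite B"
    and "\<exists>v::'h. v \<noteq> 0"
    and "orthonormal_basis n e"
  defines "H \<equiv> Hilb l n False" and "X \<equiv> {H}"
    and "qA \<equiv> classical A" and "qB \<equiv> classical B"
    and "\<Phi> \<equiv> family_function H e A B"
    and "\<F> \<equiv> {F. is_function F \<and> src F = [X, qA] \<and> tgt F = [qB]}"
    and "\<sigma>\<^sub>1 \<equiv> (\<lambda>F. let x = (0, X); b' = (1, qdual qB); a = (2, qA) in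
           All x (All b' (Ex a (Rel 3 (eq_brel qB) [App F [Var x, Var a], Var b']))))"
    and "\<sigma>\<^sub>2 \<equiv> (\<lambda>F. let x = (0, X); x' = (1, qdual X);
             a1 = (2, qA); a1' = (3, qdual qA); a2 = (4, qA); a2' = (5, qdual qA) in
           AllEq x x' (AllEq a1 a1' (AllEq a2 a2'
             (Iff (Rel 6 (eq_brel qA) [Var a1, Var a2'])
                  (Rel 6 (conj_brel (eq_brel qB))
                     [App (conj_brel F) [Var x', Var a1'], App F [Var x, Var a2]])))))"
  shows "bij_betw \<Phi> (row_families A B) \<F> \<and>
         bij_betw \<Phi> (magic_unitaries A B) {F \<in> \<F>. holds (\<sigma>\<^sub>1 F) \<and> holds (\<sigma>\<^sub>2 F)}"
proof -
  \<comment> \<open>an empty basis spans only the zero space\<close>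
  have pos: "0 < n"
  proof (rule ccontr)
    assume "\<not> 0 < n"
    then have "cvec.span {} = (UNIV :: 'h set)"
      using assms(4) by (simp add: orthonormal_basis_def)
    then show False
      using assms(3) by (metis UNIV_I cvec.span_empty singletonD)
  qed
  have coords: "coordinates H e"
    using assms(4) pos by unfold_locales (simp_all add: H_def)
  have bij: "bij_betw \<Phi> (row_families A B) \<F>"
    unfolding \<Phi>_def \<F>_def X_def qA_def qB_def by (rule coordinates.bij_betw_family_function[OF coords assms(2)])
  have magic: "p \<in> magic_unitaries A B \<longleftrightarrow> holds (\<sigma>\<^sub>1 (\<Phi> p)) \<and> holds (\<sigma>\<^sub>2 (\<Phi> p))"
    if p: "p \<in> row_families A B" for p :: "'l \<times> 'l \<Rightarrow> 'h \<Rightarrow> 'h"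
  proof -
    have proj: "projection (p (i, j))" if "i \<in> A" "j \<in> B" for i j
      using p that by (auto simp: row_families_def dest: PiE_mem)
    have sum: "(\<Sum>j\<in>B. p (i, j) v) = v" if "i \<in> A" for i v
      using p that by (auto simp: row_families_def fun_eq_iff)
    have F: "graded (\<Phi> p)" "src (\<Phi> p) = [{H}, classical A]" "tgt (\<Phi> p) = [classical B]"
      using proj by (simp_all add: \<Phi>_def coordinates.graded_family_function[OF coords]) (simp_all add: family_function_def)
    have spaces: "spaces (\<Phi> p) [H, Hilb i 1 False] [Hilb j 1 False] = coordinates.row H e ` range (p (i, j))"
      if "i \<in> A" "j \<in> B" for i j
      unfolding \<Phi>_def using proj[OF that] that by (rule coordinates.spaces_family_function[OF coords])
    have "holds (\<sigma>\<^sub>1 (\<Phi> p)) \<longleftrightarrow> (\<forall>j\<in>B. \<forall>v. (\<forall>i\<in>A. p (i, j) v = 0) \<longrightarrow> v = 0)"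
      unfolding \<sigma>\<^sub>1_def Let_def X_def qA_def qB_def
      using F proj spaces by (rule coordinates.holds_surjectivity_iff[OF coords])
    moreover have "holds (\<sigma>\<^sub>2 (\<Phi> p)) \<longleftrightarrow>
        (\<forall>i\<in>A. \<forall>i'\<in>A. i \<noteq> i' \<longrightarrow> (\<forall>j\<in>B. \<forall>v. p (i', j) (p (i, j) v) = 0))"
      unfolding \<sigma>\<^sub>2_def Let_def X_def qA_def qB_def
      using F proj spaces assms(2) sum by (rule coordinates.holds_injectivity_iff[OF coords])
    ultimately show ?thesis
      using coordinates.magic_unitary_iff[OF coords assms(1) p] by simp
  qed
  have "magic_unitaries A B \<subseteq> (row_families A B :: ('l \<times> 'l \<Rightarrow> 'h \<Rightarrow> 'h) set)"
    by (auto simp: magic_unitaries_def row_families_def)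
  then have "bij_betw \<Phi> (magic_unitaries A B) (\<Phi> ` magic_unitaries A B)"
    using bij by (rule bij_betw_subset[OF _ _ refl, rotated])
  moreover have "\<Phi> ` magic_unitaries A B = {F \<in> \<F>. holds (\<sigma>\<^sub>1 F) \<and> holds (\<sigma>\<^sub>2 F)}"
  proof -
    have "\<F> = \<Phi> ` row_families A B"
      using bij by (simp add: bij_betw_def)
    then show ?thesis
      using magic \<open>magic_unitaries A B \<subseteq> _\<close> by auto
  qed
  ultimately show ?thesis
    using bij by simp
qed

end
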